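(* Let $\mu$ be an offspring distribution with mean $m_\mu=\sum_{i\ge 0} i\mu(i)<1$. Assume that there exist $\beta>1$ and a slowly varying function $L$ such that, for every integer $i\ge 1$, $\mu([i,\infty))=L(i)/i^{\beta}$. Let $J$ be a real-valued random variable such that $\mathbb{P}(J\ge x)=\left(\frac{1-m_\mu}{x}\right)^{\beta}$ for $x\ge 1-m_\mu$. For every $n\ge 1$, let $\mathcal{T}_{\ge n}$ be a $\mathrm{BGW}_\mu$ tree conditioned on having at least $n$ vertices. Then the convergence $$\frac1n\cdot \mathsf{Loop}(\mathcal{T}_{\ge n})\ \xrightarrow[n\to\infty]{}\ J\cdot \mathbb{S}_1$$ holds in distribution for the Gromov--Hausdorff topology, where $\mathbb{S}_1$ is the circle of unit length.
   Context: An offspring distribution is a probability measure $\mu$ on $\mathbb{Z}_{\ge 0}$ with $\mu(0)>0$ and $\mu(0)+\mu(1)<1$; it is assumed aperiodic, i.e. $\gcd\{k\ge 1:\mu(k)>0\}=1$. A plane tree is a rooted tree in which the children of each vertex are ordered. A $\mathrm{BGW}_\mu$ tree is the random plane tree in which vertices have i.i.d. numbers of children with law $\mu$; equivalently $\mathrm{BGW}_\mu(\tau)=\prod_{u\in\tau}\mu(k_u(\tau))$ for every finite plane tree $\tau$, where $k_u(\tau)$ is the number of children of $u$ in $\tau$. For a plane tree $\tau$, $\mathsf{Loop}(\tau)$ is the graph with the same vertex set as $\tau$, with an edge between $u$ and $v$ if and only if $u$ and $v$ are consecutive children of the same parent in $\tau$, or $v$ is the first or the last child of $u$ in $\tau$.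 It is viewed as a compact metric space: its vertex set with the graph distance. For $\lambda>0$ and a metric space $(E,d)$, $\lambda\cdot E$ denotes $(E,\lambda d)$. The circle $\mathbb{S}_1$ of total length $1$ is equipped with its intrinsic (arc-length) distance. A function $L:\mathbb{R}_+\to\mathbb{R}_+$ is slowly varying if $L(\lambda x)/L(x)\to 1$ as $x\to\infty$ for every $\lambda>0$. *)

theory Defs
  imports "HOL-Probability.Probability"
begin

section \<open>The Gromov--Hausdorff space\<close>

subsection \<open>Isometries and the Gromov--Hausdorff distance\<close>

definition isometric_embedding :: "'a metric \<Rightarrow> 'b metric \<Rightarrow> ('a \<Rightarrow> 'b) \<Rightarrow> bool" where
  "isometric_embedding X Y f \<longleftrightarrow> f \<in> mspace X \<rightarrow> mspace Y \<and>
     (\<forall>x\<in>mspace X. \<forall>x'\<in>mspace X. mdist Y (f x) (f x') = mdist X x x')"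

definition isometric :: "'a metric \<Rightarrow> 'b metric \<Rightarrow> bool" where
  "isometric X Y \<longleftrightarrow> (\<exists>f. isometric_embedding X Y f \<and> f ` mspace X = mspace Y)"

definition hausdorff_dist :: "'a metric \<Rightarrow> 'a set \<Rightarrow> 'a set \<Rightarrow> real" where
  "hausdorff_dist Z A B = Inf {r. 0 \<le> r \<and> (\<forall>a\<in>A. \<exists>b\<in>B. mdist Z a b \<le> r) \<and>
                                  (\<forall>b\<in>B. \<exists>a\<in>A. mdist Z a b \<le> r)}"

text \<open>
  The infimum over all metric spaces into which both spaces embed. Only the union of the two
  images matters, so it is enough to let the ambient space range over metric spaces carried by
  subsets of the disjoint sum type.
\<close>

definition gh_dist :: "'a metric \<Rightarrow> 'b metric \<Rightarrow> real" where
  "gh_dist X Y = Inf {hausdorff_dist Z (f ` mspace X) (g ` mspace Y) | (Z :: ('a + 'b) metric) f g.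
                        isometric_embedding X Z f \<and> isometric_embedding Y Z g}"

definition compact_metric :: "'a metric \<Rightarrow> bool" where
  "compact_metric X \<longleftrightarrow> mspace X \<noteq> {} \<and> compact_space (mtopology_of X)"

lemma compact_metric_bounded:
  assumes "compact_metric X"
  obtains B where "B > 0" "\<And>x y. x \<in> mspace X \<Longrightarrow> y \<in> mspace X \<Longrightarrow> mdist X x y \<le> B"
proof -
  interpret X: Metric_space "mspace X" "mdist X" by simp
  have "compactin X.mtopology (mspace X)"
    using assms by (simp add: compact_metric_def compact_space_def mtopology_of_def)
  then have "X.mbounded (mspace X)" by (rule X.compactin_imp_mbounded)
  then show ?thesis using that by (auto simp: X.mbounded_alt_pos)
qed

lemma finite_compact_metric:
  assumes "Metric_space M d" "finite M" "M \<noteq> {}" shows "compact_metric (metric (M, d))"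
proof -
  interpret M: Metric_space M d by fact
  show ?thesis
    using assms by (simp add: compact_metric_def compact_space_def finite_imp_compactin)
qed

lemma isometric_refl: "isometric X X"
  unfolding isometric_def isometric_embedding_def by (rule exI[of _ id]) auto

lemma isometric_sym:
  assumes "isometric X Y" shows "isometric Y X"
proof -
  obtain f where f: "isometric_embedding X Y f" "f ` mspace X = mspace Y"
    using assms unfolding isometric_def by auto
  have inj: "inj_on f (mspace X)"
    using f(1) unfolding isometric_embedding_def inj_on_def by (metis mdist_zero)
  have "isometric_embedding Y X (inv_into (mspace X) f)"
    using f unfolding isometric_embedding_def
    by (smt (verit, ccfv_SIG) Pi_I f_inv_into_f inv_into_into)
  moreover have "inv_into (mspace X) f ` mspace Y = mspace X"
    using f(2) inj by (metis inv_into_image_cancel order_refl)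
  ultimately show ?thesis unfolding isometric_def by blast
qed

lemma isometric_trans:
  assumes "isometric X Y" "isometric Y Z" shows "isometric X Z"
proof -
  obtain f g where f: "isometric_embedding X Y f" "f ` mspace X = mspace Y"
    and g: "isometric_embedding Y Z g" "g ` mspace Y = mspace Z"
    using assms unfolding isometric_def by auto
  have "isometric_embedding X Z (g \<circ> f)"
    using f(1) g(1) unfolding isometric_embedding_def by (auto simp: Pi_iff)
  moreover have "(g \<circ> f) ` mspace X = mspace Z" using f(2) g(2) by (simp only: image_comp[symmetric])
  ultimately show ?thesis unfolding isometric_def by blast
qed


subsection \<open>Correspondences\<close>

text \<open>Correspondences of distortion at most \<open>2 * r\<close>; used only to derive the metric axioms.\<close>

definition gh_corr :: "'a metric \<Rightarrow> 'b metric \<Rightarrow> ('a \<times> 'b) set \<Rightarrow> real \<Rightarrow> bool" where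
  "gh_corr X Y R r \<longleftrightarrow> R \<subseteq> mspace X \<times> mspace Y \<and>
     (\<forall>x\<in>mspace X. \<exists>y. (x,y) \<in> R) \<and> (\<forall>y\<in>mspace Y. \<exists>x. (x,y) \<in> R) \<and>
     (\<forall>(x,y)\<in>R. \<forall>(x',y')\<in>R. \<bar>mdist X x x' - mdist Y y y'\<bar> \<le> 2 * r)"

lemma gh_corrI:
  assumes "\<And>x y. (x,y) \<in> R \<Longrightarrow> x \<in> mspace X \<and> y \<in> mspace Y"
    and "\<And>x. x \<in> mspace X \<Longrightarrow> \<exists>y. (x,y) \<in> R" and "\<And>y. y \<in> mspace Y \<Longrightarrow> \<exists>x. (x,y) \<in> R"
    and "\<And>x y x' y'. (x,y) \<in> R \<Longrightarrow> (x',y') \<in> R \<Longrightarrow> \<bar>mdist X x x' - mdist Y y y'\<bar> \<le> 2 * r"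
  shows "gh_corr X Y R r"
  unfolding gh_corr_def using assms by auto

lemma gh_corrD:
  assumes "gh_corr X Y R r"
  shows "(x,y) \<in> R \<Longrightarrow> x \<in> mspace X" "(x,y) \<in> R \<Longrightarrow> y \<in> mspace Y"
    "x \<in> mspace X \<Longrightarrow> \<exists>y. (x,y) \<in> R" "y \<in> mspace Y \<Longrightarrow> \<exists>x. (x,y) \<in> R"
    "(x,y) \<in> R \<Longrightarrow> (x',y') \<in> R \<Longrightarrow> \<bar>mdist X x x' - mdist Y y y'\<bar> \<le> 2 * r"
  using assms unfolding gh_corr_def by auto

lemma hausdorff_dist_set_nonempty:
  assumes X: "compact_metric X" and Y: "compact_metric Y"
    and f: "isometric_embedding X Z f" and g: "isometric_embedding Y Z g"
  shows "{r. 0 \<le> r \<and> (\<forall>a\<in>f ` mspace X. \<exists>b\<in>g ` mspace Y. mdist Z a b \<le> r) \<and>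
             (\<forall>b\<in>g ` mspace Y. \<exists>a\<in>f ` mspace X. mdist Z a b \<le> r)} \<noteq> {}"
proof -
  obtain B where B: "B > 0" "\<And>x y. x \<in> mspace X \<Longrightarrow> y \<in> mspace X \<Longrightarrow> mdist X x y \<le> B"
    using compact_metric_bounded[OF X] by blast
  obtain C where C: "C > 0" "\<And>x y. x \<in> mspace Y \<Longrightarrow> y \<in> mspace Y \<Longrightarrow> mdist Y x y \<le> C"
    using compact_metric_bounded[OF Y] by blast
  obtain x0 y0 where 0: "x0 \<in> mspace X" "y0 \<in> mspace Y"
    using X Y by (auto simp: compact_metric_def)
  define r where "r = B + C + mdist Z (f x0) (g y0)"
  have *: "mdist Z (f x) (g y) \<le> r" if "x \<in> mspace X" "y \<in> mspace Y" for x y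
  proof -
    have "f x \<in> mspace Z" "f x0 \<in> mspace Z" "g y \<in> mspace Z" "g y0 \<in> mspace Z"
      using f g that 0 by (auto simp: isometric_embedding_def)
    then have "mdist Z (f x) (g y) \<le> mdist Z (f x) (f x0) + mdist Z (f x0) (g y0) + mdist Z (g y0) (g y)"
      by (smt (verit) mdist_triangle)
    moreover have "mdist Z (f x) (f x0) = mdist X x x0" "mdist Z (g y0) (g y) = mdist Y y0 y"
      using f g that 0 by (auto simp: isometric_embedding_def)
    ultimately show ?thesis using B(2)[of x x0] C(2)[of y0 y] that 0 r_def by auto
  qed
  have "r \<ge> 0" using B(1) C(1) by (simp add: r_def)
  then show ?thesis using * 0 by blast
qed

lemma gh_corr_of_hausdorff:
  assumes X: "compact_metric X" and Y: "compact_metric Y"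
    and f: "isometric_embedding X Z f" and g: "isometric_embedding Y Z g"
    and less: "hausdorff_dist Z (f ` mspace X) (g ` mspace Y) < r"
  shows "\<exists>R. gh_corr X Y R r"
proof -
  obtain s where s: "0 \<le> s" "s < r" "\<forall>a\<in>f ` mspace X. \<exists>b\<in>g ` mspace Y. mdist Z a b \<le> s"
     "\<forall>b\<in>g ` mspace Y. \<exists>a\<in>f ` mspace X. mdist Z a b \<le> s"
    using cInf_lessD[OF hausdorff_dist_set_nonempty[OF X Y f g] less[unfolded hausdorff_dist_def]]
    by blast
  define R where "R = {(x,y). x \<in> mspace X \<and> y \<in> mspace Y \<and> mdist Z (f x) (g y) \<le> s}"
  have "\<bar>mdist X x x' - mdist Y y y'\<bar> \<le> 2 * r" if "(x,y) \<in> R" "(x',y') \<in> R" for x y x' y'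
  proof -
    have m: "f x \<in> mspace Z" "f x' \<in> mspace Z" "g y \<in> mspace Z" "g y' \<in> mspace Z"
      using f g that by (auto simp: isometric_embedding_def R_def)
    have e: "mdist Z (f x) (f x') = mdist X x x'" "mdist Z (g y) (g y') = mdist Y y y'"
      using f g that by (auto simp: isometric_embedding_def R_def)
    have d: "mdist Z (f x) (g y) \<le> s" "mdist Z (f x') (g y') \<le> s" using that by (auto simp: R_def)
    have "mdist Z (f x) (f x') \<le> mdist Z (f x) (g y) + mdist Z (g y) (g y') + mdist Z (f x') (g y')"
      using m by (smt (verit) mdist_triangle mdist_commute)
    moreover have "mdist Z (g y) (g y') \<le> mdist Z (f x) (g y) + mdist Z (f x) (f x') + mdist Z (f x') (g y')"
      using m by (smt (verit) mdist_triangle mdist_commute)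
    ultimately show ?thesis using e d s by linarith
  qed
  then have "gh_corr X Y R r"
    using s(3,4) by (intro gh_corrI) (auto simp: R_def)
  then show ?thesis by blast
qed

lemma gh_corr_imp_embedding:
  fixes X :: "'a metric" and Y :: "'b metric"
  assumes X: "compact_metric X" and R: "gh_corr X Y R r" and r: "r > 0"
  shows "\<exists>(Z :: ('a + 'b) metric) f g. isometric_embedding X Z f \<and> isometric_embedding Y Z g \<and>
           hausdorff_dist Z (f ` mspace X) (g ` mspace Y) \<le> r"
proof -
  have Rne: "R \<noteq> {}" using X R by (fastforce simp: compact_metric_def gh_corr_def)
  note Rm = gh_corrD(1,2)[OF R]
  have Rd: "\<bar>mdist X a a' - mdist Y b b'\<bar> \<le> 2 * r" if "(a,b) \<in> R" "(a',b') \<in> R" for a b a' b'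
    by (rule gh_corrD(5)[OF R that])
  define h where "h x y = (INF p\<in>R. mdist X x (fst p) + mdist Y y (snd p))" for x y
  have bdd: "bdd_below ((\<lambda>p. mdist X x (fst p) + mdist Y y (snd p)) ` R)" for x y
    by (rule bdd_belowI2[of _ 0]) simp
  have h0: "0 \<le> h x y" for x y
    unfolding h_def by (rule cINF_greatest[OF Rne]) simp
  have h_le: "h x y \<le> mdist X x a + mdist Y y b" if "(a,b) \<in> R" for x y a b
    unfolding h_def using cINF_lower[OF bdd that] by simp
  have h_ge: "c \<le> h x y" if "\<And>a b. (a,b) \<in> R \<Longrightarrow> c \<le> mdist X x a + mdist Y y b" for x y c
    unfolding h_def by (rule cINF_greatest[OF Rne]) (use that in auto)
  define d where "d u v = (case (u,v) of (Inl x, Inl x') \<Rightarrow> mdist X x x' | (Inr y, Inr y') \<Rightarrow> mdist Y y y'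
      | (Inl x, Inr y) \<Rightarrow> r + h x y | (Inr y, Inl x) \<Rightarrow> r + h x y)" for u v :: "'a + 'b"
  have d[simp]: "d (Inl x) (Inl x') = mdist X x x'" "d (Inr y) (Inr y') = mdist Y y y'"
     "d (Inl x) (Inr y) = r + h x y" "d (Inr y) (Inl x) = r + h x y" for x x' y y'
    by (auto simp: d_def)
  define S where "S = Inl ` mspace X \<union> Inr ` mspace Y"
  have t1: "h x y \<le> mdist X x x' + h x' y"
    if "x \<in> mspace X" "x' \<in> mspace X" "y \<in> mspace Y" for x x' y
  proof -
    have "h x y - mdist X x x' \<le> h x' y"
    proof (rule h_ge)
      fix a b assume ab: "(a,b) \<in> R"
      show "h x y - mdist X x x' \<le> mdist X x' a + mdist Y y b"
        using h_le[OF ab, of x y] mdist_triangle[of x X x' a] that Rm[OF ab] by linarith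
    qed
    then show ?thesis by simp
  qed
  have t2: "h x y \<le> mdist Y y y' + h x y'"
    if "x \<in> mspace X" "y' \<in> mspace Y" "y \<in> mspace Y" for x y y'
  proof -
    have "h x y - mdist Y y y' \<le> h x y'"
    proof (rule h_ge)
      fix a b assume ab: "(a,b) \<in> R"
      show "h x y - mdist Y y y' \<le> mdist X x a + mdist Y y' b"
        using h_le[OF ab, of x y] mdist_triangle[of y Y y' b] that Rm[OF ab] by linarith
    qed
    then show ?thesis by simp
  qed
  have t3: "mdist X x x' \<le> 2 * r + h x y + h x' y"
    if "x \<in> mspace X" "x' \<in> mspace X" "y \<in> mspace Y" for x x' y
  proof -
    have "mdist X x x' - 2 * r - h x' y \<le> h x y"
    proof (rule h_ge)
      fix a b assume ab: "(a,b) \<in> R"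
      have "mdist X x x' - 2 * r - (mdist X x a + mdist Y y b) \<le> h x' y"
      proof (rule h_ge)
        fix a' b' assume ab': "(a',b') \<in> R"
        have "mdist X x x' \<le> mdist X x a + mdist X a a' + mdist X x' a'"
          using that Rm[OF ab] Rm[OF ab'] by (smt (verit) mdist_triangle mdist_commute)
        moreover have "mdist Y b b' \<le> mdist Y y b + mdist Y y b'"
          using that Rm[OF ab] Rm[OF ab'] by (smt (verit) mdist_triangle mdist_commute)
        ultimately show "mdist X x x' - 2 * r - (mdist X x a + mdist Y y b) \<le> mdist X x' a' + mdist Y y b'"
          using Rd[OF ab ab'] by linarith
      qed
      then show "mdist X x x' - 2 * r - h x' y \<le> mdist X x a + mdist Y y b" by linarith
    qed
    then show ?thesis by linarith
  qed
  have t4: "mdist Y y y' \<le> 2 * r + h x y + h x y'"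
    if "x \<in> mspace X" "y \<in> mspace Y" "y' \<in> mspace Y" for x y y'
  proof -
    have "mdist Y y y' - 2 * r - h x y' \<le> h x y"
    proof (rule h_ge)
      fix a b assume ab: "(a,b) \<in> R"
      have "mdist Y y y' - 2 * r - (mdist X x a + mdist Y y b) \<le> h x y'"
      proof (rule h_ge)
        fix a' b' assume ab': "(a',b') \<in> R"
        have "mdist Y y y' \<le> mdist Y y b + mdist Y b b' + mdist Y y' b'"
          using that Rm[OF ab] Rm[OF ab'] by (smt (verit) mdist_triangle mdist_commute)
        moreover have "mdist X a a' \<le> mdist X x a + mdist X x a'"
          using that Rm[OF ab] Rm[OF ab'] by (smt (verit) mdist_triangle mdist_commute)
        ultimately show "mdist Y y y' - 2 * r - (mdist X x a + mdist Y y b) \<le> mdist X x a' + mdist Y y' b'"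
          using Rd[OF ab ab'] by linarith
      qed
      then show "mdist Y y y' - 2 * r - h x y' \<le> mdist X x a + mdist Y y b" by linarith
    qed
    then show ?thesis by linarith
  qed
  interpret Z: Metric_space S d
  proof
    fix u v show "0 \<le> d u v" using r h0 by (cases u; cases v; simp add: add_nonneg_nonneg)
  next
    fix u v show "d u v = d v u" by (cases u; cases v; simp add: mdist_commute)
  next
    fix u v assume "u \<in> S" "v \<in> S"
    then show "(d u v = 0) = (u = v)"
      using r h0 by (auto simp: S_def add_pos_nonneg less_imp_neq[symmetric] not_le)
  next
    fix u v w assume *: "u \<in> S" "v \<in> S" "w \<in> S"
    show "d u w \<le> d u v + d v w"
    proof (cases u; cases v; cases w)
      fix a b c assume "u = Inl a" "v = Inl b" "w = Inl c"
      then show ?thesis using * by (auto simp: S_def intro: mdist_triangle)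
    next
      fix a b c assume "u = Inr a" "v = Inr b" "w = Inr c"
      then show ?thesis using * by (auto simp: S_def intro: mdist_triangle)
    next
      fix a b c assume "u = Inl a" "v = Inl b" "w = Inr c"
      then show ?thesis using * t1[of a b c] by (auto simp: S_def)
    next
      fix a b c assume "u = Inl a" "v = Inr b" "w = Inl c"
      then show ?thesis using * t3[of a c b] by (auto simp: S_def)
    next
      fix a b c assume "u = Inl a" "v = Inr b" "w = Inr c"
      then show ?thesis using * t2[of a b c] by (auto simp: S_def mdist_commute)
    next
      fix a b c assume "u = Inr a" "v = Inl b" "w = Inl c"
      then show ?thesis using * t1[of c b a] by (auto simp: S_def mdist_commute)
    next
      fix a b c assume "u = Inr a" "v = Inl b" "w = Inr c"
      then show ?thesis using * t4[of b a c] by (auto simp: S_def)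
    next
      fix a b c assume "u = Inr a" "v = Inr b" "w = Inl c"
      then show ?thesis using * t2[of c b a] by (auto simp: S_def)
    qed
  qed
  let ?Z = "metric (S, d)"
  have e: "isometric_embedding X ?Z Inl" "isometric_embedding Y ?Z Inr"
    unfolding isometric_embedding_def Z.mspace_metric Z.mdist_metric by (auto simp: S_def)
  have hR: "h a b = 0" if "(a,b) \<in> R" for a b
  proof -
    have "mdist X a a = 0" "mdist Y b b = 0" using Rm[OF that] by simp_all
    then show ?thesis using h_le[OF that, of a b] h0[of a b] by linarith
  qed
  have "hausdorff_dist ?Z (Inl ` mspace X) (Inr ` mspace Y) \<le> r"
    unfolding hausdorff_dist_def
  proof (rule cInf_lower)
    have "\<exists>b\<in>mspace Y. d (Inl x) (Inr b) \<le> r" if x: "x \<in> mspace X" for x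
    proof -
      obtain y where "(x,y) \<in> R" using R x by (auto simp: gh_corr_def)
      then show ?thesis using hR Rm by force
    qed
    moreover have "\<exists>a\<in>mspace X. d (Inl a) (Inr y) \<le> r" if y: "y \<in> mspace Y" for y
    proof -
      obtain x where "(x,y) \<in> R" using R y by (auto simp: gh_corr_def)
      then show ?thesis using hR Rm by force
    qed
    ultimately show "r \<in> {r. 0 \<le> r \<and> (\<forall>a\<in>Inl ` mspace X. \<exists>b\<in>Inr ` mspace Y. mdist ?Z a b \<le> r) \<and>
        (\<forall>b\<in>Inr ` mspace Y. \<exists>a\<in>Inl ` mspace X. mdist ?Z a b \<le> r)}"
      using r by (simp del: d)
  qed (rule bdd_belowI[of _ 0], simp)
  then show ?thesis using e by blast
qed

lemma hausdorff_dist_embed_nonneg: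
  assumes "compact_metric X" "compact_metric Y"
    "isometric_embedding X Z f" "isometric_embedding Y Z g"
  shows "0 \<le> hausdorff_dist Z (f ` mspace X) (g ` mspace Y)"
  unfolding hausdorff_dist_def
  by (rule cInf_greatest[OF hausdorff_dist_set_nonempty[OF assms]]) simp

lemma gh_dist_le:
  assumes X: "compact_metric X" and Y: "compact_metric Y" and R: "gh_corr X Y R r" and r: "r > 0"
  shows "gh_dist X Y \<le> r"
proof -
  obtain Z :: "('a + 'b) metric" and f g where
    *: "isometric_embedding X Z f" "isometric_embedding Y Z g"
    and le: "hausdorff_dist Z (f ` mspace X) (g ` mspace Y) \<le> r"
    using gh_corr_imp_embedding[OF X R r] by blast
  have "gh_dist X Y \<le> hausdorff_dist Z (f ` mspace X) (g ` mspace Y)"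
    unfolding gh_dist_def
    by (rule cInf_lower, use * in blast, rule bdd_belowI[of _ 0])
      (use hausdorff_dist_embed_nonneg[OF X Y] in blast)
  then show ?thesis using le by simp
qed

lemma gh_corr_exists:
  assumes X: "compact_metric X" and Y: "compact_metric Y"
  obtains r where "r > 0" "gh_corr X Y (mspace X \<times> mspace Y) r"
proof -
  obtain B where B: "B > 0" "\<And>x y. x \<in> mspace X \<Longrightarrow> y \<in> mspace X \<Longrightarrow> mdist X x y \<le> B"
    using compact_metric_bounded[OF X] by blast
  obtain C where C: "C > 0" "\<And>x y. x \<in> mspace Y \<Longrightarrow> y \<in> mspace Y \<Longrightarrow> mdist Y x y \<le> C"
    using compact_metric_bounded[OF Y] by blast
  have "\<bar>mdist X x x' - mdist Y y y'\<bar> \<le> 2 * (B + C)"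
    if "x \<in> mspace X" "x' \<in> mspace X" "y \<in> mspace Y" "y' \<in> mspace Y" for x x' y y'
    using B(2)[OF that(1,2)] C(2)[OF that(3,4)] mdist_nonneg[of X x x'] mdist_nonneg[of Y y y'] B(1) C(1)
    by (smt (verit))
  then have "gh_corr X Y (mspace X \<times> mspace Y) (B + C)"
    using X Y unfolding gh_corr_def compact_metric_def by blast
  then show ?thesis using that[of "B + C"] B(1) C(1) by simp
qed

lemma gh_dist_set_nonempty:
  assumes X: "compact_metric (X :: 'a metric)" and Y: "compact_metric (Y :: 'b metric)"
  shows "{hausdorff_dist Z (f ` mspace X) (g ` mspace Y) | (Z :: ('a + 'b) metric) f g.
                        isometric_embedding X Z f \<and> isometric_embedding Y Z g} \<noteq> {}"
proof -
  obtain r where r: "r > 0" "gh_corr X Y (mspace X \<times> mspace Y) r"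
    using gh_corr_exists[OF X Y] .
  show ?thesis using gh_corr_imp_embedding[OF X r(2,1)] by auto
qed

lemma gh_dist_lessD:
  fixes X :: "'a metric" and Y :: "'b metric"
  assumes X: "compact_metric X" and Y: "compact_metric Y" and less: "gh_dist X Y < r"
  shows "\<exists>R. gh_corr X Y R r"
proof -
  obtain Z :: "('a + 'b) metric" and f g where
    "isometric_embedding X Z f" "isometric_embedding Y Z g"
    "hausdorff_dist Z (f ` mspace X) (g ` mspace Y) < r"
    using cInf_lessD[OF gh_dist_set_nonempty[OF X Y] less[unfolded gh_dist_def]] by auto
  then show ?thesis by (rule gh_corr_of_hausdorff[OF X Y])
qed

lemma gh_dist_nonneg:
  assumes X: "compact_metric X" and Y: "compact_metric Y"
  shows "0 \<le> gh_dist X Y"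
  unfolding gh_dist_def
  by (rule cInf_greatest[OF gh_dist_set_nonempty[OF X Y]])
    (use hausdorff_dist_embed_nonneg[OF X Y] in blast)

lemma gh_dist_commute_le:
  assumes X: "compact_metric X" and Y: "compact_metric Y"
  shows "gh_dist Y X \<le> gh_dist X Y"
proof (rule dense_ge)
  fix r assume r: "gh_dist X Y < r"
  then obtain R where "gh_corr X Y R r" using gh_dist_lessD[OF X Y] by blast
  then have "gh_corr Y X (R\<inverse>) r"
    by (intro gh_corrI) (auto simp: gh_corrD abs_minus_commute)
  then show "gh_dist Y X \<le> r" using gh_dist_le[OF Y X] r gh_dist_nonneg[OF X Y] by simp
qed

lemma gh_dist_commute:
  assumes X: "compact_metric X" and Y: "compact_metric Y"
  shows "gh_dist X Y = gh_dist Y X"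
  using gh_dist_commute_le[OF X Y] gh_dist_commute_le[OF Y X] by simp

lemma gh_dist_triangle:
  assumes X: "compact_metric X" and Y: "compact_metric Y" and W: "compact_metric W"
  shows "gh_dist X W \<le> gh_dist X Y + gh_dist Y W"
proof (rule field_le_epsilon)
  fix e :: real assume e: "e > 0"
  define s t where "s = gh_dist X Y + e/2" and "t = gh_dist Y W + e/2"
  have st: "s > 0" "t > 0" using e gh_dist_nonneg[OF X Y] gh_dist_nonneg[OF Y W] by (auto simp: s_def t_def)
  obtain R where R: "gh_corr X Y R s" using gh_dist_lessD[OF X Y, of s] e by (auto simp: s_def)
  obtain Q where Q: "gh_corr Y W Q t" using gh_dist_lessD[OF Y W, of t] e by (auto simp: t_def)
  have "gh_corr X W (R O Q) (s + t)"
  proof (rule gh_corrI)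
    show "x \<in> mspace X \<and> w \<in> mspace W" if "(x,w) \<in> R O Q" for x w
      using that gh_corrD(1)[OF R] gh_corrD(2)[OF Q] by blast
    show "\<exists>w. (x, w) \<in> R O Q" if "x \<in> mspace X" for x
      by (meson that gh_corrD(2,3)[OF R] gh_corrD(3)[OF Q] relcompI)
    show "\<exists>x. (x, w) \<in> R O Q" if "w \<in> mspace W" for w
      by (meson that gh_corrD(4)[OF R] gh_corrD(1,4)[OF Q] relcompI)
    fix x w x' w' assume "(x,w) \<in> R O Q" "(x',w') \<in> R O Q"
    then obtain y y' where 1: "(x,y) \<in> R" "(y,w) \<in> Q" and 2: "(x',y') \<in> R" "(y',w') \<in> Q"
      by blast
    show "\<bar>mdist X x x' - mdist W w w'\<bar> \<le> 2 * (s + t)"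
      using gh_corrD(5)[OF R 1(1) 2(1)] gh_corrD(5)[OF Q 1(2) 2(2)] by (smt (verit))
  qed
  from gh_dist_le[OF X W this] st show "gh_dist X W \<le> gh_dist X Y + gh_dist Y W + e"
    by (simp add: s_def t_def)
qed

lemma gh_dist_isometric:
  assumes X: "compact_metric X" and Y: "compact_metric Y" and iso: "isometric X Y"
  shows "gh_dist X Y = 0"
proof -
  obtain f where f: "isometric_embedding X Y f" "f ` mspace X = mspace Y"
    using iso unfolding isometric_def by auto
  have "gh_dist X Y \<le> r" if "r > 0" for r
  proof (rule gh_dist_le[OF X Y _ that])
    show "gh_corr X Y {(x, f x) | x. x \<in> mspace X} r"
      by (rule gh_corrI) (use f that in \<open>auto simp: isometric_embedding_def\<close>)
  qed
  then have "gh_dist X Y \<le> 0" by (rule dense_ge)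
  with gh_dist_nonneg[OF X Y] show ?thesis by simp
qed

lemma gh_dist_cong:
  assumes "compact_metric X" "compact_metric X'" "compact_metric Y" "compact_metric Y'"
    and "isometric X X'" "isometric Y Y'"
  shows "gh_dist X Y = gh_dist X' Y'"
proof -
  have "gh_dist X X' = 0" "gh_dist X' X = 0" "gh_dist Y Y' = 0" "gh_dist Y' Y = 0"
    using assms by (auto intro!: gh_dist_isometric intro: isometric_sym)
  then show ?thesis
    using assms gh_dist_triangle[of X X' Y] gh_dist_triangle[of X' Y' Y]
      gh_dist_triangle[of X' X Y'] gh_dist_triangle[of X Y Y'] by simp
qed

lemma gh_dist_zero_embedding:
  assumes X: "compact_metric X" and Y: "compact_metric Y" and zero: "gh_dist X Y = 0"
  shows "\<exists>f. isometric_embedding X Y f"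
proof -
  let ?P = "product_topology (\<lambda>_. mtopology_of Y) (mspace X)"
  define C where "C n = {f \<in> topspace ?P. \<forall>x\<in>mspace X. \<forall>x'\<in>mspace X.
      \<bar>mdist Y (f x) (f x') - mdist X x x'\<bar> \<le> 2 * inverse (real (Suc n))}" for n
  have cpt: "compact_space ?P"
    using Y by (simp add: compact_space_product_topology compact_metric_def)
  have ne: "C n \<noteq> {}" for n
  proof -
    obtain R where R: "gh_corr X Y R (inverse (real (Suc n)))"
      using gh_dist_lessD[OF X Y, of "inverse (real (Suc n))"] zero by auto
    then have "\<forall>x\<in>mspace X. \<exists>y. (x,y) \<in> R" by (simp add: gh_corr_def)
    then obtain f where f: "\<And>x. x \<in> mspace X \<Longrightarrow> (x, f x) \<in> R" by metis
    have "f x \<in> mspace Y" if "x \<in> mspace X" for x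
      using f[OF that] R by (auto simp: gh_corr_def)
    moreover have "\<bar>mdist Y (f x) (f x') - mdist X x x'\<bar> \<le> 2 * inverse (real (Suc n))"
      if "x \<in> mspace X" "x' \<in> mspace X" for x x'
    proof -
      have "\<bar>mdist X x x' - mdist Y (f x) (f x')\<bar> \<le> 2 * inverse (real (Suc n))"
        by (rule gh_corrD(5)[OF R f[OF that(1)] f[OF that(2)]])
      then show ?thesis by (subst abs_minus_commute)
    qed
    ultimately have "restrict f (mspace X) \<in> C n"
      by (simp add: C_def del: of_nat_Suc)
    then show ?thesis by blast
  qed
  have closed: "closedin ?P (C n)" for n
  proof -
    have 1: "closedin ?P {f \<in> topspace ?P. \<bar>mdist Y (f x) (f x') - mdist X x x'\<bar> \<in> {..2 * inverse (real (Suc n))}}"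
      if "x \<in> mspace X" "x' \<in> mspace X" for x x'
    proof (rule closedin_continuous_map_preimage)
      show "continuous_map ?P euclidean (\<lambda>f. \<bar>mdist Y (f x) (f x') - mdist X x x'\<bar>)"
        by (intro continuous_map_real_abs continuous_map_diff continuous_map_mdist
            continuous_map_product_projection that continuous_map_canonical_const)
    qed simp
    have eq: "C n = (\<Inter>x\<in>mspace X. \<Inter>x'\<in>mspace X.
        {f \<in> topspace ?P. \<bar>mdist Y (f x) (f x') - mdist X x x'\<bar> \<in> {..2 * inverse (real (Suc n))}})"
      using X unfolding C_def compact_metric_def by blast
    show ?thesis
      unfolding eq using X 1 by (intro closedin_Inter) (auto simp: compact_metric_def)
  qed
  have dec: "C n \<subseteq> C m" if "m \<le> n" for m n
  proof -
    have "inverse (real (Suc n)) \<le> inverse (real (Suc m))"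
      using that by (intro le_imp_inverse_le) auto
    then show ?thesis unfolding C_def by (smt (verit) Collect_mono_iff)
  qed
  have "(\<Inter>n. C n) \<noteq> {}"
    by (rule compact_space_imp_nest[OF cpt]) (use ne closed dec in \<open>simp_all add: decseq_def\<close>)
  then obtain f where f: "\<And>n. f \<in> C n" by auto
  have fm: "f \<in> mspace X \<rightarrow> mspace Y" using f[of 0] by (auto simp: C_def)
  have "mdist Y (f x) (f x') = mdist X x x'" if "x \<in> mspace X" "x' \<in> mspace X" for x x'
  proof -
    have b: "\<bar>mdist Y (f x) (f x') - mdist X x x'\<bar> \<le> 2 * inverse (real (Suc n))" for n
      using f[of n] that by (simp add: C_def del: of_nat_Suc)
    have "(\<lambda>n. 2 * inverse (real (Suc n))) \<longlonglongrightarrow> 2 * 0"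
      by (intro tendsto_intros LIMSEQ_inverse_real_of_nat)
    then have "\<bar>mdist Y (f x) (f x') - mdist X x x'\<bar> \<le> 2 * 0"
      by (rule LIMSEQ_le_const) (use b in blast)
    then show ?thesis by simp
  qed
  with fm show ?thesis unfolding isometric_embedding_def by blast
qed

lemma compact_self_embedding_surj:
  assumes X: "compact_metric X" and h: "isometric_embedding X X h"
  shows "h ` mspace X = mspace X"
proof (rule ccontr)
  assume neq: "h ` mspace X \<noteq> mspace X"
  interpret X: Metric_space "mspace X" "mdist X" by simp
  have cpt: "compact_space X.mtopology" using X by (simp add: compact_metric_def mtopology_of_def)
  have hm: "h x \<in> mspace X" if "x \<in> mspace X" for x using h that by (auto simp: isometric_embedding_def)
  have hd: "mdist X (h x) (h y) = mdist X x y" if "x \<in> mspace X" "y \<in> mspace X" for x y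
    using h that by (auto simp: isometric_embedding_def)
  obtain x where x: "x \<in> mspace X" "x \<notin> h ` mspace X" using neq hm by blast
  have "continuous_map X.mtopology X.mtopology h"
    unfolding X.metric_continuous_map[OF Metric_space_mspace_mdist]
    using hm hd by (auto simp: Pi_iff)
  then have "compactin X.mtopology (h ` mspace X)"
    using image_compactin cpt by (fastforce simp: compact_space_def)
  then have "closedin X.mtopology (h ` mspace X)"
    by (simp add: compactin_imp_closedin X.Hausdorff_space_mtopology)
  then obtain e where e: "e > 0" "disjnt (h ` mspace X) (X.mball x e)"
    using x unfolding X.closedin_metric by blast
  define s where "s n = (h ^^ n) x" for n
  have sm: "s n \<in> mspace X" for n by (induction n) (auto simp: s_def x hm)
  have sd: "mdist X (s (m + k)) (s (n + k)) = mdist X (s m) (s n)" for m n k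
    by (induction k) (use hd sm in \<open>auto simp: s_def\<close>)
  have far: "mdist X (s m) (s n) \<ge> e" if mn: "m < n" for m n
  proof -
    have "mdist X (s m) (s n) = mdist X x (s (n - m))"
      using sd[of 0 m "n - m"] that by (simp add: s_def)
    moreover have "s (n - m) \<in> h ` mspace X"
    proof -
      obtain j where j: "n - m = Suc j" using mn by (cases "n - m") simp_all
      have "s (n - m) = h (s j)" by (simp add: j s_def)
      then show ?thesis using sm[of j] by simp
    qed
    ultimately show ?thesis using e sm x by (force simp: disjnt_iff not_less)
  qed
  obtain l r where lr: "strict_mono r" "limitin X.mtopology (s \<circ> r) l sequentially"
    using cpt[unfolded X.compact_space_sequentially] sm by blast
  have "X.MCauchy (s \<circ> r)" by (rule X.convergent_imp_MCauchy[OF _ lr(2)]) (use sm in auto)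
  then obtain N where "\<forall>n n'. N \<le> n \<longrightarrow> N \<le> n' \<longrightarrow> mdist X ((s \<circ> r) n) ((s \<circ> r) n') < e"
    using e(1) unfolding X.MCauchy_def by blast
  then have "mdist X (s (r N)) (s (r (Suc N))) < e" by simp
  moreover have "r N < r (Suc N)" using lr(1) by (simp add: strict_mono_def)
  ultimately show False using far by fastforce
qed

lemma gh_dist_zero_isometric:
  assumes X: "compact_metric X" and Y: "compact_metric Y" and zero: "gh_dist X Y = 0"
  shows "isometric X Y"
proof -
  have "gh_dist Y X = 0" using gh_dist_commute[OF Y X] zero by (rule trans)
  then obtain f g where f: "isometric_embedding X Y f" and g: "isometric_embedding Y X g"
    using gh_dist_zero_embedding[OF X Y zero] gh_dist_zero_embedding[OF Y X] by blast
  have "isometric_embedding Y Y (f \<circ> g)" using f g by (auto simp: isometric_embedding_def Pi_iff)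
  then have "(f \<circ> g) ` mspace Y = mspace Y" by (rule compact_self_embedding_surj[OF Y])
  then have "mspace Y = f ` g ` mspace Y" by (simp only: image_comp)
  also have "\<dots> \<subseteq> f ` mspace X"
    using g by (intro image_mono) (auto simp: isometric_embedding_def)
  finally have "f ` mspace X = mspace Y"
    using f by (auto simp: isometric_embedding_def)
  with f show ?thesis unfolding isometric_def by blast
qed


subsection \<open>The space of isometry classes\<close>

text \<open>
  A compact metric space has at most the cardinality of the continuum, so every nonempty compact
  metric space is isometric to one carried by a set of real numbers (in general not with the
  Euclidean distance).
\<close>

definition gh_rel :: "real metric \<Rightarrow> real metric \<Rightarrow> bool" where
  "gh_rel X Y \<longleftrightarrow> compact_metric X \<and> compact_metric Y \<and> isometric X Y"

lemma gh_rel_exists: "\<exists>X. gh_rel X X"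
proof -
  have "Metric_space {0} (\<lambda>_ _. 0)" by unfold_locales auto
  then have "compact_metric (metric ({0}, \<lambda>_ _. 0))" by (rule finite_compact_metric) simp_all
  then show ?thesis using isometric_refl unfolding gh_rel_def by auto
qed

lemma part_equivp_gh_rel: "part_equivp gh_rel"
proof (rule part_equivpI)
  show "\<exists>X. gh_rel X X" by (rule gh_rel_exists)
  show "symp gh_rel" unfolding gh_rel_def by (intro sympI) (simp add: isometric_sym)
  show "transp gh_rel" unfolding gh_rel_def by (intro transpI) (metis isometric_trans)
qed

quotient_type gh_space = "real metric" / partial: gh_rel
  by (rule part_equivp_gh_rel)

instantiation gh_space :: metric_space
begin

lift_definition dist_gh_space :: "gh_space \<Rightarrow> gh_space \<Rightarrow> real" is gh_dist
  unfolding gh_rel_def by (rule gh_dist_cong) auto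

definition uniformity_gh_space :: "(gh_space \<times> gh_space) filter" where
  "uniformity_gh_space = (INF e\<in>{0<..}. principal {(x, y). dist x y < e})"

definition open_gh_space :: "gh_space set \<Rightarrow> bool" where
  "open_gh_space U = (\<forall>x\<in>U. eventually (\<lambda>(x', y). x' = x \<longrightarrow> y \<in> U) uniformity)"

instance
proof
  fix x y z :: gh_space
  show "dist x y = 0 \<longleftrightarrow> x = y"
    by transfer (metis gh_rel_def gh_dist_isometric gh_dist_zero_isometric)
  show "dist x y \<le> dist x z + dist y z"
    by transfer (metis gh_rel_def gh_dist_triangle gh_dist_commute)
qed (simp_all only: uniformity_gh_space_def open_gh_space_def)

end

lemma isometric_compact_metric:
  assumes X: "compact_metric X" and iso: "isometric X Y" shows "compact_metric Y"
proof -
  obtain f where f: "isometric_embedding X Y f" "f ` mspace X = mspace Y"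
    using iso unfolding isometric_def by auto
  interpret X: Metric_space "mspace X" "mdist X" by simp
  interpret Y: Metric_space "mspace Y" "mdist Y" by simp
  have "continuous_map X.mtopology Y.mtopology f"
    unfolding X.metric_continuous_map[OF Metric_space_mspace_mdist]
    using f(1) by (auto simp: isometric_embedding_def Pi_iff)
  moreover have "compactin X.mtopology (mspace X)"
    using X by (simp add: compact_metric_def compact_space_def mtopology_of_def)
  ultimately have "compactin Y.mtopology (f ` mspace X)" by (rule image_compactin[rotated])
  then show ?thesis
    using X f(2) by (auto simp: compact_metric_def compact_space_def mtopology_of_def)
qed

lemma compact_metric_inj_real:
  fixes X :: "'a metric"
  assumes X: "compact_metric X"
  obtains h :: "'a \<Rightarrow> real" where "inj_on h (mspace X)"
proof -
  interpret X: Metric_space "mspace X" "mdist X" by simp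
  have "compactin X.mtopology (mspace X)"
    using X by (simp add: compact_metric_def compact_space_def mtopology_of_def)
  then have tb: "X.mtotally_bounded (mspace X)" by (rule X.compactin_imp_mtotally_bounded)
  have "\<exists>K. finite K \<and> K \<subseteq> mspace X \<and> mspace X \<subseteq> (\<Union>x\<in>K. X.mball x (inverse (real (Suc n))))" for n
    using tb unfolding X.mtotally_bounded_def by (auto simp del: of_nat_Suc)
  then obtain K where K: "\<And>n. finite (K n)" "\<And>n. K n \<subseteq> mspace X"
    "\<And>n. mspace X \<subseteq> (\<Union>x\<in>K n. X.mball x (inverse (real (Suc n))))" by metis
  define D where "D = (\<Union>n. K n)"
  have D: "countable D" unfolding D_def by (intro countable_UN) (simp_all add: K(1) countable_finite)
  define code where "code x = {k. \<exists>a\<in>D. \<exists>q::rat. k = to_nat (to_nat_on D a, q) \<and> mdist X a x < of_rat q}" for x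
  have "inj_on code (mspace X)"
  proof (rule inj_onI, rule ccontr)
    fix x y assume xy: "x \<in> mspace X" "y \<in> mspace X" and eq: "code x = code y" and neq: "x \<noteq> y"
    have "mdist X x y / 2 > 0" using xy neq by simp
    then obtain n where n: "inverse (real (Suc n)) < mdist X x y / 2" using reals_Archimedean by blast
    obtain a where a: "a \<in> K n" "mdist X a x < inverse (real (Suc n))"
      using K(3)[of n] xy(1) by auto
    have aD: "a \<in> D" "a \<in> mspace X" using a(1) K(2) by (auto simp: D_def)
    obtain q where q: "mdist X a x < of_rat q" "of_rat q < mdist X x y / 2"
      using of_rat_dense[of "mdist X a x" "mdist X x y / 2"] a(2) n by auto
    have "to_nat (to_nat_on D a, q) \<in> code y" unfolding eq[symmetric] using aD q(1) by (auto simp: code_def)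
    then obtain b q' where b: "b \<in> D" "to_nat (to_nat_on D a, q) = to_nat (to_nat_on D b, q')"
       "mdist X b y < of_rat q'" unfolding code_def by blast
    then have "to_nat_on D a = to_nat_on D b" "q' = q" by simp_all
    with aD(1) b(1) D have "b = a" by simp
    with b \<open>q' = q\<close> have "mdist X a y < of_rat q" by simp
    moreover have "mdist X x y \<le> mdist X a x + mdist X a y"
      using xy aD(2) by (metis mdist_triangle mdist_commute)
    ultimately show False using q by linarith
  qed
  moreover obtain g :: "nat set \<Rightarrow> real" where "bij g"
    using nat_sets_eqpoll_reals unfolding eqpoll_def by auto
  ultimately have "inj_on (g \<circ> code) (mspace X)"
    by (intro comp_inj_on) (auto dest: bij_is_inj intro: inj_on_subset)
  then show ?thesis using that by blast
qed

lemma compact_metric_real_model: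
  fixes X :: "'a metric"
  assumes X: "compact_metric X"
  shows "\<exists>Y :: real metric. isometric X Y"
proof -
  obtain h :: "'a \<Rightarrow> real" where h: "inj_on h (mspace X)" using compact_metric_inj_real[OF X] .
  let ?i = "inv_into (mspace X) h"
  interpret Y: Metric_space "h ` mspace X" "\<lambda>s t. mdist X (?i s) (?i t)"
  proof
    fix s t assume "s \<in> h ` mspace X" "t \<in> h ` mspace X"
    then show "(mdist X (?i s) (?i t) = 0) = (s = t)" using h by (auto simp: inj_on_eq_iff)
  qed (use h in \<open>auto simp: mdist_commute intro: mdist_triangle inv_into_into\<close>)
  have "isometric X (metric (h ` mspace X, \<lambda>s t. mdist X (?i s) (?i t)))"
    unfolding isometric_def isometric_embedding_def Y.mspace_metric Y.mdist_metric
    using h by (intro exI[of _ h]) auto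
  then show ?thesis by blast
qed

text \<open>
  By the preceding lemma a real model exists for every nonempty compact \<open>X\<close>; on other arguments the
  value is irrelevant.
\<close>

definition gh_class :: "'a metric \<Rightarrow> gh_space" where
  "gh_class X = abs_gh_space (SOME Y. isometric X Y)"

lemma gh_class_real_model:
  assumes X: "compact_metric X"
  obtains Y where "compact_metric Y" "isometric X Y" "gh_class X = abs_gh_space Y"
proof -
  define Y :: "real metric" where "Y = (SOME Y. isometric X Y)"
  have iso: "isometric X Y"
    unfolding Y_def by (rule someI_ex[OF compact_metric_real_model[OF X]])
  with isometric_compact_metric[OF X iso] that show ?thesis by (auto simp: gh_class_def Y_def)
qed

lemma dist_gh_class:
  assumes X: "compact_metric X" and Y: "compact_metric Y"
  shows "dist (gh_class X) (gh_class Y) = gh_dist X Y"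
proof -
  obtain X' where X': "compact_metric X'" "isometric X X'" "gh_class X = abs_gh_space X'"
    using gh_class_real_model[OF X] .
  obtain Y' where Y': "compact_metric Y'" "isometric Y Y'" "gh_class Y = abs_gh_space Y'"
    using gh_class_real_model[OF Y] .
  have "dist (gh_class X) (gh_class Y) = gh_dist X' Y'"
    unfolding X'(3) Y'(3)
    by (rule dist_gh_space.abs_eq) (simp_all add: gh_rel_def eq_onp_def X' Y' isometric_refl)
  also have "\<dots> = gh_dist X Y" by (rule gh_dist_cong[symmetric]) fact+
  finally show ?thesis .
qed

lemma gh_class_eq_iff:
  assumes "compact_metric X" "compact_metric Y"
  shows "gh_class X = gh_class Y \<longleftrightarrow> isometric X Y"
  using dist_gh_class[OF assms] gh_dist_isometric[OF assms] gh_dist_zero_isometric[OF assms]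
  by (metis dist_eq_0_iff)


section \<open>Scaling, and the circle of unit length\<close>

text \<open>
  Only \<open>c > 0\<close> is meaningful; for \<open>c \<le> 0\<close> the metric is left unchanged, so that the result is always
  a metric space.
\<close>

definition scale_metric :: "real \<Rightarrow> 'a metric \<Rightarrow> 'a metric" where
  "scale_metric c X = metric (mspace X, \<lambda>x y. (if 0 < c then c else 1) * mdist X x y)"

lemma Metric_space_scale:
  "Metric_space (mspace X) (\<lambda>x y. (if 0 < c then c else 1) * mdist X x y)" for c :: real
proof
  fix x y z assume "x \<in> mspace X" "y \<in> mspace X" "z \<in> mspace X"
  then have "(if 0 < c then c else 1) * mdist X x z \<le> (if 0 < c then c else 1) * (mdist X x y + mdist X y z)"
    by (intro mult_left_mono mdist_triangle) auto
  then show "(if 0 < c then c else 1) * mdist X x z \<le>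
      (if 0 < c then c else 1) * mdist X x y + (if 0 < c then c else 1) * mdist X y z"
    by (simp add: distrib_left split: if_splits)
qed (auto simp: mdist_commute)

lemma mspace_scale_metric [simp]: "mspace (scale_metric c X) = mspace X"
  unfolding scale_metric_def by (rule Metric_space.mspace_metric[OF Metric_space_scale])

lemma mdist_scale_metric: "mdist (scale_metric c X) x y = (if 0 < c then c else 1) * mdist X x y"
  unfolding scale_metric_def Metric_space.mdist_metric[OF Metric_space_scale] ..

lemma compact_metric_scale:
  assumes X: "compact_metric X" shows "compact_metric (scale_metric c X)"
proof -
  let ?Y = "scale_metric c X"
  let ?c = "if 0 < c then c else 1"
  interpret X: Metric_space "mspace X" "mdist X" by simp
  interpret Y: Metric_space "mspace X" "mdist ?Y" using Metric_space_mspace_mdist[of ?Y] by simp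
  have "continuous_map X.mtopology Y.mtopology (\<lambda>x. x)"
    unfolding X.metric_continuous_map[OF Y.Metric_space_axioms]
  proof (intro conjI ballI allI impI)
    fix a e :: real and x assume "0 < e"
    then show "\<exists>\<delta>>0. \<forall>y. y \<in> mspace X \<and> mdist X x y < \<delta> \<longrightarrow> mdist ?Y x y < e"
      by (intro exI[of _ "e / ?c"]) (auto simp: mdist_scale_metric field_simps)
  qed auto
  moreover have "compactin X.mtopology (mspace X)"
    using X by (simp add: compact_metric_def compact_space_def mtopology_of_def)
  ultimately have "compactin Y.mtopology ((\<lambda>x. x) ` mspace X)" by (rule image_compactin[rotated])
  then show ?thesis
    using X by (auto simp: compact_metric_def compact_space_def mtopology_of_def)
qed

lemma gh_dist_scale_le:
  assumes X: "compact_metric X" and a: "0 < a" and b: "0 < b" and B: "0 < B"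
    "\<And>x y. x \<in> mspace X \<Longrightarrow> y \<in> mspace X \<Longrightarrow> mdist X x y \<le> B"
  shows "gh_dist (scale_metric a X) (scale_metric b X) \<le> \<bar>a - b\<bar> * B"
proof (cases "a = b")
  case True
  then show ?thesis
    using gh_dist_isometric[OF compact_metric_scale[OF X, of b] compact_metric_scale[OF X, of b] isometric_refl]
    by simp
next
  case False
  let ?R = "{(x, x) | x. x \<in> mspace X}"
  have "gh_corr (scale_metric a X) (scale_metric b X) ?R (\<bar>a - b\<bar> * B)"
  proof (rule gh_corrI)
    fix x y x' y' assume "(x, y) \<in> ?R" "(x', y') \<in> ?R"
    then have x: "y = x" "y' = x'" "x \<in> mspace X" "x' \<in> mspace X" by auto
    have "\<bar>mdist (scale_metric a X) x x' - mdist (scale_metric b X) y y'\<bar> = \<bar>a - b\<bar> * mdist X x x'"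
      using a b x by (simp add: mdist_scale_metric left_diff_distrib[symmetric] abs_mult)
    also have "\<dots> \<le> \<bar>a - b\<bar> * B" using B(2)[OF x(3,4)] by (intro mult_left_mono) auto
    also have "\<dots> \<le> 2 * (\<bar>a - b\<bar> * B)" using B(1) by simp
    finally show "\<bar>mdist (scale_metric a X) x x' - mdist (scale_metric b X) y y'\<bar> \<le> 2 * (\<bar>a - b\<bar> * B)" .
  qed auto
  then show ?thesis
    using False B(1) by (intro gh_dist_le compact_metric_scale X) auto
qed

lemma measurable_gh_class_scale:
  assumes X: "compact_metric X"
  shows "(\<lambda>c. gh_class (scale_metric c X)) \<in> borel_measurable borel"
proof -
  obtain B where B: "B > 0" "\<And>x y. x \<in> mspace X \<Longrightarrow> y \<in> mspace X \<Longrightarrow> mdist X x y \<le> B"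
    using compact_metric_bounded[OF X] by blast
  have "B-lipschitz_on {0<..} (\<lambda>c. gh_class (scale_metric c X))"
  proof (rule lipschitz_onI)
    fix a b :: real assume "a \<in> {0<..}" "b \<in> {0<..}"
    then show "dist (gh_class (scale_metric a X)) (gh_class (scale_metric b X)) \<le> B * dist a b"
      using gh_dist_scale_le[OF X _ _ B] dist_gh_class[OF compact_metric_scale[OF X] compact_metric_scale[OF X]]
      by (simp add: dist_real_def mult.commute)
  qed (use B in simp)
  then have c: "continuous_on {0<..} (\<lambda>c. gh_class (scale_metric c X))"
    by (rule lipschitz_on_continuous_on)
  have e: "scale_metric c X = scale_metric 0 X" if "\<not> 0 < c" for c
    using that by (simp add: scale_metric_def)
  show ?thesis
  proof (rule measurable_piecewise_restrict[of "{{0<..}, {..0}}"])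
    fix A :: "real set" assume "A \<in> {{0<..}, {..0}}"
    then show "(\<lambda>c. gh_class (scale_metric c X)) \<in> borel_measurable (restrict_space borel A)"
    proof (elim insertE emptyE)
      assume "A = {0<..}"
      then show ?thesis using borel_measurable_continuous_on_restrict[OF c] by simp
    next
      assume A: "A = {..0}"
      have "(\<lambda>c. gh_class (scale_metric c X)) \<in> borel_measurable (restrict_space borel A) \<longleftrightarrow>
          (\<lambda>c. gh_class (scale_metric 0 X)) \<in> borel_measurable (restrict_space borel A)"
      proof (rule measurable_cong)
        fix c assume "c \<in> space (restrict_space borel A)"
        then have "\<not> 0 < c" by (simp add: A space_restrict_space)
        then show "gh_class (scale_metric c X) = gh_class (scale_metric 0 X)" by (rule arg_cong[OF e])
      qed
      then show ?thesis by simp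
    qed
  qed (auto simp: not_less)
qed

text \<open>
  The circle of length \<open>1\<close>, parametrised by arc length over \<open>[0, 1)\<close>; the two fractional parts are the
  lengths of the two arcs joining \<open>s\<close> and \<open>t\<close>.
\<close>

definition unit_circle :: "real metric" where
  "unit_circle = metric ({0..<1}, \<lambda>s t. min (frac (s - t)) (frac (t - s)))"

lemma arc_dist_eq:
  fixes s t :: real
  assumes "s \<in> {0..<1}" "t \<in> {0..<1}"
  shows "min (frac (s - t)) (frac (t - s)) = min \<bar>s - t\<bar> (1 - \<bar>s - t\<bar>)"
proof -
  consider "s = t" | "s < t" | "t < s" by linarith
  then show ?thesis
  proof cases
    case 2
    have "frac (t - s) = t - s" using 2 assms by (simp add: frac_eq)
    moreover have "frac (s - t) = s - t + 1" using 2 assms by (simp add: frac_unique_iff)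
    ultimately show ?thesis using 2 by (simp add: min.commute)
  next
    case 3
    have "frac (s - t) = s - t" using 3 assms by (simp add: frac_eq)
    moreover have "frac (t - s) = t - s + 1" using 3 assms by (simp add: frac_unique_iff)
    ultimately show ?thesis using 3 by simp
  qed (use assms in auto)
qed

lemma Metric_space_unit_circle:
  "Metric_space {0..<1::real} (\<lambda>s t. min (frac (s - t)) (frac (t - s)))"
proof
  fix s t :: real assume "s \<in> {0..<1}" "t \<in> {0..<1}"
  then show "(min (frac (s - t)) (frac (t - s)) = 0) = (s = t)"
    by (subst arc_dist_eq) (auto simp: min_def split: if_splits)
next
  fix s t u :: real assume "s \<in> {0..<1}" "t \<in> {0..<1}" "u \<in> {0..<1}"
  then show "min (frac (s - u)) (frac (u - s))
     \<le> min (frac (s - t)) (frac (t - s)) + min (frac (t - u)) (frac (u - t))"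
    by (simp only: arc_dist_eq) (auto simp: min_def abs_if)
qed (auto simp: min.commute)

lemma compact_metric_unit_circle: "compact_metric unit_circle"
proof -
  interpret circle: Metric_space "{0..<1::real}" "\<lambda>s t. min (frac (s - t)) (frac (t - s))"
    by (rule Metric_space_unit_circle)
  have d: "min (frac (frac s - frac t)) (frac (frac t - frac s)) \<le> \<bar>s - t\<bar>" for s t :: real
  proof -
    have "frac (frac x - frac y) = frac (x - y)" for x y :: real
    proof -
      have "frac x - frac y = (x - y) - of_int (\<lfloor>x\<rfloor> - \<lfloor>y\<rfloor>)" by (simp add: frac_def)
      then show ?thesis unfolding frac_def by (simp only: floor_diff_of_int)
    qed
    moreover have "frac x \<le> x" if "x \<ge> 0" for x :: real using that by (simp add: frac_def)
    ultimately show ?thesis by (smt (verit))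
  qed
  have "continuous_map (euclidean :: real topology) circle.mtopology frac"
    unfolding circle.continuous_map_to_metric
  proof (intro ballI allI impI)
    fix x e :: real assume "e > 0"
    have "frac y \<in> circle.mball (frac x) e" if "y \<in> ball x e" for y
    proof -
      have "\<bar>x - y\<bar> < e" using that by (simp add: dist_real_def)
      with d[of x y] have "min (frac (frac x - frac y)) (frac (frac y - frac x)) < e" by (rule le_less_trans)
      then show ?thesis unfolding circle.in_mball by (simp add: frac_lt_1)
    qed
    then show "\<exists>U. openin euclidean U \<and> x \<in> U \<and> (\<forall>y\<in>U. frac y \<in> circle.mball (frac x) e)"
      using \<open>e > 0\<close> by (intro exI[of _ "ball x e"]) simp
  qed
  moreover have "compactin (euclidean :: real topology) {0..1}" by simp
  ultimately have "compactin circle.mtopology (frac ` {0..1::real})" by (rule image_compactin[rotated])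
  moreover have "frac ` {0..1::real} = {0..<1}"
  proof
    show "{0..<1::real} \<subseteq> frac ` {0..1}" by (force simp: frac_eq image_iff)
  qed (auto simp: frac_lt_1)
  ultimately show ?thesis by (simp add: unit_circle_def compact_metric_def compact_space_def)
qed


section \<open>Plane trees and their looptrees\<close>

datatype plane_tree = Node "plane_tree list"

text \<open>
  Vertices are addressed by words: \<open>[]\<close> is the root and \<open>u @ [i]\<close> the child number \<open>i\<close> (counted from
  \<open>0\<close>) of \<open>u\<close>.
\<close>

function vertices :: "plane_tree \<Rightarrow> nat list set" where
  "vertices (Node ts) = insert [] (\<Union>i<length ts. (#) i ` vertices (ts ! i))"
  by pat_completeness auto
termination
  by (relation "Wellfounded.measure size") (auto simp: less_Suc_eq_le intro: size_list_estimation'[OF nth_mem order_refl])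

text \<open>Only meaningful for addresses in \<open>vertices t\<close>.\<close>

fun num_children :: "plane_tree \<Rightarrow> nat list \<Rightarrow> nat" where
  "num_children (Node ts) [] = length ts"
| "num_children (Node ts) (i # u) = num_children (ts ! i) u"

text \<open>
  Membership of both ends in \<open>vertices t\<close> excludes \<open>w @ [0]\<close> when \<open>w\<close> is a leaf, also where it arises
  as \<open>w @ [0 - 1]\<close>.
\<close>

definition loop_edges :: "plane_tree \<Rightarrow> (nat list \<times> nat list) set" where
  "loop_edges t = {(u, v) \<in> vertices t \<times> vertices t.
     (\<exists>w i. {u, v} = {w @ [i], w @ [Suc i]}) \<or>
     (\<exists>w. {u, v} = {w, w @ [0]} \<or> {u, v} = {w, w @ [num_children t w - 1]})}"

definition graph_dist :: "('a \<times> 'a) set \<Rightarrow> 'a \<Rightarrow> 'a \<Rightarrow> nat" where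
  "graph_dist E u v = (LEAST n. (u, v) \<in> E ^^ n)"

definition loop :: "plane_tree \<Rightarrow> nat list metric" where
  "loop t = metric (vertices t, \<lambda>u v. real (graph_dist (loop_edges t) u v))"

lemma finite_vertices: "finite (vertices t)"
  by (induction t rule: vertices.induct) simp

lemma Nil_in_vertices: "[] \<in> vertices t"
  by (cases t) simp

lemma snoc_in_vertices: "w @ [i] \<in> vertices t \<longleftrightarrow> w \<in> vertices t \<and> i < num_children t w"
proof (induction w arbitrary: t)
  case Nil
  show ?case by (cases t) (auto simp: Nil_in_vertices image_iff)
next
  case (Cons j w)
  then show ?case by (cases t) auto
qed

lemma sym_loop_edges: "sym (loop_edges t)"
  unfolding loop_edges_def by (auto intro!: symI simp: insert_commute)

lemma loop_edges_root:
  assumes "u \<in> vertices t" shows "([], u) \<in> (loop_edges t)\<^sup>*"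
  using assms
proof (induction u rule: rev_induct)
  case (snoc i w)
  have w: "w \<in> vertices t" and i: "i < num_children t w" using snoc.prems by (auto simp: snoc_in_vertices)
  have "(w, w @ [j]) \<in> (loop_edges t)\<^sup>*" if "j \<le> i" for j
    using that
  proof (induction j)
    case 0
    have "w @ [0] \<in> vertices t" using w i by (simp add: snoc_in_vertices)
    then have "(w, w @ [0]) \<in> loop_edges t" using w by (auto simp: loop_edges_def)
    then show ?case by blast
  next
    case (Suc j)
    have "w @ [j] \<in> vertices t" "w @ [Suc j] \<in> vertices t"
      using w i Suc.prems by (simp_all add: snoc_in_vertices)
    then have "(w @ [j], w @ [Suc j]) \<in> loop_edges t" unfolding loop_edges_def by blast
    with Suc show ?case by (simp add: rtrancl_into_rtrancl)
  qed
  from this[OF order_refl] snoc.IH[OF w] show ?case by (rule rtrancl_trans[rotated])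
qed simp

lemma loop_connected:
  assumes "u \<in> vertices t" "v \<in> vertices t" shows "\<exists>n. (u, v) \<in> loop_edges t ^^ n"
proof -
  have "(u, []) \<in> (loop_edges t)\<^sup>*"
    using symD[OF sym_rtrancl[OF sym_loop_edges] loop_edges_root[OF assms(1)]] .
  with loop_edges_root[OF assms(2)] show ?thesis by (meson rtrancl_trans rtrancl_imp_relpow)
qed

lemma relpow_sym:
  assumes "sym E" shows "(u, v) \<in> E ^^ n \<longleftrightarrow> (v, u) \<in> E ^^ n"
proof -
  have "(u, v) \<in> E ^^ n \<Longrightarrow> (v, u) \<in> E ^^ n" for u v
  proof (induction n arbitrary: v)
    case (Suc n)
    then obtain w where "(u, w) \<in> E ^^ n" "(w, v) \<in> E" by auto
    with Suc.IH have "(v, w) \<in> E" "(w, u) \<in> E ^^ n" using assms by (auto dest: symD)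
    then show ?case by (rule relpow_Suc_I2)
  qed simp
  then show ?thesis by blast
qed

lemma Metric_space_loop: "Metric_space (vertices t) (\<lambda>u v. real (graph_dist (loop_edges t) u v))"
proof
  have reach: "(u, v) \<in> loop_edges t ^^ graph_dist (loop_edges t) u v"
    if "u \<in> vertices t" "v \<in> vertices t" for u v
    unfolding graph_dist_def using loop_connected[OF that] by (rule LeastI_ex)
  fix u v w
  show "real (graph_dist (loop_edges t) u v) = real (graph_dist (loop_edges t) v u)"
    unfolding graph_dist_def by (subst relpow_sym[OF sym_loop_edges]) rule
  assume u: "u \<in> vertices t" and v: "v \<in> vertices t"
  show "(real (graph_dist (loop_edges t) u v) = 0) = (u = v)"
  proof
    assume "real (graph_dist (loop_edges t) u v) = 0"
    with reach[OF u v] show "u = v" by simp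
  next
    assume "u = v"
    then have "graph_dist (loop_edges t) u v \<le> 0" unfolding graph_dist_def by (intro Least_le) simp
    then show "real (graph_dist (loop_edges t) u v) = 0" by simp
  qed
  assume w: "w \<in> vertices t"
  have "(u, w) \<in> loop_edges t ^^ (graph_dist (loop_edges t) u v + graph_dist (loop_edges t) v w)"
    using reach[OF u v] reach[OF v w] by (auto simp: relpow_add)
  then have "graph_dist (loop_edges t) u w \<le> graph_dist (loop_edges t) u v + graph_dist (loop_edges t) v w"
    unfolding graph_dist_def by (rule Least_le)
  then show "real (graph_dist (loop_edges t) u w) \<le>
      real (graph_dist (loop_edges t) u v) + real (graph_dist (loop_edges t) v w)" by linarith
qed simp

lemma compact_metric_loop: "compact_metric (loop t)"
  unfolding loop_def
  by (rule finite_compact_metric[OF Metric_space_loop finite_vertices]) (use Nil_in_vertices in auto)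

lemma mspace_loop: "mspace (loop t) = vertices t"
  unfolding loop_def by (rule Metric_space.mspace_metric[OF Metric_space_loop])

lemma mdist_loop: "mdist (loop t) u v = real (graph_dist (loop_edges t) u v)"
  unfolding loop_def Metric_space.mdist_metric[OF Metric_space_loop] ..


section \<open>Bienayme--Galton--Watson trees\<close>

definition offspring_distribution :: "nat pmf \<Rightarrow> bool" where
  "offspring_distribution mu \<longleftrightarrow>
     0 < pmf mu 0 \<and> pmf mu 0 + pmf mu 1 < 1 \<and> Gcd {k. 1 \<le> k \<and> 0 < pmf mu k} = 1"

text \<open>
  The law of the tree on finite plane trees. If the mean of \<open>mu\<close> is at most \<open>1\<close> then the tree is almost
  surely finite and no mass is lost.
\<close>

definition BGW :: "nat pmf \<Rightarrow> plane_tree measure" where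
  "BGW mu = density (count_space UNIV) (\<lambda>t. ennreal (\<Prod>u\<in>vertices t. pmf mu (num_children t u)))"

definition BGW_at_least :: "nat pmf \<Rightarrow> nat \<Rightarrow> plane_tree measure" where
  "BGW_at_least mu n = uniform_measure (BGW mu) {t. n \<le> card (vertices t)}"

lemma measurable_BGW_at_least: "f \<in> measurable (BGW_at_least mu n) borel"
  by (simp add: BGW_at_least_def BGW_def measurable_def)


section \<open>Slow variation and weak convergence\<close>

definition slowly_varying :: "(real \<Rightarrow> real) \<Rightarrow> bool" where
  "slowly_varying L \<longleftrightarrow> (\<forall>x\<ge>0. 0 \<le> L x) \<and>
     (\<forall>c>0. ((\<lambda>x. L (c * x) / L x) \<longlongrightarrow> 1) at_top)"

text \<open>
  Random variables converge in distribution when their laws (\<open>distr\<close>) converge in this sense.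
\<close>

definition weakly_converges :: "(nat \<Rightarrow> 'a::topological_space measure) \<Rightarrow> 'a measure \<Rightarrow> bool" where
  "weakly_converges P Q \<longleftrightarrow> (\<forall>f :: 'a \<Rightarrow> real. continuous_on UNIV f \<longrightarrow> bounded (range f) \<longrightarrow>
     (\<lambda>n. \<integral>x. f x \<partial>P n) \<longlonglongrightarrow> (\<integral>x. f x \<partial>Q))"

end

theory Submission
  imports Defs "HOL-Real_Asymp.Real_Asymp"
begin

text \<open>
  This is the principle of one big jump. A vertex \<open>u\<close> splits the tree into the tree pruned at \<open>u\<close> and the
  subtree at \<open>u\<close>, and a many-to-one formula makes the two independent. The total size has mean
  \<open>1 / (1 - m)\<close>, so by the law of large numbers a vertex with \<open>k\<close> children produces about \<open>k / (1 - m)\<close>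
  descendants. Hence one vertex of degree at least \<open>(1 - m) n\<close> is enough for the tree to have \<open>n\<close> vertices.
  Conversely, an exponential moment bound for trees without large degrees shows that every other way of
  reaching size \<open>n\<close> has probability negligible with respect to \<open>mu [n, \<infinity>)\<close>. Given its size, the tree
  therefore contains exactly one vertex of degree of order \<open>n\<close>; this degree divided by \<open>n\<close> has the limit law
  \<open>J\<close> by regular variation, and all pieces attached to the loop of that vertex have \<open>o(n)\<close> vertices. The
  correspondence which projects these pieces to the loop has distortion \<open>o(n)\<close>.
\<close>

section \<open>Subtrees and grafting\<close>

text \<open>Conditioning enters only through quotients. The probability of size at least
  \<open>n\<close> needs an upper bound with the sharp constant
  \<open>msize * (1 - m) powr - beta\<close>; the presence of a vertex with degree in
  \<open>[a n, b n)\<close> needs a matching lower bound. One-sided bounds suffice because the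
  limiting masses of disjoint degree cells exhaust the law of \<open>J\<close>, so lower bounds on
  the cells leave no room elsewhere.

  The upper bound is the hard half. Polynomial tails admit no exponential moment, so degrees are
  truncated at \<open>d n\<close> and the exponential parameter is of order \<open>ln n / n\<close>.
  This leaves intermediate degrees between \<open>d n\<close> and about \<open>(1 - m) n\<close>,
  which are treated by first moments: such a vertex already costs a factor comparable to the tail at
  \<open>n\<close>, and the pruned tree or the forest above it must be exceptional as well. The
  factor \<open>msize\<close> in both bounds comes from the expected number of vertices at which the
  big jump can happen.\<close>

abbreviation tsize :: "plane_tree \<Rightarrow> nat" where
  "tsize t \<equiv> card (vertices t)"

definition tree_weight :: "nat pmf \<Rightarrow> plane_tree \<Rightarrow> real" where
  "tree_weight mu t = (\<Prod>u\<in>vertices t. pmf mu (num_children t u))"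

fun subtree :: "plane_tree \<Rightarrow> nat list \<Rightarrow> plane_tree" where
  "subtree t [] = t"
| "subtree (Node ts) (i # u) = subtree (ts ! i) u"

fun graft :: "plane_tree \<Rightarrow> nat list \<Rightarrow> plane_tree \<Rightarrow> plane_tree" where
  "graft t [] s = s"
| "graft (Node ts) (i # u) s = Node (ts[i := graft (ts ! i) u s])"

abbreviation children :: "plane_tree \<Rightarrow> plane_tree list" where
  "children t \<equiv> (case t of Node ts \<Rightarrow> ts)"

section \<open>Recursive sums and products over the vertices\<close>

lemma prod_vertices_Node:
  fixes f :: "nat list \<Rightarrow> 'a::comm_monoid_mult"
  shows "(\<Prod>u\<in>vertices (Node ts). f u) = f [] * (\<Prod>i<length ts. \<Prod>u\<in>vertices (ts ! i). f (i # u))"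
proof -
  have "(\<Prod>u\<in>vertices (Node ts). f u) = f [] * (\<Prod>u\<in>(\<Union>i<length ts. (#) i ` vertices (ts ! i)). f u)"
    by (simp only: vertices.simps, subst prod.insert) (auto simp: finite_vertices)
  also have "(\<Prod>u\<in>(\<Union>i<length ts. (#) i ` vertices (ts ! i)). f u) =
      (\<Prod>i<length ts. \<Prod>u\<in>(#) i ` vertices (ts ! i). f u)"
    by (rule prod.UNION_disjoint) (auto simp: finite_vertices)
  also have "\<dots> = (\<Prod>i<length ts. \<Prod>u\<in>vertices (ts ! i). f (i # u))"
    by (intro prod.cong[OF refl], subst prod.reindex) (auto simp: inj_on_def)
  finally show ?thesis .
qed

lemma sum_vertices_Node:
  fixes f :: "nat list \<Rightarrow> 'a::comm_monoid_add"
  shows "(\<Sum>u\<in>vertices (Node ts). f u) = f [] + (\<Sum>i<length ts. \<Sum>u\<in>vertices (ts ! i). f (i # u))"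
proof -
  have "(\<Sum>u\<in>vertices (Node ts). f u) = f [] + (\<Sum>u\<in>(\<Union>i<length ts. (#) i ` vertices (ts ! i)). f u)"
    by (simp only: vertices.simps, subst sum.insert) (auto simp: finite_vertices)
  also have "(\<Sum>u\<in>(\<Union>i<length ts. (#) i ` vertices (ts ! i)). f u) =
      (\<Sum>i<length ts. \<Sum>u\<in>(#) i ` vertices (ts ! i). f u)"
    by (rule sum.UNION_disjoint) (auto simp: finite_vertices)
  also have "\<dots> = (\<Sum>i<length ts. \<Sum>u\<in>vertices (ts ! i). f (i # u))"
    by (intro sum.cong[OF refl], subst sum.reindex) (auto simp: inj_on_def)
  finally show ?thesis .
qed

lemma prod_list_map_nth:
  fixes f :: "'b \<Rightarrow> 'a::comm_monoid_mult"
  shows "prod_list (map f ts) = (\<Prod>i<length ts. f (ts ! i))"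
  by (simp add: prod.list_conv_set_nth atLeast0LessThan)

lemma sum_list_map_nth:
  fixes f :: "'b \<Rightarrow> 'a::comm_monoid_add"
  shows "sum_list (map f ts) = (\<Sum>i<length ts. f (ts ! i))"
  by (simp add: sum.list_conv_set_nth atLeast0LessThan)

lemma tree_weight_Node:
  "tree_weight mu (Node ts) = pmf mu (length ts) * prod_list (map (tree_weight mu) ts)"
  by (simp add: tree_weight_def prod_vertices_Node prod_list_map_nth del: vertices.simps)

lemma tree_weight_nonneg: "0 \<le> tree_weight mu t"
  by (simp add: tree_weight_def prod_nonneg)

lemma tsize_Node: "tsize (Node ts) = Suc (sum_list (map tsize ts))"
proof -
  have "tsize (Node ts) = (\<Sum>u\<in>vertices (Node ts). 1)" by simp
  then show ?thesis by (simp add: sum_vertices_Node sum_list_map_nth del: vertices.simps sum_constant) simp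
qed

lemma tsize_pos: "0 < tsize t"
  using finite_vertices[of t] Nil_in_vertices[of t] by (auto simp: card_gt_0_iff)

lemma tsize_children: "tsize t = Suc (sum_list (map tsize (children t)))"
  by (cases t) (simp add: tsize_Node del: vertices.simps)

lemma num_children_le_tsize: "u \<in> vertices t \<Longrightarrow> num_children t u < tsize t"
proof -
  assume u: "u \<in> vertices t"
  have "insert u ((\<lambda>i. u @ [i]) ` {..<num_children t u}) \<subseteq> vertices t"
    using u by (auto simp: snoc_in_vertices)
  then have "card (insert u ((\<lambda>i. u @ [i]) ` {..<num_children t u})) \<le> tsize t"
    by (intro card_mono finite_vertices)
  moreover have "card ((\<lambda>i. u @ [i]) ` {..<num_children t u}) = num_children t u"
    by (subst card_image) (auto simp: inj_on_def)
  moreover have "u \<notin> (\<lambda>i. u @ [i]) ` {..<num_children t u}" by auto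
  ultimately show ?thesis by (simp add: card_insert_if)
qed

section \<open>Addresses, sizes and weights under grafting\<close>

lemma append_in_vertices:
  "u @ v \<in> vertices t \<longleftrightarrow> u \<in> vertices t \<and> v \<in> vertices (subtree t u)"
proof (induction t u rule: subtree.induct)
  case (1 t) then show ?case by (simp add: Nil_in_vertices)
next
  case (2 ts i u)
  then show ?case by auto
qed

lemma num_children_append:
  "u \<in> vertices t \<Longrightarrow> num_children t (u @ v) = num_children (subtree t u) v"
  by (induction t u rule: subtree.induct) auto

lemma num_children_Nil: "num_children t [] = length (children t)"
  by (cases t) simp

lemma num_children_subtree: "u \<in> vertices t \<Longrightarrow> num_children t u = length (children (subtree t u))"
  using num_children_append[of u t "[]"] by (simp add: num_children_Nil)

lemma graft_graft: "u \<in> vertices t \<Longrightarrow> graft (graft t u s') u s = graft t u s"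
  by (induction t u s rule: graft.induct) auto

lemma graft_subtree: "u \<in> vertices t \<Longrightarrow> graft t u (subtree t u) = t"
  by (induction t u rule: subtree.induct) auto

lemma subtree_graft: "u \<in> vertices t \<Longrightarrow> subtree (graft t u s) u = s"
  by (induction t u s rule: graft.induct) auto

lemma Cons_in_vertices: "i # u \<in> vertices (Node ts) \<longleftrightarrow> i < length ts \<and> u \<in> vertices (ts ! i)"
  by auto

lemma in_vertices_graft: "u \<in> vertices t \<Longrightarrow> u \<in> vertices (graft t u s)"
  by (induction t u s rule: graft.induct) (simp_all add: Nil_in_vertices Cons_in_vertices del: vertices.simps)

lemma num_children_graft:
  assumes "u \<in> vertices t" "x \<in> vertices t" "\<nexists>v. x = u @ v"
  shows "x \<in> vertices (graft t u s) \<and> num_children (graft t u s) x = num_children t x"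
  using assms
proof (induction t u s arbitrary: x rule: graft.induct)
  case (2 ts i u s)
  show ?case
  proof (cases x)
    case (Cons j y)
    show ?thesis
    proof (cases "j = i")
      case True
      with 2(2-4) Cons have "u \<in> vertices (ts ! i)" "y \<in> vertices (ts ! i)" "\<nexists>v. y = u @ v" by auto
      from 2(1)[OF this] show ?thesis using 2(2) Cons True
        by (simp add: Cons_in_vertices del: vertices.simps)
    next
      case False
      then show ?thesis using 2(2-4) Cons
        by (simp add: Cons_in_vertices del: vertices.simps)
    qed
  qed simp
qed simp

lemma tsize_graft:
  "u \<in> vertices t \<Longrightarrow> tsize (graft t u s) + tsize (subtree t u) = tsize t + tsize s"
proof (induction t u s rule: graft.induct)
  case (2 ts i u s)
  then have i: "i < length ts" "u \<in> vertices (ts ! i)" by auto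
  have "ts = take i ts @ ts ! i # drop (Suc i) ts" using i by (simp add: id_take_nth_drop)
  then have *: "sum_list (map tsize ts) =
      sum_list (map tsize (take i ts)) + tsize (ts ! i) + sum_list (map tsize (drop (Suc i) ts))"
    by (metis add.assoc list.simps(9) map_append sum_list.Cons sum_list_append)
  show ?case using 2(1)[OF i(2)] i
    by (simp add: tsize_Node upd_conv_take_nth_drop * del: vertices.simps)
qed simp

text \<open>Cross-multiplied because the replaced subtree may have weight zero.\<close>

lemma tree_weight_graft:
  "u \<in> vertices t \<Longrightarrow> tree_weight mu (graft t u s) * tree_weight mu (subtree t u) =
     tree_weight mu t * tree_weight mu s"
proof (induction t u s rule: graft.induct)
  case (2 ts i u s)
  then have i: "i < length ts" "u \<in> vertices (ts ! i)" by auto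
  have "ts = take i ts @ ts ! i # drop (Suc i) ts" using i by (simp add: id_take_nth_drop)
  then have *: "prod_list (map (tree_weight mu) ts) =
      prod_list (map (tree_weight mu) (take i ts)) * tree_weight mu (ts ! i) *
      prod_list (map (tree_weight mu) (drop (Suc i) ts))"
    by (metis mult.assoc list.simps(9) map_append prod_list.Cons prod_list.append)
  show ?case using 2(1)[OF i(2)] i
    by (simp add: tree_weight_Node upd_conv_take_nth_drop * Suc_diff_Suc)
qed simp

lemma tree_weight_leaf: "tree_weight mu (Node []) = pmf mu 0"
  by (simp add: tree_weight_Node)

section \<open>Sums over plane trees\<close>

lemma nn_integral_lists_length:
  fixes g :: "'a \<Rightarrow> ennreal"
  shows "(\<integral>\<^sup>+ ts. of_bool (length ts = k) * prod_list (map g ts) \<partial>count_space UNIV) =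
    (\<integral>\<^sup>+ x. g x \<partial>count_space UNIV) ^ k"
proof (induction k)
  case 0
  have "(\<integral>\<^sup>+ ts. of_bool (length ts = 0) * prod_list (map g ts) \<partial>count_space UNIV) =
      (\<integral>\<^sup>+ ts. indicator {[] :: 'a list} ts \<partial>count_space UNIV)"
    by (intro nn_integral_cong) (auto split: split_indicator)
  then show ?case by simp
next
  case (Suc k)
  let ?f = "\<lambda>ts. of_bool (length ts = Suc k) * prod_list (map g ts)"
  have "(\<integral>\<^sup>+ ts. ?f ts \<partial>count_space UNIV) = (\<integral>\<^sup>+ ts. ?f ts \<partial>count_space {ts. ts \<noteq> []})"
    by (rule nn_integral_count_space_eq) auto
  also have "\<dots> = (\<integral>\<^sup>+ p. ?f ((\<lambda>(x, xs). x # xs) p) \<partial>count_space UNIV)"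
  proof (rule nn_integral_bij_count_space[symmetric])
    show "bij_betw (\<lambda>(x, xs). x # xs) UNIV {ts. ts \<noteq> []}"
      by (auto simp: bij_betw_def inj_on_def image_iff neq_Nil_conv)
  qed
  also have "\<dots> = (\<integral>\<^sup>+ x. \<integral>\<^sup>+ xs. ?f ((\<lambda>(x, xs). x # xs) (x, xs)) \<partial>count_space UNIV \<partial>count_space UNIV)"
    by (rule nn_integral_fst_count_space[symmetric])
  also have "\<dots> = (\<integral>\<^sup>+ x. \<integral>\<^sup>+ xs. g x * (of_bool (length xs = k) * prod_list (map g xs)) \<partial>count_space UNIV \<partial>count_space UNIV)"
    by (intro nn_integral_cong) (simp add: ac_simps)
  also have "\<dots> = (\<integral>\<^sup>+ x. g x \<partial>count_space UNIV) ^ Suc k"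
    by (simp add: nn_integral_cmult nn_integral_multc Suc)
  finally show ?case .
qed

text \<open>The right-hand side is the generating function of \<open>c\<close> at the total mass of
  \<open>g\<close>; this turns sums over trees into fixed-point equations.\<close>

lemma nn_integral_lists:
  fixes g :: "'a \<Rightarrow> ennreal"
  shows "(\<integral>\<^sup>+ ts. c (length ts) * prod_list (map g ts) \<partial>count_space UNIV) =
    (\<Sum>k. c k * (\<integral>\<^sup>+ x. g x \<partial>count_space UNIV) ^ k)"
proof -
  have "c (length ts) * prod_list (map g ts) = (\<Sum>k. c k * (of_bool (length ts = k) * prod_list (map g ts)))" for ts
  proof -
    have "(\<lambda>k. if k = length ts then c k * prod_list (map g ts) else 0) sums (c (length ts) * prod_list (map g ts))"
      by (rule sums_single)
    moreover have "(\<lambda>k. if k = length ts then c k * prod_list (map g ts) else 0) =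
       (\<lambda>k. c k * (of_bool (length ts = k) * prod_list (map g ts)))" by auto
    ultimately show ?thesis by (simp add: sums_unique)
  qed
  then have "(\<integral>\<^sup>+ ts. c (length ts) * prod_list (map g ts) \<partial>count_space UNIV) =
     (\<integral>\<^sup>+ ts. (\<Sum>k. c k * (of_bool (length ts = k) * prod_list (map g ts))) \<partial>count_space UNIV)"
    by simp
  also have "\<dots> = (\<Sum>k. \<integral>\<^sup>+ ts. c k * (of_bool (length ts = k) * prod_list (map g ts)) \<partial>count_space UNIV)"
    by (rule nn_integral_suminf) simp
  also have "\<dots> = (\<Sum>k. c k * (\<integral>\<^sup>+ x. g x \<partial>count_space UNIV) ^ k)"
    by (simp add: nn_integral_cmult nn_integral_lists_length)
  finally show ?thesis .
qed

section \<open>The branching recursion for sums over trees\<close>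

lemma nn_integral_plane_tree:
  "(\<integral>\<^sup>+ t. f t \<partial>count_space UNIV) = (\<integral>\<^sup>+ ts. f (Node ts) \<partial>count_space UNIV)"
  by (rule nn_integral_bij_count_space[symmetric])
    (auto simp: bij_betw_def inj_on_def image_iff intro: plane_tree.exhaust)

text \<open>The exhaustion starts from the empty set, so that the truncated sums in
  \<open>tree_sum_le\<close> are the iterates of the recursion from 0 and increase to its least
  solution.\<close>

primrec trees_upto :: "nat \<Rightarrow> plane_tree set" where
  "trees_upto 0 = {}"
| "trees_upto (Suc h) = {Node ts | ts. set ts \<subseteq> trees_upto h}"

lemma trees_upto_mono: "h \<le> h' \<Longrightarrow> trees_upto h \<subseteq> trees_upto h'"
proof (induction h arbitrary: h')
  case (Suc h)
  then obtain h'' where "h' = Suc h''" "h \<le> h''" by (cases h') auto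
  then show ?case using Suc.IH[of h''] by auto
qed simp

lemma trees_upto_exhaust: "\<exists>h. t \<in> trees_upto h"
proof (induction t)
  case (Node ts)
  then have "\<forall>t\<in>set ts. \<exists>h. t \<in> trees_upto h" by blast
  then obtain h where h: "\<And>t. t \<in> set ts \<Longrightarrow> t \<in> trees_upto (h t)" by metis
  have "t \<in> trees_upto (Max (h ` set ts))" if "t \<in> set ts" for t
    using h[OF that] trees_upto_mono[of "h t" "Max (h ` set ts)"] that by auto
  then have "Node ts \<in> trees_upto (Suc (Max (h ` set ts)))" by auto
  then show ?case by blast
qed

text \<open>
  Restricted to trees of bounded height the sum satisfies a recursion, of which \<open>x\<close> is a supersolution.
\<close>

lemma tree_sum_le:
  fixes g :: "plane_tree \<Rightarrow> ennreal"
  assumes g: "\<And>ts. g (Node ts) = c (length ts) * prod_list (map g ts)"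
    and x: "(\<Sum>k. c k * x ^ k) \<le> x"
  shows "(\<integral>\<^sup>+ t. g t \<partial>count_space UNIV) \<le> x"
proof -
  define G where "G h = (\<integral>\<^sup>+ t. g t * indicator (trees_upto h) t \<partial>count_space UNIV)" for h
  have G_Suc: "G (Suc h) = (\<Sum>k. c k * G h ^ k)" for h
  proof -
    have *: "indicator (trees_upto (Suc h)) (Node ts) = prod_list (map (indicator (trees_upto h)) ts :: ennreal list)" for ts
    proof (induction ts)
      case (Cons a ts)
      have "indicator (trees_upto (Suc h)) (Node (a # ts)) =
          (indicator (trees_upto h) a * indicator (trees_upto (Suc h)) (Node ts) :: ennreal)"
        by (simp add: indicator_def)
      then show ?case by (simp only: Cons.IH list.map prod_list.Cons)
    qed simp
    have **: "prod_list (map g ts) * prod_list (map (indicator (trees_upto h)) ts) =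
        prod_list (map (\<lambda>t. g t * indicator (trees_upto h) t) ts)" for ts
      by (induction ts) (auto simp: ac_simps)
    have "G (Suc h) = (\<integral>\<^sup>+ ts. c (length ts) * prod_list (map (\<lambda>t. g t * indicator (trees_upto h) t) ts) \<partial>count_space UNIV)"
      unfolding G_def
      by (subst nn_integral_plane_tree) (simp only: g * mult.assoc **)
    then show ?thesis by (simp add: nn_integral_lists G_def)
  qed
  have le: "G h \<le> x" for h
  proof (induction h)
    case 0 show ?case by (simp add: G_def)
  next
    case (Suc h)
    have "G (Suc h) \<le> (\<Sum>k. c k * x ^ k)"
      unfolding G_Suc by (intro suminf_le mult_left_mono power_mono Suc) auto
    with x show ?case by order
  qed
  have "(\<integral>\<^sup>+ t. g t \<partial>count_space UNIV) = (\<integral>\<^sup>+ t. (SUP h. g t * indicator (trees_upto h) t) \<partial>count_space UNIV)"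
  proof (rule nn_integral_cong, rule antisym)
    fix t
    obtain h where "t \<in> trees_upto h" using trees_upto_exhaust by blast
    then show "g t \<le> (SUP h. g t * indicator (trees_upto h) t)"
      by (intro SUP_upper2[of h]) auto
    show "(SUP h. g t * indicator (trees_upto h) t) \<le> g t"
      by (intro SUP_least) (auto split: split_indicator)
  qed
  also have "\<dots> = (SUP h. G h)"
    unfolding G_def
  proof (rule nn_integral_monotone_convergence_SUP)
    show "incseq (\<lambda>h t. g t * indicator (trees_upto h) t)"
      using trees_upto_mono[of n "Suc n" for n]
      by (intro incseq_SucI le_funI mult_left_mono indicator_leI) (auto simp del: trees_upto.simps)
  qed simp
  also have "\<dots> \<le> x" by (intro SUP_least le)
  finally show ?thesis .
qed

text \<open>Infinite values are not excluded by the equation alone; it becomes informative together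
  with a finite bound from \<open>tree_sum_le\<close>.\<close>

lemma tree_sum_eq:
  fixes g :: "plane_tree \<Rightarrow> ennreal"
  assumes g: "\<And>ts. g (Node ts) = c (length ts) * prod_list (map g ts)"
  shows "(\<integral>\<^sup>+ t. g t \<partial>count_space UNIV) = (\<Sum>k. c k * (\<integral>\<^sup>+ t. g t \<partial>count_space UNIV) ^ k)"
  by (subst nn_integral_plane_tree) (simp only: g nn_integral_lists)

lemma of_nat_sum_list_map:
  "(of_nat (sum_list (map f xs)) :: 'b::semiring_1) = sum_list (map (\<lambda>x. of_nat (f x)) xs)"
  by (induction xs) simp_all

section \<open>Independent and identically distributed lists\<close>

lemma replicate_pmf_Suc_pair:
  "replicate_pmf (Suc k) p = map_pmf (\<lambda>(x, xs). x # xs) (pair_pmf p (replicate_pmf k p))"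
  by (simp add: pair_pmf_def map_bind_pmf)

lemma pmf_replicate_pmf:
  "pmf (replicate_pmf k p) ts = of_bool (length ts = k) * prod_list (map (pmf p) ts)"
proof (induction k arbitrary: ts)
  case 0 show ?case by (cases ts) auto
next
  case (Suc k)
  show ?case
  proof (cases ts)
    case Nil
    have "[] \<notin> set_pmf (replicate_pmf (Suc k) p)" by (auto simp: set_replicate_pmf)
    then show ?thesis unfolding Nil by (simp only: set_pmf_iff) simp
  next
    case (Cons x xs)
    have "pmf (replicate_pmf (Suc k) p) ts = pmf (pair_pmf p (replicate_pmf k p)) (x, xs)"
      unfolding Cons replicate_pmf_Suc_pair
      using pmf_map_inj'[of "\<lambda>(x, xs). x # xs" "pair_pmf p (replicate_pmf k p)" "(x, xs)"]
      by (auto simp: inj_on_def)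
    then show ?thesis using Cons Suc by (simp add: pmf_pair)
  qed
qed

lemma nn_integral_replicate_sum_list:
  fixes g :: "'a \<Rightarrow> ennreal"
  shows "(\<integral>\<^sup>+ ts. sum_list (map g ts) \<partial>replicate_pmf k p) = of_nat k * (\<integral>\<^sup>+ x. g x \<partial>p)"
proof (induction k)
  case (Suc k)
  then show ?case
    by (simp add: nn_integral_add measure_pmf.emeasure_space_1 nn_integral_multc distrib_right)
qed simp

lemma nn_integral_replicate_prod_list:
  fixes g :: "'a \<Rightarrow> ennreal"
  shows "(\<integral>\<^sup>+ ts. prod_list (map g ts) \<partial>replicate_pmf k p) = (\<integral>\<^sup>+ x. g x \<partial>p) ^ k"
proof (induction k)
  case (Suc k)
  then show ?case by (simp add: nn_integral_cmult nn_integral_multc)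
qed simp


section \<open>Subcritical Bienayme--Galton--Watson trees\<close>

locale subcritical =
  fixes mu :: "nat pmf" and m :: real
  assumes mu0: "0 < pmf mu 0"
    and mean: "(\<lambda>i. real i * pmf mu i) sums m" and m_less_1: "m < 1"
begin

lemma m_nonneg: "0 \<le> m"
  by (rule sums_le[OF _ sums_zero mean]) simp

lemma nn_mean: "(\<integral>\<^sup>+ k. ennreal (real k) \<partial>mu) = ennreal m"
proof -
  have "(\<integral>\<^sup>+ k. ennreal (real k) \<partial>mu) = (\<Sum>k. ennreal (real k * pmf mu k))"
    by (simp add: nn_integral_measure_pmf nn_integral_count_space_nat ennreal_mult'' mult.commute)
  also have "\<dots> = ennreal m"
    using mean by (subst suminf_ennreal2) (auto simp: sums_iff)
  finally show ?thesis .
qed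

lemma sums_pmf: "pmf mu sums 1"
proof -
  have "(\<Sum>k. ennreal (pmf mu k)) = 1"
    by (simp add: nn_integral_count_space_nat[symmetric] nn_integral_pmf)
  then show ?thesis
    using ennreal_suminf_neq_top[of "pmf mu"] summable_suminf_not_top[of "pmf mu"]
    by (metis ennreal_eq_1 ennreal_one_neq_top pmf_nonneg suminf_ennreal suminf_nonneg summable_sums)
qed

text \<open>Almost sure finiteness of the tree. The total mass \<open>q\<close> is at most 1 and is
  a fixed point of the generating function of \<open>mu\<close>. Bernoulli's inequality gives
  \<open>1 - q \<le> m * (1 - q)\<close>, and \<open>m < 1\<close> then leaves only
  \<open>q = 1\<close>.\<close>

lemma sum_tree_weight: "(\<integral>\<^sup>+ t. tree_weight mu t \<partial>count_space UNIV) = 1"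
proof -
  let ?g = "\<lambda>t. ennreal (tree_weight mu t)"
  have g: "?g (Node ts) = ennreal (pmf mu (length ts)) * prod_list (map ?g ts)" for ts
  proof -
    have "prod_list (map ?g ts) = ennreal (prod_list (map (tree_weight mu) ts))"
      by (induction ts) (auto simp: ennreal_mult' tree_weight_nonneg)
    then show ?thesis by (simp add: tree_weight_Node ennreal_mult')
  qed
  have "(\<Sum>k. ennreal (pmf mu k) * 1 ^ k) \<le> 1"
    using sums_pmf by (simp add: suminf_ennreal2 sums_iff)
  from tree_sum_le[OF g this] obtain q where q: "(\<integral>\<^sup>+ t. ?g t \<partial>count_space UNIV) = ennreal q" "0 \<le> q" "q \<le> 1"
    by (cases "\<integral>\<^sup>+ t. ?g t \<partial>count_space UNIV") (auto simp: top_unique)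
  have "ennreal q = (\<Sum>k. ennreal (pmf mu k * q ^ k))"
    using tree_sum_eq[OF g] q by (simp add: ennreal_mult' ennreal_power)
  moreover have sm: "summable (\<lambda>k. pmf mu k * q ^ k)"
  proof (rule summable_comparison_test')
    show "summable (pmf mu)" using sums_pmf by (simp add: sums_iff)
    fix k :: nat assume "0 \<le> k"
    have "pmf mu k * q ^ k \<le> pmf mu k" by (rule mult_left_le) (use q in \<open>simp_all add: power_le_one\<close>)
    then show "norm (pmf mu k * q ^ k) \<le> pmf mu k" using q by simp
  qed
  ultimately have "q = (\<Sum>k. pmf mu k * q ^ k)"
    using q by (simp add: suminf_ennreal2 suminf_nonneg)
  with sm have "(\<lambda>k. pmf mu k * q ^ k) sums q" by (simp add: sums_iff)
  with sums_pmf have 1: "(\<lambda>k. pmf mu k - pmf mu k * q ^ k) sums (1 - q)" by (rule sums_diff)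
  have 2: "(\<lambda>k. real k * pmf mu k * (1 - q)) sums (m * (1 - q))" using mean by (rule sums_mult2)
  have "1 - q \<le> m * (1 - q)"
  proof (rule sums_le[OF _ 1 2])
    fix k
    have "1 - q ^ k \<le> real k * (1 - q)"
      using Bernoulli_inequality[of "q - 1" k] q by (simp add: algebra_simps)
    then have "pmf mu k * (1 - q ^ k) \<le> pmf mu k * (real k * (1 - q))" by (intro mult_left_mono) auto
    then show "pmf mu k - pmf mu k * q ^ k \<le> real k * pmf mu k * (1 - q)" by (simp add: algebra_simps)
  qed
  then have "(1 - m) * (1 - q) \<le> 0" by (simp add: algebra_simps)
  with m_less_1 have "1 \<le> q" by (simp add: mult_le_0_iff)
  with q show ?thesis by simp
qed

section \<open>The law of the tree and the mean of its size\<close>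

definition bgw :: "plane_tree pmf" where
  "bgw = embed_pmf (tree_weight mu)"

lemma pmf_bgw: "pmf bgw t = tree_weight mu t"
  unfolding bgw_def by (rule pmf_embed_pmf) (simp_all add: tree_weight_nonneg sum_tree_weight)

lemma BGW_eq: "BGW mu = measure_pmf bgw"
  unfolding BGW_def measure_pmf_eq_density pmf_bgw tree_weight_def ..

text \<open>Branching property; it replaces integrals over the tree by integrals over the root
  degree and an independent forest.\<close>

lemma bgw_fixpoint: "bgw = bind_pmf mu (\<lambda>k. map_pmf Node (replicate_pmf k bgw))"
proof (rule pmf_eqI)
  fix t
  obtain ts where t: "t = Node ts" by (cases t)
  have "ennreal (pmf (bind_pmf mu (\<lambda>k. map_pmf Node (replicate_pmf k bgw))) t) =
      (\<integral>\<^sup>+ k. ennreal (pmf (map_pmf Node (replicate_pmf k bgw)) (Node ts)) \<partial>mu)"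
    unfolding t by (rule ennreal_pmf_bind)
  also have "\<dots> = (\<integral>\<^sup>+ k. ennreal (prod_list (map (tree_weight mu) ts)) * indicator {length ts} k \<partial>mu)"
    by (intro nn_integral_cong, subst pmf_map_inj')
      (auto simp: inj_on_def pmf_replicate_pmf pmf_bgw[abs_def] split: split_indicator)
  also have "\<dots> = ennreal (pmf mu (length ts)) * ennreal (prod_list (map (tree_weight mu) ts))"
    by (simp add: nn_integral_cmult emeasure_pmf_single mult.commute)
  also have "\<dots> = ennreal (pmf bgw t)"
    by (simp add: t pmf_bgw tree_weight_Node ennreal_mult')
  finally show "pmf bgw t = pmf (bind_pmf mu (\<lambda>k. map_pmf Node (replicate_pmf k bgw))) t" by simp
qed

lemma nn_integral_bgw_Node:
  "(\<integral>\<^sup>+ t. f t \<partial>bgw) = (\<integral>\<^sup>+ k. \<integral>\<^sup>+ ts. f (Node ts) \<partial>replicate_pmf k bgw \<partial>mu)"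
  by (subst bgw_fixpoint) simp

lemma nn_integral_bgw_arity: "(\<integral>\<^sup>+ t. f (length (children t)) \<partial>bgw) = (\<integral>\<^sup>+ k. f k \<partial>mu)"
proof -
  have "(\<integral>\<^sup>+ ts. f (length ts) \<partial>replicate_pmf k bgw) = f k" for k
  proof -
    have "(\<integral>\<^sup>+ ts. f (length ts) \<partial>replicate_pmf k bgw) = (\<integral>\<^sup>+ ts. f k \<partial>replicate_pmf k bgw)"
      by (intro nn_integral_cong_AE) (auto simp: AE_measure_pmf_iff set_replicate_pmf)
    then show ?thesis by (simp add: measure_pmf.emeasure_space_1)
  qed
  then show ?thesis by (subst nn_integral_bgw_Node) simp
qed

text \<open>The sum of \<open>m ^ j\<close> over the generations \<open>j\<close>, hence the mean
  number of vertices.\<close>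

definition msize :: real where "msize = 1 / (1 - m)"

lemma msize_pos: "0 < msize"
  using m_less_1 by (simp add: msize_def)

lemma nn_integral_tsize: "(\<integral>\<^sup>+ t. of_nat (tsize t) \<partial>bgw) = ennreal msize"
proof -
  let ?e = "\<integral>\<^sup>+ t. of_nat (tsize t) \<partial>bgw"
  \<comment> \<open>The equation for the mean, \<open>E = 1 + m * E\<close>, is also solved by
    infinity. The truncated means are finite, so for them the corresponding inequality can be
    solved.\<close>
  define e where "e N = (\<integral>\<^sup>+ t. of_nat (min (tsize t) N) \<partial>bgw)" for N
  have forest: "(\<integral>\<^sup>+ k. \<integral>\<^sup>+ ts. 1 + sum_list (map g ts) \<partial>replicate_pmf k bgw \<partial>mu) =
      1 + ennreal m * (\<integral>\<^sup>+ t. g t \<partial>bgw)" for g :: "plane_tree \<Rightarrow> ennreal"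
    by (simp add: nn_integral_add nn_integral_replicate_sum_list measure_pmf.emeasure_space_1
        nn_integral_multc nn_mean ennreal_of_nat_eq_real_of_nat)
  have lin: "1 + ennreal m * ennreal r = ennreal (1 + m * r)" if "0 \<le> r" for r
    using m_nonneg that by (simp add: ennreal_mult)
  have "e N \<le> ennreal msize" for N
  proof -
    have "e N \<le> ennreal (real N)"
      unfolding e_def
      by (rule order_trans[OF nn_integral_mono[of _ _ "\<lambda>_. of_nat N"]])
        (auto simp: measure_pmf.emeasure_space_1 ennreal_of_nat_eq_real_of_nat)
    then obtain r where r: "e N = ennreal r" "0 \<le> r" by (cases "e N") (auto simp: top_unique)
    \<comment> \<open>Truncation is subadditive, so the recursion survives as an inequality.\<close>
    have *: "min (Suc (sum_list (map tsize ts))) N \<le> 1 + sum_list (map (\<lambda>t. min (tsize t) N) ts)" for ts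
      by (induction ts) auto
    have "e N \<le> (\<integral>\<^sup>+ k. \<integral>\<^sup>+ ts. 1 + sum_list (map (\<lambda>t. of_nat (min (tsize t) N)) ts) \<partial>replicate_pmf k bgw \<partial>mu)"
      unfolding e_def
    proof (subst nn_integral_bgw_Node, intro nn_integral_mono)
      fix ts
      have "(of_nat (min (tsize (Node ts)) N) :: ennreal) \<le> of_nat (1 + sum_list (map (\<lambda>t. min (tsize t) N) ts))"
        unfolding tsize_Node by (intro of_nat_mono *)
      also have "\<dots> = 1 + sum_list (map (\<lambda>t. of_nat (min (tsize t) N)) ts)"
        by (simp add: of_nat_sum_list_map)
      finally show "(of_nat (min (tsize (Node ts)) N) :: ennreal) \<le> 1 + sum_list (map (\<lambda>t. of_nat (min (tsize t) N)) ts)" .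
    qed
    also have "\<dots> = 1 + ennreal m * e N" by (simp add: forest e_def)
    finally have "ennreal r \<le> ennreal (1 + m * r)"
      by (simp add: r lin)
    then have "r \<le> 1 + m * r" by (rule ennreal_le_iff[THEN iffD1, rotated]) (use r m_nonneg in simp)
    then have "r \<le> msize" using m_less_1 by (simp add: msize_def field_simps)
    with r show ?thesis by (simp add: ennreal_leI)
  qed
  moreover have "?e = (SUP N. e N)"
  proof -
    have "?e = (\<integral>\<^sup>+ t. (SUP N. of_nat (min (tsize t) N)) \<partial>bgw)"
    proof (rule nn_integral_cong, rule antisym)
      fix t show "(of_nat (tsize t) :: ennreal) \<le> (SUP N. of_nat (min (tsize t) N))"
        by (rule SUP_upper2[of "tsize t"]) auto
      show "(SUP N. of_nat (min (tsize t) N)) \<le> (of_nat (tsize t) :: ennreal)"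
        by (intro SUP_least of_nat_mono) simp
    qed
    then show ?thesis
      unfolding e_def
      by (subst nn_integral_monotone_convergence_SUP[symmetric]) (auto simp: incseq_def le_fun_def intro!: of_nat_mono)
  qed
  ultimately have "?e \<le> ennreal msize" by (simp add: SUP_least)
  then obtain r where r: "?e = ennreal r" "0 \<le> r" by (cases ?e) (auto simp: top_unique)
  have "?e = (\<integral>\<^sup>+ k. \<integral>\<^sup>+ ts. 1 + sum_list (map (\<lambda>t. of_nat (tsize t)) ts) \<partial>replicate_pmf k bgw \<partial>mu)"
    by (subst nn_integral_bgw_Node, unfold tsize_Node) (simp add: of_nat_sum_list_map)
  also have "\<dots> = 1 + ennreal m * ?e" by (rule forest)
  finally have "ennreal r = ennreal (1 + m * r)"
    by (simp add: r lin)
  then have "r = 1 + m * r" by (rule ennreal_inj[THEN iffD1, rotated 2]) (use r m_nonneg in simp_all)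
  then have "r = msize" using m_less_1 by (simp add: msize_def field_simps)
  with r show ?thesis by simp
qed

section \<open>Cutting a tree at a vertex\<close>

lemma leaf_iff: "u \<in> vertices t \<Longrightarrow> num_children t u = 0 \<longleftrightarrow> subtree t u = Node []"
  by (cases "subtree t u") (simp add: num_children_subtree)

definition leaves :: "plane_tree \<Rightarrow> nat list set" where
  "leaves t = {u \<in> vertices t. num_children t u = 0}"

lemma leaves_subset: "leaves t \<subseteq> vertices t"
  by (auto simp: leaves_def)

lemma finite_leaves: "finite (leaves t)"
  using finite_subset[OF leaves_subset finite_vertices] .

lemma sum_eq_nn_integral:
  fixes f :: "'b \<Rightarrow> ennreal"
  shows "finite A \<Longrightarrow> (\<Sum>u\<in>A. f u) = (\<integral>\<^sup>+ u. f u * indicator A u \<partial>count_space UNIV)"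
  by (subst nn_integral_count_space_indicator[symmetric]) (simp_all add: nn_integral_count_space_finite)

text \<open>
  A vertex \<open>u\<close> of \<open>t\<close> splits \<open>t\<close> into the tree pruned at \<open>u\<close>, in which \<open>u\<close> is a leaf, and the subtree at
  \<open>u\<close>; the weight of \<open>t\<close> is the product of the two weights, divided by the weight of the extra leaf.
\<close>

lemma many_to_one:
  fixes H :: "plane_tree \<Rightarrow> nat list \<Rightarrow> ennreal"
  shows "(\<integral>\<^sup>+ t. (\<Sum>u\<in>vertices t. H t u) \<partial>bgw) =
    ennreal (1 / pmf mu 0) * (\<integral>\<^sup>+ t. (\<Sum>u\<in>leaves t. \<integral>\<^sup>+ s. H (graft t u s) u \<partial>bgw) \<partial>bgw)"
proof -
  let ?w = "\<lambda>t. ennreal (tree_weight mu t)" and ?C = "count_space UNIV"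
  \<comment> \<open>For a fixed address \<open>u\<close>, grafting is a bijection from pairs of a
    tree with leaf \<open>u\<close> and an arbitrary tree onto the trees that contain
    \<open>u\<close>. The sum over addresses is exchanged with the integral only afterwards.\<close>
  have split: "(\<integral>\<^sup>+ t. ?w t * H t u * indicator (vertices t) u \<partial>?C) =
     ennreal (1 / pmf mu 0) * (\<integral>\<^sup>+ t. ?w t * indicator (leaves t) u * (\<integral>\<^sup>+ s. ?w s * H (graft t u s) u \<partial>?C) \<partial>?C)" for u
  proof -
    define A where "A = {t. u \<in> leaves t}"
    define B where "B = {t. u \<in> vertices t}"
    have bij: "bij_betw (\<lambda>(t, s). graft t u s) (A \<times> UNIV) B"
    proof (rule bij_betw_byWitness[where f' = "\<lambda>t. (graft t u (Node []), subtree t u)"])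
      show "\<forall>p\<in>A \<times> UNIV. (graft (case p of (t, s) \<Rightarrow> graft t u s) u (Node []),
          subtree (case p of (t, s) \<Rightarrow> graft t u s) u) = p"
      proof
        fix p :: "plane_tree \<times> plane_tree" assume "p \<in> A \<times> UNIV"
        then obtain t s where p: "p = (t, s)" "t \<in> A" by auto
        then have t: "u \<in> vertices t" "subtree t u = Node []"
          using leaf_iff[of u t] by (auto simp: A_def leaves_def)
        then show "(graft (case p of (t, s) \<Rightarrow> graft t u s) u (Node []),
          subtree (case p of (t, s) \<Rightarrow> graft t u s) u) = p"
          using graft_subtree[OF t(1)] by (simp add: p graft_graft subtree_graft)
      qed
      show "\<forall>t\<in>B. (case (graft t u (Node []), subtree t u) of (t, s) \<Rightarrow> graft t u s) = t"
        by (auto simp: B_def graft_graft graft_subtree)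
      show "(\<lambda>(t, s). graft t u s) ` (A \<times> UNIV) \<subseteq> B"
        by (auto simp: A_def B_def leaves_def in_vertices_graft)
      show "(\<lambda>t. (graft t u (Node []), subtree t u)) ` B \<subseteq> A \<times> UNIV"
        by (auto simp: A_def B_def leaves_def in_vertices_graft leaf_iff subtree_graft)
    qed
    have weight: "?w (graft t u s) = ennreal (1 / pmf mu 0) * (?w t * ?w s)" if "t \<in> A" for t s
    proof -
      have t: "u \<in> vertices t" "subtree t u = Node []"
        using that leaf_iff[of u t] by (auto simp: A_def leaves_def)
      have "tree_weight mu (graft t u s) = 1 / pmf mu 0 * (tree_weight mu t * tree_weight mu s)"
        using tree_weight_graft[OF t(1), of mu s] mu0 by (simp add: t(2) tree_weight_leaf field_simps)
      then show ?thesis by (simp only: ennreal_mult' tree_weight_nonneg mu0 less_imp_le divide_nonneg_nonneg zero_le_one)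
    qed
    have "(\<integral>\<^sup>+ t. ?w t * H t u * indicator (vertices t) u \<partial>?C) =
        (\<integral>\<^sup>+ t. ?w t * H t u * indicator B t \<partial>?C)"
      by (intro nn_integral_cong) (simp add: B_def indicator_def)
    also have "\<dots> = (\<integral>\<^sup>+ t. ?w t * H t u \<partial>count_space B)"
      by (rule nn_integral_count_space_indicator[symmetric]) simp
    also have "\<dots> = (\<integral>\<^sup>+ p. ?w (case p of (t, s) \<Rightarrow> graft t u s) * H (case p of (t, s) \<Rightarrow> graft t u s) u \<partial>count_space (A \<times> UNIV))"
      by (rule nn_integral_bij_count_space[OF bij, symmetric])
    also have "\<dots> = (\<integral>\<^sup>+ p. (?w (case p of (t, s) \<Rightarrow> graft t u s) * H (case p of (t, s) \<Rightarrow> graft t u s) u) *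
        indicator (A \<times> UNIV) p \<partial>?C)"
      by (rule nn_integral_count_space_indicator) simp
    also have "\<dots> = (\<integral>\<^sup>+ t. \<integral>\<^sup>+ s. (?w (case (t, s) of (t, s) \<Rightarrow> graft t u s) * H (case (t, s) of (t, s) \<Rightarrow> graft t u s) u) *
        indicator (A \<times> UNIV) (t, s) \<partial>?C \<partial>?C)"
      by (rule nn_integral_fst_count_space[symmetric])
    also have "\<dots> = (\<integral>\<^sup>+ t. \<integral>\<^sup>+ s. ennreal (1 / pmf mu 0) * (?w t * indicator (leaves t) u * (?w s * H (graft t u s) u)) \<partial>?C \<partial>?C)"
    proof (intro nn_integral_cong)
      fix t s
      show "(?w (case (t, s) of (t, s) \<Rightarrow> graft t u s) * H (case (t, s) of (t, s) \<Rightarrow> graft t u s) u) *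
        indicator (A \<times> UNIV) (t, s) = ennreal (1 / pmf mu 0) * (?w t * indicator (leaves t) u * (?w s * H (graft t u s) u))"
        by (cases "t \<in> A") (simp_all only: prod.case weight, auto simp: A_def indicator_def mult.assoc)
    qed
    also have "\<dots> = ennreal (1 / pmf mu 0) * (\<integral>\<^sup>+ t. ?w t * indicator (leaves t) u * (\<integral>\<^sup>+ s. ?w s * H (graft t u s) u \<partial>?C) \<partial>?C)"
      by (simp add: nn_integral_cmult)
    finally show ?thesis .
  qed
  have swap: "(\<integral>\<^sup>+ t. \<integral>\<^sup>+ u. f t u \<partial>?C \<partial>?C) = (\<integral>\<^sup>+ u. \<integral>\<^sup>+ t. f t u \<partial>?C \<partial>?C)"
    for f :: "plane_tree \<Rightarrow> nat list \<Rightarrow> ennreal"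
    using nn_integral_fst_count_space[of "\<lambda>(t, u). f t u"] nn_integral_snd_count_space[of "\<lambda>(t, u). f t u"] by simp
  have "(\<integral>\<^sup>+ t. (\<Sum>u\<in>vertices t. H t u) \<partial>bgw) = (\<integral>\<^sup>+ t. \<integral>\<^sup>+ u. ?w t * H t u * indicator (vertices t) u \<partial>?C \<partial>?C)"
    by (simp add: nn_integral_measure_pmf pmf_bgw sum_eq_nn_integral finite_vertices mult.assoc nn_integral_cmult)
  also have "\<dots> = (\<integral>\<^sup>+ u. ennreal (1 / pmf mu 0) * (\<integral>\<^sup>+ t. ?w t * indicator (leaves t) u * (\<integral>\<^sup>+ s. ?w s * H (graft t u s) u \<partial>?C) \<partial>?C) \<partial>?C)"
    by (subst swap) (simp only: split)
  also have "\<dots> = ennreal (1 / pmf mu 0) * (\<integral>\<^sup>+ t. \<integral>\<^sup>+ u. ?w t * indicator (leaves t) u * (\<integral>\<^sup>+ s. ?w s * H (graft t u s) u \<partial>?C) \<partial>?C \<partial>?C)"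
    by (subst swap) (simp add: nn_integral_cmult)
  also have "(\<integral>\<^sup>+ t. \<integral>\<^sup>+ u. ?w t * indicator (leaves t) u * (\<integral>\<^sup>+ s. ?w s * H (graft t u s) u \<partial>?C) \<partial>?C \<partial>?C) =
     (\<integral>\<^sup>+ t. (\<Sum>u\<in>leaves t. \<integral>\<^sup>+ s. H (graft t u s) u \<partial>bgw) \<partial>bgw)"
    by (simp add: nn_integral_measure_pmf[of bgw] pmf_bgw sum_eq_nn_integral finite_leaves nn_integral_cmult[symmetric] ac_simps)
  finally show ?thesis .
qed

text \<open>The case \<open>H = 1\<close> of \<open>many_to_one\<close>: the measure of trees with a
  marked leaf, divided by \<open>pmf mu 0\<close>, has total mass \<open>msize\<close>.\<close>

lemma nn_integral_leaves:
  "ennreal (1 / pmf mu 0) * (\<integral>\<^sup>+ t. of_nat (card (leaves t)) \<partial>bgw) = ennreal msize"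
  using many_to_one[of "\<lambda>_ _. 1"] by (simp add: nn_integral_tsize measure_pmf.emeasure_space_1)

end

section \<open>Regularly varying offspring tails\<close>

locale heavy_tailed = subcritical mu m for mu m +
  fixes beta :: real and L :: "real \<Rightarrow> real"
  assumes beta: "1 < beta" and slow: "slowly_varying L"
    and tail_L: "\<And>i::nat. i \<ge> 1 \<Longrightarrow> measure_pmf.prob mu {i..} = L (real i) / real i powr beta"
begin

text \<open>Real thresholds avoid rounding of \<open>x * real n\<close>; only at positive integers
  does \<open>L\<close> describe the value.\<close>

definition tail :: "real \<Rightarrow> real" where
  "tail y = measure_pmf.prob mu {k. y \<le> real k}"

lemma tail_antimono: "x \<le> y \<Longrightarrow> tail y \<le> tail x"
  unfolding tail_def by (rule measure_pmf.finite_measure_mono) auto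

lemma tail_nonneg: "0 \<le> tail y"
  by (simp add: tail_def)

lemma tail_le_1: "tail y \<le> 1"
  by (simp add: tail_def)

lemma tail_of_nat: "1 \<le> n \<Longrightarrow> tail (real n) = L (real n) / real n powr beta"
  unfolding tail_def using tail_L[of n] by (simp add: atLeast_def)

lemma tail_ceiling: "tail y = tail (real (nat \<lceil>y\<rceil>))"
proof -
  have "y \<le> real k \<longleftrightarrow> real (nat \<lceil>y\<rceil>) \<le> real k" for k
    by (metis nat_ceiling_le_eq of_nat_le_iff)
  then show ?thesis by (simp add: tail_def)
qed

lemma L_ratio:
  assumes "0 < c" shows "((\<lambda>n. L (c * real n) / L (real n)) \<longlongrightarrow> 1) sequentially"
  using slow assms unfolding slowly_varying_def
  by (auto intro: filterlim_compose[OF _ filterlim_real_sequentially])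

text \<open>The ratio \<open>L x / L x\<close> tends to 1 while division by zero yields 0, so
  \<open>L\<close> does not vanish at large integers; monotonicity carries positivity to every
  \<open>y\<close>.\<close>

lemma tail_pos: "0 < tail y"
proof -
  have "eventually (\<lambda>n. L (1 * real n) / L (real n) > 0) sequentially"
    using L_ratio[of 1] by (rule order_tendstoD) simp_all
  moreover have "eventually (\<lambda>n. y \<le> real n \<and> 1 \<le> n) sequentially"
    by (intro eventually_conj eventually_ge_at_top) real_asymp
  ultimately have "eventually (\<lambda>n. L (real n) \<noteq> 0 \<and> y \<le> real n \<and> 1 \<le> n) sequentially"
    by eventually_elim auto
  then obtain n where n: "L (real n) \<noteq> 0" "y \<le> real n" "1 \<le> n"
    using eventually_happens'[OF sequentially_bot] by blast
  then have "tail (real n) \<noteq> 0" by (simp add: tail_of_nat)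
  then have "0 < tail (real n)" using tail_nonneg[of "real n"] by linarith
  with tail_antimono[OF n(2)] show ?thesis by linarith
qed

text \<open>For an integer ratio both thresholds are integers, where the tail is expressed by
  \<open>L\<close>.\<close>

lemma tail_ratio_nat:
  assumes "1 \<le> c"
  shows "(\<lambda>n. tail (real c * real n) / tail (real n)) \<longlonglongrightarrow> real c powr - beta"
proof -
  have "(\<lambda>n. L (real c * real n) / L (real n) * real c powr - beta) \<longlonglongrightarrow> 1 * real c powr - beta"
    using assms by (intro tendsto_mult L_ratio tendsto_const) simp
  moreover have "eventually (\<lambda>n. L (real c * real n) / L (real n) * real c powr - beta =
      tail (real c * real n) / tail (real n)) sequentially"
    using eventually_ge_at_top[of 1]
  proof eventually_elim
    case (elim n)
    have "tail (real c * real n) = L (real c * real n) / (real c * real n) powr beta"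
      using tail_of_nat[of "c * n"] elim assms by simp
    then show ?case
      using elim assms by (simp add: tail_of_nat powr_mult powr_minus divide_simps mult_ac)
  qed
  ultimately show ?thesis by (simp add: tendsto_cong)
qed

text \<open>
  The slow variation of \<open>L\<close> is only informative at integers. A real ratio \<open>x\<close> is squeezed between the
  two integers next to \<open>M x\<close> for a large integer \<open>M\<close>.
\<close>

lemma tail_ratio:
  assumes x: "0 < x"
  shows "(\<lambda>n. tail (x * real n) / tail (real n)) \<longlonglongrightarrow> x powr - beta"
proof -
  define c where "c n = nat \<lceil>x * real n\<rceil>" for n
  have c: "tail (x * real n) = tail (real (c n))" for n
    unfolding c_def by (rule tail_ceiling)
  have cb: "x * real n \<le> real (c n)" "real (c n) \<le> x * real n + 1" for n
    unfolding c_def using x by (auto simp: of_nat_ceiling of_nat_nat) 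
  have lim_c: "filterlim c at_top sequentially"
  proof (rule filterlim_at_top_mono)
    show "filterlim (\<lambda>n. nat \<lfloor>x * real n\<rfloor>) at_top sequentially"
      using x by real_asymp
    show "eventually (\<lambda>n. nat \<lfloor>x * real n\<rfloor> \<le> c n) sequentially"
      unfolding c_def by (intro always_eventually allI nat_mono) linarith
  qed
  \<comment> \<open>The wanted ratio is this factor times \<open>tail (M * c n) / tail n\<close>,
    whose numerator is then compared with \<open>tail (N * n)\<close> for an integer
    \<open>N\<close>.\<close>
  have r: "(\<lambda>n. tail (real (c n)) / tail (real M * real (c n))) \<longlonglongrightarrow> real M powr beta" if "1 \<le> M" for M
  proof -
    have "(\<lambda>n. inverse (tail (real M * real (c n)) / tail (real (c n)))) \<longlonglongrightarrow> inverse (real M powr - beta)"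
      using that by (intro tendsto_inverse filterlim_compose[OF tail_ratio_nat lim_c]) auto
    then show ?thesis by (simp add: powr_minus)
  qed
  show ?thesis
  proof (rule order_tendstoI)
    fix a assume a: "a < x powr - beta"
    have "(\<lambda>M. (real M / (x * real M + 2)) powr beta) \<longlonglongrightarrow> (1 / x) powr beta"
      using x beta by (intro tendsto_powr) (real_asymp, auto simp: field_simps)
    then have "eventually (\<lambda>M. a < (real M / (x * real M + 2)) powr beta) sequentially"
      using a x by (intro order_tendstoD) (auto simp: powr_minus powr_divide divide_simps)
    then have "eventually (\<lambda>M. a < (real M / (x * real M + 2)) powr beta \<and> 1 \<le> M) sequentially"
      by (intro eventually_conj eventually_ge_at_top)
    then obtain M where M: "a < (real M / (x * real M + 2)) powr beta" "1 \<le> M"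
      using eventually_happens'[OF sequentially_bot] by blast
    \<comment> \<open>The extra unit absorbs \<open>M\<close> times the rounding error of
      \<open>c n\<close> as soon as \<open>M \<le> n\<close>.\<close>
    define N where "N = nat \<lceil>real M * x\<rceil> + 1"
    have N: "real M * x + 1 \<le> real N" "real N \<le> real M * x + 2" "1 \<le> N"
      unfolding N_def using x by (simp_all add: of_nat_ceiling of_nat_nat) linarith?
    have "(\<lambda>n. tail (real (c n)) / tail (real M * real (c n)) * (tail (real N * real n) / tail (real n)))
        \<longlonglongrightarrow> real M powr beta * real N powr - beta"
      using M(2) N(3) by (intro tendsto_mult r tail_ratio_nat)
    moreover have "a < real M powr beta * real N powr - beta"
    proof -
      have "real M / (x * real M + 2) \<le> real M / real N"
        using N M x by (intro divide_left_mono) (auto simp: mult.commute intro!: mult_pos_pos add_pos_pos)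
      then have "(real M / (x * real M + 2)) powr beta \<le> (real M / real N) powr beta"
        using x beta by (intro powr_mono2) auto
      moreover have "(real M / real N) powr beta = real M powr beta * real N powr - beta"
        using powr_divide[of "real M" "real N" beta] by (simp add: powr_minus divide_inverse)
      ultimately show ?thesis using M(1) by linarith
    qed
    ultimately have "eventually (\<lambda>n. a < tail (real (c n)) / tail (real M * real (c n)) * (tail (real N * real n) / tail (real n))) sequentially"
      by (rule order_tendstoD)
    then show "eventually (\<lambda>n. a < tail (x * real n) / tail (real n)) sequentially"
      using eventually_ge_at_top[of M]
    proof eventually_elim
      case (elim n)
      have "real M * real (c n) \<le> real M * (x * real n + 1)" using cb by (intro mult_left_mono) auto
      also have "\<dots> \<le> (real M * x + 1) * real n" using elim(2) by (simp add: algebra_simps)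
      also have "\<dots> \<le> real N * real n" using N(1) by (intro mult_right_mono) auto
      finally have "tail (real N * real n) \<le> tail (real M * real (c n))" by (rule tail_antimono)
      then have "tail (real (c n)) / tail (real M * real (c n)) * (tail (real N * real n) / tail (real n))
        \<le> tail (real (c n)) / tail (real n)"
        using tail_pos by (simp add: divide_simps mult_left_mono mult_right_mono less_imp_le)
      with elim(1) show ?case unfolding c by linarith
    qed
  next
    fix a assume a: "x powr - beta < a"
    have "(\<lambda>M. (real M / (x * real M - 1)) powr beta) \<longlonglongrightarrow> (1 / x) powr beta"
      using x beta by (intro tendsto_powr) (real_asymp, auto simp: field_simps)
    then have "eventually (\<lambda>M. (real M / (x * real M - 1)) powr beta < a) sequentially"
      using a x by (intro order_tendstoD) (auto simp: powr_minus powr_divide divide_simps)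
    moreover have "eventually (\<lambda>M. 2 \<le> x * real M) sequentially" using x by real_asymp
    ultimately have "eventually (\<lambda>M. (real M / (x * real M - 1)) powr beta < a \<and> 2 \<le> x * real M \<and> 1 \<le> M) sequentially"
      by (intro eventually_conj eventually_ge_at_top)
    then obtain M where M: "(real M / (x * real M - 1)) powr beta < a" "2 \<le> x * real M" "1 \<le> M"
      using eventually_happens'[OF sequentially_bot] by blast
    \<comment> \<open>Here the rounding in \<open>c n\<close> goes in the right direction, so the
      floor needs no margin.\<close>
    define N where "N = nat \<lfloor>real M * x\<rfloor>"
    have N: "real M * x - 1 \<le> real N" "real N \<le> real M * x" "1 \<le> N"
      unfolding N_def using x M(2) by (simp_all add: of_nat_floor le_nat_floor mult.commute) linarith?
    have "(\<lambda>n. tail (real (c n)) / tail (real M * real (c n)) * (tail (real N * real n) / tail (real n)))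
        \<longlonglongrightarrow> real M powr beta * real N powr - beta"
      using M(3) N(3) by (intro tendsto_mult r tail_ratio_nat)
    moreover have "real M powr beta * real N powr - beta < a"
    proof -
      have "real M / real N \<le> real M / (x * real M - 1)"
        using N M x by (intro divide_left_mono) (auto simp: mult.commute intro!: mult_pos_pos)
      then have "(real M / real N) powr beta \<le> (real M / (x * real M - 1)) powr beta"
        using x beta by (intro powr_mono2) auto
      moreover have "(real M / real N) powr beta = real M powr beta * real N powr - beta"
        using powr_divide[of "real M" "real N" beta] by (simp add: powr_minus divide_inverse)
      ultimately show ?thesis using M(1) by linarith
    qed
    ultimately have "eventually (\<lambda>n. tail (real (c n)) / tail (real M * real (c n)) * (tail (real N * real n) / tail (real n)) < a) sequentially"
      by (rule order_tendstoD)
    then show "eventually (\<lambda>n. tail (x * real n) / tail (real n) < a) sequentially"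
    proof eventually_elim
      case (elim n)
      have "real N * real n \<le> (real M * x) * real n" using N(2) by (intro mult_right_mono) auto
      also have "\<dots> \<le> real M * real (c n)" using cb(1)[of n] by (simp add: mult.assoc mult_left_mono)
      finally have "tail (real M * real (c n)) \<le> tail (real N * real n)" by (rule tail_antimono)
      then have "tail (real (c n)) / tail (real n)
        \<le> tail (real (c n)) / tail (real M * real (c n)) * (tail (real N * real n) / tail (real n))"
        using tail_pos by (simp add: divide_simps mult_left_mono mult_right_mono less_imp_le)
      with elim show ?case unfolding c by linarith
    qed
  qed
qed

text \<open>Half of the room, so that \<open>1 < 1 + gam < beta\<close>: the moment of order
  \<open>1 + gam\<close> is finite and gains a power over the mean.\<close>

definition gam :: real where "gam = (beta - 1) / 2"

lemma gam_pos: "0 < gam"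
  using beta by (simp add: gam_def)

text \<open>Doubling argument. From some \<open>N\<close> on, each doubling multiplies the tail by
  at most \<open>rho\<close> and the integrand by \<open>2 powr (1 + gam)\<close>. The exponent of
  \<open>rho\<close> is the midpoint of \<open>1 + gam\<close> and \<open>beta\<close>, which makes
  the product of the two factors less than 1.\<close>

lemma finite_moment: "(\<integral>\<^sup>+ k. ennreal (real k powr (1 + gam)) \<partial>mu) < \<infinity>"
proof -
  define rho where "rho = 2 powr - ((beta + 1 + gam) / 2)"
  have g: "1 + gam < beta" using beta by (simp add: gam_def field_simps)
  have rho: "2 powr - beta < rho" "0 < rho" "2 powr (1 + gam) * rho < 1"
  proof -
    show "2 powr - beta < rho" "0 < rho" using g by (simp_all add: rho_def)
    have "2 powr (1 + gam) * rho = 2 powr (1 + gam - (beta + 1 + gam) / 2)"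
      unfolding rho_def by (simp only: powr_add[symmetric]) simp
    also have "\<dots> < 2 powr 0" using g by (intro powr_less_mono) auto
    finally show "2 powr (1 + gam) * rho < 1" by simp
  qed
  have "eventually (\<lambda>n. tail (real 2 * real n) / tail (real n) < rho) sequentially"
    using tail_ratio_nat[of 2] rho(1) by (intro order_tendstoD) simp_all
  then obtain N0 where N0: "\<And>n. N0 \<le> n \<Longrightarrow> tail (real 2 * real n) / tail (real n) < rho"
    by (auto simp: eventually_at_top_linorder)
  define N where "N = max N0 1"
  have N: "1 \<le> N" "\<And>n. N \<le> n \<Longrightarrow> tail (2 * real n) \<le> rho * tail (real n)"
    using N0 tail_pos by (fastforce simp: N_def divide_simps)+
  have dec: "tail (real (2 ^ j * N)) \<le> rho ^ j" for j
  proof (induction j)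
    case 0 show ?case by (simp add: tail_le_1)
  next
    case (Suc j)
    have "N \<le> 2 ^ j * N" by simp
    from N(2)[OF this] have "tail (real (2 ^ Suc j * N)) \<le> rho * tail (real (2 ^ j * N))" by (simp add: mult.assoc)
    also have "\<dots> \<le> rho * rho ^ j" using Suc rho by (intro mult_left_mono) auto
    finally show ?case by simp
  qed
  define q where "q = 2 powr (1 + gam)"
  have q: "0 < q" "q * rho < 1" using rho by (auto simp: q_def)
  \<comment> \<open>The term of the series that belongs to the dyadic block of \<open>k\<close>
    already dominates; the summand 1 covers \<open>k < N\<close>.\<close>
  have pw: "ennreal (real k powr (1 + gam)) \<le> ennreal (real N powr (1 + gam)) *
      (1 + (\<Sum>j. ennreal (q ^ Suc j) * indicator {k. real (2 ^ j * N) \<le> real k} k))" for k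
  proof (cases "k < N")
    case True
    then have "real k powr (1 + gam) \<le> real N powr (1 + gam)" using gam_pos by (intro powr_mono2) auto
    then have "ennreal (real k powr (1 + gam)) \<le> ennreal (real N powr (1 + gam)) * 1" by (simp add: ennreal_leI)
    also have "\<dots> \<le> ennreal (real N powr (1 + gam)) *
      (1 + (\<Sum>j. ennreal (q ^ Suc j) * indicator {k. real (2 ^ j * N) \<le> real k} k))"
      by (intro mult_left_mono) auto
    finally show ?thesis .
  next
    case False
    have "\<exists>j. k < 2 ^ j * N"
      using N(1) by (intro exI[of _ k]) (metis less_exp less_le_trans mult.right_neutral mult_le_mono2)
    then obtain j where j: "k < 2 ^ j * N" "\<And>i. i < j \<Longrightarrow> \<not> k < 2 ^ i * N"
      using exists_least_iff[of "\<lambda>j. k < 2 ^ j * N"] by auto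
    then obtain i where i: "j = Suc i" using False by (cases j) auto
    have "real k \<le> real (2 ^ Suc i * N)" using j(1) i by (simp only: of_nat_le_iff)
    also have "\<dots> = 2 ^ Suc i * real N" by simp
    finally have "real k powr (1 + gam) \<le> (2 ^ Suc i * real N) powr (1 + gam)"
      using gam_pos by (intro powr_mono2) auto
    also have "\<dots> = real N powr (1 + gam) * q ^ Suc i"
      by (simp only: powr_mult q_def powr_power powr_realpow[symmetric]) (simp add: powr_powr mult.commute powr_add[symmetric] algebra_simps)
    finally have "ennreal (real k powr (1 + gam)) \<le> ennreal (real N powr (1 + gam)) * ennreal (q ^ Suc i)"
      using q by (simp only: ennreal_mult[symmetric] powr_ge_zero zero_le_power less_imp_le ennreal_leI)
    also have "ennreal (q ^ Suc i) = (\<Sum>j\<in>{i}. ennreal (q ^ Suc j) * indicator {k. real (2 ^ j * N) \<le> real k} k)"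
      using j(2)[of i] i by (simp add: not_less del: of_nat_mult of_nat_power)
    also have "\<dots> \<le> (\<Sum>j. ennreal (q ^ Suc j) * indicator {k. real (2 ^ j * N) \<le> real k} k)"
      by (rule sum_le_suminf) auto
    also have "\<dots> \<le> 1 + \<dots>" by simp
    finally show ?thesis by (simp add: mult_left_mono)
  qed
  have "(\<integral>\<^sup>+ k. ennreal (real k powr (1 + gam)) \<partial>mu) \<le>
     (\<integral>\<^sup>+ k. ennreal (real N powr (1 + gam)) *
      (1 + (\<Sum>j. ennreal (q ^ Suc j) * indicator {k. real (2 ^ j * N) \<le> real k} k)) \<partial>mu)"
    by (intro nn_integral_mono pw)
  also have "\<dots> = ennreal (real N powr (1 + gam)) * (1 + (\<Sum>j. ennreal (q ^ Suc j) * ennreal (tail (real (2 ^ j * N)))))"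
    by (simp add: nn_integral_cmult nn_integral_add nn_integral_suminf measure_pmf.emeasure_space_1
       tail_def measure_pmf.emeasure_eq_measure del: of_nat_mult of_nat_power)
  also have "\<dots> \<le> ennreal (real N powr (1 + gam)) * (1 + (\<Sum>j. ennreal (q * (q * rho) ^ j)))"
  proof (intro mult_left_mono add_left_mono suminf_le)
    fix j
    have "ennreal (q ^ Suc j) * ennreal (tail (real (2 ^ j * N))) \<le> ennreal (q ^ Suc j) * ennreal (rho ^ j)"
      by (intro mult_left_mono ennreal_leI dec) auto
    then show "ennreal (q ^ Suc j) * ennreal (tail (real (2 ^ j * N))) \<le> ennreal (q * (q * rho) ^ j)"
      using q rho by (simp add: ennreal_mult[symmetric] power_mult_distrib mult.assoc)
  qed auto
  also have "(\<Sum>j. ennreal (q * (q * rho) ^ j)) < \<infinity>"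
  proof -
    have "summable (\<lambda>j. q * (q * rho) ^ j)" using q rho by (intro summable_mult summable_geometric) simp
    then show ?thesis using q rho by (subst suminf_ennreal2) auto
  qed
  then have "ennreal (real N powr (1 + gam)) * (1 + (\<Sum>j. ennreal (q * (q * rho) ^ j))) < \<infinity>"
    by (simp add: ennreal_mult_less_top)
  finally show ?thesis .
qed

section \<open>Power bounds on the offspring tail\<close>

definition cmom :: real where
  "cmom = enn2real (\<integral>\<^sup>+ k. ennreal (real k powr (1 + gam)) \<partial>mu)"

lemma cmom_nonneg: "0 \<le> cmom" by (simp add: cmom_def)

lemma cmom_eq: "(\<integral>\<^sup>+ k. ennreal (real k powr (1 + gam)) \<partial>mu) = ennreal cmom"
  using finite_moment by (simp add: cmom_def)

lemma truncated_mean_le: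
  assumes y: "0 < y"
  shows "(\<integral>\<^sup>+ k. ennreal (real k) * indicator {k. y \<le> real k} k \<partial>mu) \<le> ennreal (cmom * y powr - gam)"
proof -
  have "ennreal (real k) * indicator {k. y \<le> real k} k \<le> ennreal (y powr - gam) * ennreal (real k powr (1 + gam))" for k
  proof (cases "y \<le> real k")
    case True
    then have "y powr gam \<le> real k powr gam" using y gam_pos by (intro powr_mono2) auto
    then have "real k * y powr gam \<le> real k powr (1 + gam)"
      using True y by (simp add: powr_add mult_left_mono)
    then have "real k \<le> y powr - gam * real k powr (1 + gam)"
      using y by (simp add: powr_minus field_simps)
    then show ?thesis using True by (simp add: ennreal_mult[symmetric] ennreal_leI)
  qed simp
  then have "(\<integral>\<^sup>+ k. ennreal (real k) * indicator {k. y \<le> real k} k \<partial>mu) \<le>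
    (\<integral>\<^sup>+ k. ennreal (y powr - gam) * ennreal (real k powr (1 + gam)) \<partial>mu)"
    by (intro nn_integral_mono)
  also have "\<dots> = ennreal (cmom * y powr - gam)"
    by (subst nn_integral_cmult) (simp_all add: cmom_eq ennreal_mult'' cmom_nonneg mult.commute)
  finally show ?thesis .
qed

lemma tail_le_powr:
  assumes y: "0 < y" shows "y * tail y \<le> cmom * y powr - gam"
proof -
  have "ennreal (y * tail y) = (\<integral>\<^sup>+ k. ennreal y * indicator {k. y \<le> real k} k \<partial>mu)"
    using y by (simp add: nn_integral_cmult tail_def ennreal_mult' measure_pmf.emeasure_eq_measure)
  also have "\<dots> \<le> (\<integral>\<^sup>+ k. ennreal (real k) * indicator {k. y \<le> real k} k \<partial>mu)"
    by (intro nn_integral_mono) (auto split: split_indicator intro: ennreal_leI)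
  also have "\<dots> \<le> ennreal (cmom * y powr - gam)" by (rule truncated_mean_le[OF y])
  finally show ?thesis
    by (rule ennreal_le_iff[THEN iffD1, rotated]) (simp add: cmom_nonneg)
qed

text \<open>Makes union bounds over forests of order \<open>n\<close> trees harmless; the gain is
  the power \<open>gam\<close> beyond the first moment.\<close>

lemma n_tail_tendsto_0:
  assumes d: "0 < d" shows "(\<lambda>n. real n * tail (d * real n)) \<longlonglongrightarrow> 0"
proof (rule tendsto_sandwich[where f = "\<lambda>_. 0"])
  show "(\<lambda>n. (cmom / d) * (d * real n) powr - gam) \<longlonglongrightarrow> 0"
    using d gam_pos by real_asymp
  show "eventually (\<lambda>n. 0 \<le> real n * tail (d * real n)) sequentially"
    by (simp add: tail_nonneg)
  show "eventually (\<lambda>n. real n * tail (d * real n) \<le> (cmom / d) * (d * real n) powr - gam) sequentially"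
    using eventually_gt_at_top[of 0]
  proof eventually_elim
    case (elim n)
    then show ?case using tail_le_powr[of "d * real n"] d by (simp add: field_simps)
  qed
qed simp

text \<open>The doubling argument from below: the tail loses at most a factor
  \<open>2 powr - (beta + 1)\<close> per doubling, hence is at least of order
  \<open>n powr - (beta + 1)\<close>. This makes polynomial error bounds negligible relative to the
  tail itself.\<close>

lemma powr_over_tail:
  assumes k: "beta + 1 < k" shows "(\<lambda>n. real n powr - k / tail (real n)) \<longlonglongrightarrow> 0"
proof -
  define rho where "rho = (2::real) powr - (beta + 1)"
  have rho: "rho < 2 powr - beta" "0 < rho" by (simp_all add: rho_def)
  have "eventually (\<lambda>n. rho < tail (real 2 * real n) / tail (real n)) sequentially"
    using tail_ratio_nat[of 2] rho(1) by (intro order_tendstoD) simp_all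
  then obtain N0 where N0: "\<And>n. N0 \<le> n \<Longrightarrow> rho < tail (real 2 * real n) / tail (real n)"
    by (auto simp: eventually_at_top_linorder)
  define N where "N = max N0 1"
  have N: "1 \<le> N" "\<And>n. N \<le> n \<Longrightarrow> rho * tail (real n) \<le> tail (2 * real n)"
    using N0 tail_pos by (fastforce simp: N_def divide_simps)+
  have dec: "rho ^ j * tail (real N) \<le> tail (real (2 ^ j * N))" for j
  proof (induction j)
    case (Suc j)
    have "N \<le> 2 ^ j * N" by simp
    from N(2)[OF this] have "rho * tail (real (2 ^ j * N)) \<le> tail (real (2 ^ Suc j * N))" by (simp add: mult.assoc)
    moreover have "rho * (rho ^ j * tail (real N)) \<le> rho * tail (real (2 ^ j * N))"
      using Suc rho by (intro mult_left_mono) auto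
    ultimately show ?case by simp
  qed simp
  define c where "c = tail (real N) * (real N / 2) powr (beta + 1)"
  have c: "0 < c" using N tail_pos by (simp add: c_def)
  have low: "c * real n powr - (beta + 1) \<le> tail (real n)" if n: "N \<le> n" for n
  proof -
    have "\<exists>j. n \<le> 2 ^ j * N"
      using N(1) by (intro exI[of _ n]) (metis less_exp less_imp_le le_trans mult.right_neutral mult_le_mono2)
    then obtain j where j: "n \<le> 2 ^ j * N" "\<And>i. i < j \<Longrightarrow> \<not> n \<le> 2 ^ i * N"
      using exists_least_iff[of "\<lambda>j. n \<le> 2 ^ j * N"] by auto
    have "2 ^ j * real N \<le> 2 * real n"
    proof (cases j)
      case 0 then show ?thesis using n by simp
    next
      case (Suc i)
      have "real (2 ^ i * N) \<le> real n" using j(2)[of i] Suc by (simp only: of_nat_le_iff) simp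
      then show ?thesis using Suc by simp
    qed
    then have "real N / (2 * real n) \<le> 1 / 2 ^ j" using N n by (simp add: field_simps)
    then have "(real N / (2 * real n)) powr (beta + 1) \<le> (1 / 2 ^ j) powr (beta + 1)"
      using beta by (intro powr_mono2) auto
    also have "\<dots> = rho ^ j"
    proof -
      have "1 / 2 ^ j = (2::real) powr - real j" by (simp add: powr_minus powr_realpow inverse_eq_divide)
      then show ?thesis by (simp add: rho_def powr_power powr_powr algebra_simps)
    qed
    finally have "(real N / (2 * real n)) powr (beta + 1) * tail (real N) \<le> rho ^ j * tail (real N)"
      by (intro mult_right_mono tail_nonneg)
    also have "\<dots> \<le> tail (real (2 ^ j * N))" by (rule dec)
    also have "\<dots> \<le> tail (real n)" using j(1) by (intro tail_antimono) (simp only: of_nat_le_iff)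
    finally have "(real N / (2 * real n)) powr (beta + 1) * tail (real N) \<le> tail (real n)" .
    moreover have "real n powr (- beta - 1) = 1 / real n powr (beta + 1)"
      using powr_minus[of "real n" "beta + 1"] by (simp add: inverse_eq_divide)
    ultimately show ?thesis
      by (simp add: c_def powr_divide powr_mult mult_ac)
  qed
  show ?thesis
  proof (rule tendsto_sandwich[where f = "\<lambda>_. 0"])
    show "(\<lambda>n. real n powr - k / (c * real n powr - (beta + 1))) \<longlonglongrightarrow> 0"
      using c k by real_asymp
    show "eventually (\<lambda>n. 0 \<le> real n powr - k / tail (real n)) sequentially"
      by (simp add: tail_nonneg)
    show "eventually (\<lambda>n. real n powr - k / tail (real n) \<le> real n powr - k / (c * real n powr - (beta + 1))) sequentially"
      using eventually_ge_at_top[of N]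
    proof eventually_elim
      case (elim n)
      have "0 < c * real n powr - (beta + 1)" using c elim N by simp
      then show ?case using low[OF elim] tail_pos by (intro divide_left_mono) auto
    qed
  qed simp
qed

end

section \<open>Trees and forests without large degrees\<close>

definition small_degrees :: "real \<Rightarrow> plane_tree \<Rightarrow> bool" where
  "small_degrees y t \<longleftrightarrow> (\<forall>u\<in>vertices t. real (num_children t u) < y)"

lemma small_degrees_Node:
  "small_degrees y (Node ts) \<longleftrightarrow> real (length ts) < y \<and> (\<forall>t\<in>set ts. small_degrees y t)"
  by (force simp: small_degrees_def in_set_conv_nth)

lemma forest_union:
  "measure_pmf.prob (replicate_pmf k p) {ts. \<exists>t\<in>set ts. P t} \<le> real k * measure_pmf.prob p {t. P t}"
proof -
  have "ennreal (measure_pmf.prob (replicate_pmf k p) {ts. \<exists>t\<in>set ts. P t}) =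
      (\<integral>\<^sup>+ ts. indicator {ts. \<exists>t\<in>set ts. P t} ts \<partial>replicate_pmf k p)"
    by (simp add: measure_pmf.emeasure_eq_measure)
  also have "\<dots> \<le> (\<integral>\<^sup>+ ts. sum_list (map (indicator {t. P t}) ts) \<partial>replicate_pmf k p)"
  proof (rule nn_integral_mono)
    fix ts
    show "indicator {ts. \<exists>t\<in>set ts. P t} ts \<le> (sum_list (map (indicator {t. P t}) ts) :: ennreal)"
    proof (cases "\<exists>t\<in>set ts. P t")
      case True
      then have "(1 :: ennreal) \<in> set (map (indicator {t. P t}) ts)" by (force simp: indicator_def)
      then have "(1 :: ennreal) \<le> sum_list (map (indicator {t. P t}) ts)" by (rule member_le_sum_list) simp
      with True show ?thesis by simp
    qed simp
  qed
  also have "\<dots> = ennreal (real k * measure_pmf.prob p {t. P t})"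
    by (simp add: nn_integral_replicate_sum_list measure_pmf.emeasure_eq_measure ennreal_mult ennreal_of_nat_eq_real_of_nat)
  finally show ?thesis by (rule ennreal_le_iff[THEN iffD1, rotated]) simp
qed

context subcritical
begin

text \<open>Restricting degrees keeps the product structure of the weights, with offspring weights
  \<open>exp lam * pmf mu k\<close> for \<open>k < y\<close>. The hypothesis says exactly that
  \<open>exp s\<close> is a supersolution of the resulting recursion, so \<open>tree_sum_le\<close>
  applies.\<close>

lemma small_degrees_mgf:
  assumes "(\<integral>\<^sup>+ k. ennreal (exp (s * real k)) * indicator {k. real k < y} k \<partial>mu) \<le> ennreal (exp (s - lam))"
  shows "(\<integral>\<^sup>+ t. ennreal (exp (lam * real (tsize t))) * indicator {t. small_degrees y t} t \<partial>bgw) \<le> ennreal (exp s)"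
proof -
  define g where "g t = ennreal (tree_weight mu t) * (ennreal (exp (lam * real (tsize t))) * indicator {t. small_degrees y t} t)" for t
  define c where "c k = ennreal (exp lam) * (ennreal (pmf mu k) * indicator {k. real k < y} k)" for k
  have "g (Node ts) = c (length ts) * prod_list (map g ts)" for ts
  proof -
    have 1: "prod_list (map g ts) = ennreal (prod_list (map (tree_weight mu) ts)) *
        (ennreal (exp (lam * real (sum_list (map tsize ts)))) * indicator {ts. \<forall>t\<in>set ts. small_degrees y t} ts)"
    proof (induction ts)
      case (Cons t ts)
      then show ?case
        by (simp add: g_def ennreal_mult' tree_weight_nonneg distrib_left exp_add indicator_def mult_ac)
    qed simp
    have "exp (lam * real (tsize (Node ts))) = exp lam * exp (lam * real (sum_list (map tsize ts)))"
      by (simp add: tsize_Node distrib_left exp_add del: vertices.simps)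
    then show ?thesis
      unfolding 1 g_def c_def tree_weight_Node
      by (simp add: small_degrees_Node indicator_def ennreal_mult' mult_ac del: vertices.simps)
  qed
  moreover have "(\<Sum>k. c k * ennreal (exp s) ^ k) \<le> ennreal (exp s)"
  proof -
    have "c k * ennreal (exp s) ^ k = ennreal (exp lam) *
        (ennreal (pmf mu k) * (ennreal (exp (s * real k)) * indicator {k. real k < y} k))" for k
    proof -
      have "ennreal (exp s) ^ k = ennreal (exp (s * real k))"
        by (simp only: ennreal_power exp_ge_zero exp_of_nat2_mult)
      then show ?thesis by (simp add: c_def mult_ac)
    qed
    then have "(\<Sum>k. c k * ennreal (exp s) ^ k) = ennreal (exp lam) *
        (\<Sum>k. ennreal (pmf mu k) * (ennreal (exp (s * real k)) * indicator {k. real k < y} k))"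
      by simp
    also have "(\<Sum>k. ennreal (pmf mu k) * (ennreal (exp (s * real k)) * indicator {k. real k < y} k)) =
        (\<integral>\<^sup>+ k. ennreal (exp (s * real k)) * indicator {k. real k < y} k \<partial>mu)"
      by (simp add: nn_integral_measure_pmf nn_integral_count_space_nat)
    also have "ennreal (exp lam) * \<dots> \<le> ennreal (exp lam) * ennreal (exp (s - lam))"
      by (intro mult_left_mono assms) simp
    also have "\<dots> = ennreal (exp s)" by (simp add: ennreal_mult[symmetric] exp_add[symmetric])
    finally show ?thesis .
  qed
  ultimately have "(\<integral>\<^sup>+ t. g t \<partial>count_space UNIV) \<le> ennreal (exp s)" by (rule tree_sum_le)
  then show ?thesis by (simp add: nn_integral_measure_pmf pmf_bgw g_def)
qed

text \<open>Chernoff's bound. The degree restriction sits inside the moment, so the moment of the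
  forest factorises over its trees.\<close>

lemma forest_large_size:
  assumes mgf: "(\<integral>\<^sup>+ t. ennreal (exp (lam * real (tsize t))) * indicator {t. small_degrees y t} t \<partial>bgw) \<le> ennreal (exp s)"
    and lam: "0 \<le> lam"
  shows "measure_pmf.prob (replicate_pmf k bgw)
      {ts. N \<le> real (sum_list (map tsize ts)) \<and> (\<forall>t\<in>set ts. small_degrees y t)} \<le> exp (s * real k - lam * N)"
proof -
  let ?g = "\<lambda>t. ennreal (exp (lam * real (tsize t))) * indicator {t. small_degrees y t} t"
  let ?A = "{ts. N \<le> real (sum_list (map tsize ts)) \<and> (\<forall>t\<in>set ts. small_degrees y t)}"
  have "ennreal (measure_pmf.prob (replicate_pmf k bgw) ?A) = (\<integral>\<^sup>+ ts. indicator ?A ts \<partial>replicate_pmf k bgw)"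
    by (simp add: measure_pmf.emeasure_eq_measure)
  also have "\<dots> \<le> (\<integral>\<^sup>+ ts. ennreal (exp (- lam * N)) * prod_list (map ?g ts) \<partial>replicate_pmf k bgw)"
  proof (rule nn_integral_mono)
    fix ts
    have p: "prod_list (map ?g ts) = ennreal (exp (lam * real (sum_list (map tsize ts)))) *
        indicator {ts. \<forall>t\<in>set ts. small_degrees y t} ts"
      by (induction ts) (simp_all add: distrib_left exp_add indicator_def ennreal_mult')
    show "indicator ?A ts \<le> ennreal (exp (- lam * N)) * prod_list (map ?g ts)"
    proof (cases "ts \<in> ?A")
      case True
      then have "lam * N \<le> lam * real (sum_list (map tsize ts))" using lam by (intro mult_left_mono) auto
      then have "1 \<le> exp (- lam * N) * exp (lam * real (sum_list (map tsize ts)))"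
        by (simp add: exp_add[symmetric])
      then have "ennreal 1 \<le> ennreal (exp (- lam * N)) * ennreal (exp (lam * real (sum_list (map tsize ts))))"
        by (simp only: ennreal_mult[symmetric] exp_ge_zero ennreal_leI)
      then show ?thesis unfolding p using True by simp
    qed simp
  qed
  also have "\<dots> = ennreal (exp (- lam * N)) * (\<integral>\<^sup>+ t. ?g t \<partial>bgw) ^ k"
    by (simp add: nn_integral_cmult nn_integral_replicate_prod_list)
  also have "\<dots> \<le> ennreal (exp (- lam * N)) * ennreal (exp s) ^ k"
    by (intro mult_left_mono power_mono mgf) auto
  also have "\<dots> = ennreal (exp (s * real k - lam * N))"
    by (simp add: ennreal_power ennreal_mult[symmetric] exp_of_nat_mult[symmetric] exp_add[symmetric] mult.commute)
  finally show ?thesis by (rule ennreal_le_iff[THEN iffD1, rotated]) simp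
qed

lemma small_degrees_large_size:
  assumes mgf: "(\<integral>\<^sup>+ t. ennreal (exp (lam * real (tsize t))) * indicator {t. small_degrees y t} t \<partial>bgw) \<le> ennreal (exp s)"
    and lam: "0 \<le> lam"
  shows "measure_pmf.prob bgw {t. N \<le> real (tsize t) \<and> small_degrees y t} \<le> exp (s - lam * N)"
  using forest_large_size[OF assms, of 1 N] unfolding replicate_pmf_1 by (simp add: vimage_def)

section \<open>Trees with a marked leaf\<close>

lemma num_children_graft_at: "u \<in> leaves t \<Longrightarrow> num_children (graft t u s) u = length (children s)"
  by (simp add: leaves_def in_vertices_graft num_children_subtree subtree_graft)

lemma tsize_graft_leaf: "u \<in> leaves t \<Longrightarrow> tsize (graft t u s) + 1 = tsize t + tsize s"
  using tsize_graft[of u t s] leaf_iff[of u t] by (simp add: leaves_def)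

text \<open>The part of the mass \<open>msize\<close> in \<open>nn_integral_leaves\<close> that is
  carried by pruned trees with more than \<open>y\<close> vertices.\<close>

definition rest :: "real \<Rightarrow> real" where
  "rest y = enn2real (ennreal (1 / pmf mu 0) *
     (\<integral>\<^sup>+ t. of_nat (card (leaves t)) * indicator {t. y < real (tsize t)} t \<partial>bgw))"

lemma rest_eq:
  "ennreal (1 / pmf mu 0) * (\<integral>\<^sup>+ t. of_nat (card (leaves t)) * indicator {t. y < real (tsize t)} t \<partial>bgw) =
    ennreal (rest y)"
proof -
  have "ennreal (1 / pmf mu 0) * (\<integral>\<^sup>+ t. of_nat (card (leaves t)) * indicator {t. y < real (tsize t)} t \<partial>bgw) \<le>
    ennreal (1 / pmf mu 0) * (\<integral>\<^sup>+ t. of_nat (card (leaves t)) \<partial>bgw)"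
    by (intro mult_left_mono nn_integral_mono) (auto split: split_indicator)
  then have "ennreal (1 / pmf mu 0) * (\<integral>\<^sup>+ t. of_nat (card (leaves t)) * indicator {t. y < real (tsize t)} t \<partial>bgw) < \<top>"
    unfolding nn_integral_leaves by (rule le_less_trans) simp
  then show ?thesis unfolding rest_def by simp
qed

lemma rest_nonneg: "0 \<le> rest y"
  by (simp add: rest_def)

lemma rest_complement:
  "ennreal (1 / pmf mu 0) * (\<integral>\<^sup>+ t. of_nat (card (leaves t)) * indicator {t. real (tsize t) \<le> y} t \<partial>bgw) =
    ennreal (msize - rest y)"
proof -
  let ?a = "ennreal (1 / pmf mu 0) * (\<integral>\<^sup>+ t. of_nat (card (leaves t)) * indicator {t. real (tsize t) \<le> y} t \<partial>bgw)"
  have "ennreal msize = ennreal (1 / pmf mu 0) * (\<integral>\<^sup>+ t. of_nat (card (leaves t)) * indicator {t. real (tsize t) \<le> y} t +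
      of_nat (card (leaves t)) * indicator {t. y < real (tsize t)} t \<partial>bgw)"
    unfolding nn_integral_leaves[symmetric]
    by (intro arg_cong2[where f = "(*)"] refl nn_integral_cong) (auto split: split_indicator)
  also have "\<dots> = ?a + ennreal (rest y)"
    by (simp add: nn_integral_add distrib_left rest_eq)
  finally have "?a = ennreal msize - ennreal (rest y)" by (simp add: ennreal_add_diff_cancel_right)
  then show ?thesis by (simp add: ennreal_minus rest_nonneg)
qed

text \<open>Dominated convergence; the number of leaves is an integrable bound because the size has
  finite mean.\<close>

lemma rest_tendsto_0:
  assumes "0 < c" shows "(\<lambda>n. rest (c * real n)) \<longlonglongrightarrow> 0"
proof -
  have fin: "(\<integral>\<^sup>+ t. of_nat (card (leaves t)) \<partial>bgw) < \<infinity>"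
  proof -
    have "(\<integral>\<^sup>+ t. of_nat (card (leaves t)) \<partial>bgw) \<le> (\<integral>\<^sup>+ t. of_nat (tsize t) \<partial>bgw)"
      by (intro nn_integral_mono of_nat_mono card_mono finite_vertices leaves_subset)
    then show ?thesis by (simp add: nn_integral_tsize le_less_trans)
  qed
  have "(\<lambda>n. \<integral>\<^sup>+ t. of_nat (card (leaves t)) * indicator {t. c * real n < real (tsize t)} t \<partial>bgw) \<longlonglongrightarrow>
      (\<integral>\<^sup>+ t. 0 \<partial>bgw)"
  proof (rule nn_integral_dominated_convergence)
    show "AE t in bgw. (\<lambda>n. of_nat (card (leaves t)) * indicator {t. c * real n < real (tsize t)} t) \<longlonglongrightarrow> (0::ennreal)"
    proof (intro AE_I2)
      fix t
      have "eventually (\<lambda>n. real (tsize t) \<le> c * real n) sequentially" using assms by real_asymp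
      then have "eventually (\<lambda>n. of_nat (card (leaves t)) * indicator {t. c * real n < real (tsize t)} t = (0::ennreal)) sequentially"
        by eventually_elim simp
      then show "(\<lambda>n. of_nat (card (leaves t)) * indicator {t. c * real n < real (tsize t)} t) \<longlonglongrightarrow> (0::ennreal)"
        by (simp add: tendsto_eventually)
    qed
    show "(\<integral>\<^sup>+ t. of_nat (card (leaves t)) \<partial>bgw) < \<infinity>" by (rule fin)
  qed (auto split: split_indicator)
  then have "(\<lambda>n. ennreal (1 / pmf mu 0) * (\<integral>\<^sup>+ t. of_nat (card (leaves t)) * indicator {t. c * real n < real (tsize t)} t \<partial>bgw))
      \<longlonglongrightarrow> ennreal (1 / pmf mu 0) * 0"
    by (intro ennreal_tendsto_cmult) simp_all
  then have "(\<lambda>n. ennreal (rest (c * real n))) \<longlonglongrightarrow> ennreal 0" by (simp add: rest_eq)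
  then show ?thesis by (rule tendsto_ennrealD) (simp_all add: rest_nonneg)
qed

end

context heavy_tailed
begin

section \<open>Large degrees and truncated exponential moments\<close>

lemma prob_arity: "measure_pmf.prob bgw {t. y \<le> real (length (children t))} = tail y"
proof -
  have "ennreal (measure_pmf.prob bgw {t. y \<le> real (length (children t))}) =
      (\<integral>\<^sup>+ t. indicator {k. y \<le> real k} (length (children t)) \<partial>bgw)"
    by (simp add: measure_pmf.emeasure_eq_measure[symmetric] indicator_def flip: nn_integral_indicator)
  also have "\<dots> = ennreal (tail y)"
    by (subst nn_integral_bgw_arity) (simp add: tail_def measure_pmf.emeasure_eq_measure)
  finally show ?thesis by (simp add: tail_nonneg)
qed

text \<open>First-moment bound on the number of vertices of degree at least \<open>y\<close>. After
  grafting at a leaf, the degree there is the root degree of an independent tree, so the expectation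
  factorises into \<open>msize\<close> and \<open>tail y\<close>.\<close>

lemma prob_not_small_degrees: "measure_pmf.prob bgw {t. \<not> small_degrees y t} \<le> msize * tail y"
proof -
  define H :: "plane_tree \<Rightarrow> nat list \<Rightarrow> ennreal" where "H t u = indicator {k. y \<le> real k} (num_children t u)" for t u
  have "ennreal (measure_pmf.prob bgw {t. \<not> small_degrees y t}) = (\<integral>\<^sup>+ t. indicator {t. \<not> small_degrees y t} t \<partial>bgw)"
    by (simp add: measure_pmf.emeasure_eq_measure)
  also have "\<dots> \<le> (\<integral>\<^sup>+ t. (\<Sum>u\<in>vertices t. H t u) \<partial>bgw)"
  proof (rule nn_integral_mono)
    fix t show "indicator {t. \<not> small_degrees y t} t \<le> (\<Sum>u\<in>vertices t. H t u)"
    proof (cases "small_degrees y t")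
      case False
      then obtain u where u: "u \<in> vertices t" "H t u = 1"
        by (auto simp: small_degrees_def H_def indicator_def not_less)
      have "H t u \<le> (\<Sum>u\<in>vertices t. H t u)" using u(1) by (intro member_le_sum finite_vertices) auto
      with u False show ?thesis by simp
    qed simp
  qed
  also have "\<dots> = ennreal (1 / pmf mu 0) * (\<integral>\<^sup>+ t. (\<Sum>u\<in>leaves t. \<integral>\<^sup>+ s. H (graft t u s) u \<partial>bgw) \<partial>bgw)"
    by (rule many_to_one)
  also have "\<dots> = ennreal (1 / pmf mu 0) * (\<integral>\<^sup>+ t. of_nat (card (leaves t)) * ennreal (tail y) \<partial>bgw)"
  proof (intro arg_cong2[where f = "(*)"] refl nn_integral_cong)
    fix t
    have "(\<integral>\<^sup>+ s. H (graft t u s) u \<partial>bgw) = ennreal (tail y)" if "u \<in> leaves t" for u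
      unfolding H_def num_children_graft_at[OF that]
      by (subst nn_integral_bgw_arity) (simp add: tail_def measure_pmf.emeasure_eq_measure)
    then show "(\<Sum>u\<in>leaves t. \<integral>\<^sup>+ s. H (graft t u s) u \<partial>bgw) = of_nat (card (leaves t)) * ennreal (tail y)"
      by simp
  qed
  also have "\<dots> = ennreal (msize * tail y)"
    using nn_integral_leaves msize_pos tail_nonneg[of y]
    by (simp add: nn_integral_multc mult.assoc[symmetric] ennreal_mult less_imp_le)
  finally show ?thesis
    by (rule ennreal_le_iff[THEN iffD1, rotated]) (simp add: msize_pos tail_nonneg less_imp_le)
qed

text \<open>
  An exponential moment of order \<open>C ln n / n\<close> is large enough to make events polynomially unlikely, and
  small enough for degrees below \<open>d n\<close> to cost only a factor \<open>n powr (C d)\<close>, which the finite moment of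
  order \<open>1 + gam\<close> absorbs.
\<close>

lemma offspring_mgf:
  assumes C: "0 < C" and eta: "0 < eta"
  obtains d where "0 < d"
    "eventually (\<lambda>n. (\<integral>\<^sup>+ k. ennreal (exp (C * ln (real n) / real n * real k)) * indicator {k. real k < d * real n} k \<partial>mu)
       \<le> ennreal (exp (C * ln (real n) / real n * (m + eta)))) sequentially"
proof -
  \<comment> \<open>With \<open>s = C * ln n / n\<close> this makes \<open>exp (s * (d * n))\<close>
    equal to \<open>n powr (gam / 2)\<close>, which loses against the bound of order
    \<open>(ln n / n) powr gam\<close> on the truncated mean beyond \<open>e / s\<close>.\<close>
  define d where "d = gam / (2 * C)"
  have d: "0 < d" using C gam_pos by (simp add: d_def)
  \<comment> \<open>Below the cut \<open>s * k < e\<close> the exponential inflates the mean by at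
    most \<open>eta / 2\<close>; the denominator \<open>m + 1\<close> covers
    \<open>m = 0\<close>.\<close>
  define e where "e = ln (1 + eta / (2 * (m + 1)))"
  have e: "0 < e" unfolding e_def using eta m_nonneg by (intro ln_gt_zero) simp
  have em: "exp e * m \<le> m + eta / 2"
  proof -
    have "exp e = 1 + eta / (2 * (m + 1))" using eta m_nonneg by (simp add: e_def add_pos_nonneg)
    then have "exp e * m = m + eta / 2 * (m / (m + 1))" by (simp add: algebra_simps)
    also have "\<dots> \<le> m + eta / 2 * 1" using eta m_nonneg by (intro add_left_mono mult_left_mono) auto
    finally show ?thesis by simp
  qed
  have "(\<lambda>n. real n powr (gam / 2) * (cmom * (e / (C * ln (real n) / real n)) powr - gam)) \<longlonglongrightarrow> 0"
    using C e gam_pos by real_asymp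
  then have ev: "eventually (\<lambda>n. real n powr (gam / 2) * (cmom * (e / (C * ln (real n) / real n)) powr - gam) < eta / 2) sequentially"
    by (rule order_tendstoD) (use eta in simp)
  have "eventually (\<lambda>n. (\<integral>\<^sup>+ k. ennreal (exp (C * ln (real n) / real n * real k)) * indicator {k. real k < d * real n} k \<partial>mu)
       \<le> ennreal (exp (C * ln (real n) / real n * (m + eta)))) sequentially"
    using ev eventually_gt_at_top[of 1]
  proof eventually_elim
    case (elim n)
    define s where "s = C * ln (real n) / real n"
    have s: "0 < s" using C elim by (simp add: s_def)
    have edn: "exp (s * (d * real n)) = real n powr (gam / 2)"
      using C elim by (simp add: s_def d_def powr_def field_simps)
    let ?P = "real n powr (gam / 2)"
    \<comment> \<open>From \<open>exp x \<le> 1 + x * exp x\<close>, where the last exponential is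
      at most \<open>exp e\<close> below the cut and at most \<open>n powr (gam / 2)\<close> above
      it.\<close>
    have pw: "ennreal (exp (s * real k)) * indicator {k. real k < d * real n} k \<le>
        1 + ennreal (s * exp e) * ennreal (real k) + ennreal (s * ?P) * (ennreal (real k) * indicator {k. e / s \<le> real k} k)" for k
    proof (cases "real k < d * real n")
      case True
      have "1 - s * real k \<le> exp (- (s * real k))" using exp_ge_add_one_self[of "- (s * real k)"] by simp
      then have "(1 - s * real k) * exp (s * real k) \<le> exp (- (s * real k)) * exp (s * real k)"
        by (intro mult_right_mono) auto
      then have 1: "exp (s * real k) \<le> 1 + s * real k * exp (s * real k)"
        by (simp add: exp_add[symmetric] algebra_simps)
      show ?thesis
      proof (cases "e / s \<le> real k")
        case False
        then have "exp (s * real k) \<le> exp e" using s by (simp add: field_simps)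
        then have "s * real k * exp (s * real k) \<le> s * real k * exp e" using s by (intro mult_left_mono) auto
        with 1 have "exp (s * real k) \<le> 1 + s * exp e * real k" by (simp add: mult_ac)
        then have "ennreal (exp (s * real k)) \<le> ennreal (1 + s * exp e * real k)" by (rule ennreal_leI)
        then show ?thesis using True False s by (simp add: ennreal_mult)
      next
        case e: True
        have "exp (s * real k) \<le> ?P" unfolding edn[symmetric] using True s by simp
        then have "s * real k * exp (s * real k) \<le> s * real k * ?P" using s by (intro mult_left_mono) auto
        with 1 have "exp (s * real k) \<le> 1 + s * ?P * real k" by (simp add: mult_ac)
        then have "ennreal (exp (s * real k)) \<le> ennreal (1 + s * ?P * real k)" by (rule ennreal_leI)
        also have "\<dots> = 1 + ennreal (s * ?P) * ennreal (real k)" using s by (simp add: ennreal_mult)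
        also have "\<dots> \<le> 1 + ennreal (s * exp e) * ennreal (real k) + ennreal (s * ?P) * ennreal (real k)"
          by (intro add_right_mono) simp
        finally show ?thesis using True e by simp
      qed
    qed simp
    have "(\<integral>\<^sup>+ k. ennreal (exp (s * real k)) * indicator {k. real k < d * real n} k \<partial>mu) \<le>
      (\<integral>\<^sup>+ k. 1 + ennreal (s * exp e) * ennreal (real k) + ennreal (s * ?P) * (ennreal (real k) * indicator {k. e / s \<le> real k} k) \<partial>mu)"
      by (intro nn_integral_mono pw)
    also have "\<dots> = 1 + ennreal (s * exp e) * ennreal m + ennreal (s * ?P) * (\<integral>\<^sup>+ k. ennreal (real k) * indicator {k. e / s \<le> real k} k \<partial>mu)"
      by (simp add: nn_integral_add nn_integral_cmult nn_mean measure_pmf.emeasure_space_1)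
    also have "\<dots> \<le> 1 + ennreal (s * exp e) * ennreal m + ennreal (s * ?P) * ennreal (cmom * (e / s) powr - gam)"
      using e s by (intro add_left_mono mult_left_mono truncated_mean_le) auto
    also have "\<dots> = ennreal (1 + s * exp e * m + s * ?P * (cmom * (e / s) powr - gam))"
      using s m_nonneg cmom_nonneg by (simp add: ennreal_mult)
    also have "\<dots> \<le> ennreal (exp (s * (m + eta)))"
    proof (rule ennreal_leI)
      have "1 + s * exp e * m + s * ?P * (cmom * (e / s) powr - gam) =
         1 + s * (exp e * m + ?P * (cmom * (e / s) powr - gam))" by (simp add: algebra_simps)
      also have "\<dots> \<le> 1 + s * (m + eta / 2 + eta / 2)"
        using em elim(1) s by (intro add_left_mono mult_left_mono add_mono) (auto simp: s_def)
      also have "\<dots> \<le> exp (s * (m + eta))" using exp_ge_add_one_self[of "s * (m + eta)"] by (simp add: add.commute)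
      finally show "1 + s * exp e * m + s * ?P * (cmom * (e / s) powr - gam) \<le> exp (s * (m + eta))" .
    qed
    finally show ?case by (simp add: s_def)
  qed
  with d that show ?thesis by blast
qed

text \<open>If the truncated offspring moment at \<open>s\<close> is at most
  \<open>exp (s * (m + eta))\<close>, the hypothesis of \<open>small_degrees_mgf\<close> permits
  \<open>lam = s * (1 - m - eta)\<close>. Up to \<open>eta\<close> this is the rate dictated by the
  mean size \<open>1 / (1 - m)\<close>.\<close>

lemma truncated_size_mgf:
  assumes C: "0 < C" and eta: "0 < eta"
  obtains d where "0 < d"
    "eventually (\<lambda>n. (\<integral>\<^sup>+ t. ennreal (exp (C * ln (real n) / real n * (1 - m - eta) * real (tsize t))) *
          indicator {t. small_degrees (d * real n) t} t \<partial>bgw)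
       \<le> ennreal (exp (C * ln (real n) / real n))) sequentially"
proof -
  obtain d where d: "0 < d"
    "eventually (\<lambda>n. (\<integral>\<^sup>+ k. ennreal (exp (C * ln (real n) / real n * real k)) * indicator {k. real k < d * real n} k \<partial>mu)
       \<le> ennreal (exp (C * ln (real n) / real n * (m + eta)))) sequentially"
    using offspring_mgf[OF assms] .
  have "eventually (\<lambda>n. (\<integral>\<^sup>+ t. ennreal (exp (C * ln (real n) / real n * (1 - m - eta) * real (tsize t))) *
          indicator {t. small_degrees (d * real n) t} t \<partial>bgw)
       \<le> ennreal (exp (C * ln (real n) / real n))) sequentially"
    using d(2)
  proof eventually_elim
    case (elim n)
    show ?case
    proof (rule small_degrees_mgf)
      have "C * ln (real n) / real n * (m + eta) = C * ln (real n) / real n - C * ln (real n) / real n * (1 - m - eta)"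
        by (simp add: right_diff_distrib distrib_left)
      with elim show "(\<integral>\<^sup>+ k. ennreal (exp (C * ln (real n) / real n * real k)) * indicator {k. real k < d * real n} k \<partial>mu)
         \<le> ennreal (exp (C * ln (real n) / real n - C * ln (real n) / real n * (1 - m - eta)))" by simp
    qed
  qed
  with d(1) that show ?thesis by blast
qed

text \<open>The mean size of a forest of \<open>b * n\<close> trees is below \<open>c * n\<close>.
  Either some degree reaches \<open>d * n\<close>, which a union bound excludes, or Chernoff's bound
  with \<open>C = 1\<close> gives a negative power of \<open>n\<close>.\<close>

lemma forest_size_upper:
  assumes b: "0 < b" and c: "0 < c" and bc: "b < c * (1 - m)" and eps: "0 < eps"
  shows "eventually (\<lambda>n. \<forall>k. real k \<le> b * real n \<longrightarrow>
     measure_pmf.prob (replicate_pmf k bgw) {ts. c * real n \<le> real (sum_list (map tsize ts))} \<le> eps) sequentially"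
proof -
  define r where "r = b / c"
  \<comment> \<open>Half of the room between \<open>b / c\<close> and \<open>1 - m\<close>; the
    other half makes the exponent \<open>b - c * (1 - m - eta)\<close> negative.\<close>
  define eta where "eta = (1 - m - r) / 2"
  have eta: "0 < eta" "b < c * (1 - m - eta)" "0 < 1 - m - eta"
  proof -
    have "b < (1 - m) * c" using bc by (subst mult.commute)
    then have bc': "r < 1 - m" unfolding r_def by (rule mult_imp_div_pos_less[OF c])
    have bc0: "0 < r" unfolding r_def using b c by (rule divide_pos_pos)
    show "0 < eta" using bc' unfolding eta_def by (simp add: field_simps)
    show "0 < 1 - m - eta" using m_less_1 bc0 unfolding eta_def by (simp add: field_simps)
    have "r < 1 - m - eta" using bc' unfolding eta_def by (simp add: field_simps)
    then have "b < (1 - m - eta) * c" by (simp only: r_def pos_divide_less_eq[OF c])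
    then show "b < c * (1 - m - eta)" by (subst mult.commute)
  qed
  obtain d where d: "0 < d" and mgf:
    "eventually (\<lambda>n. (\<integral>\<^sup>+ t. ennreal (exp (1 * ln (real n) / real n * (1 - m - eta) * real (tsize t))) *
          indicator {t. small_degrees (d * real n) t} t \<partial>bgw)
       \<le> ennreal (exp (1 * ln (real n) / real n))) sequentially"
    using truncated_size_mgf[OF zero_less_one eta(1)] .
  have "(\<lambda>n. b * msize * (real n * tail (d * real n)) + real n powr (b - c * (1 - m - eta))) \<longlonglongrightarrow> b * msize * 0 + 0"
  proof (intro tendsto_add tendsto_mult tendsto_const n_tail_tendsto_0 d)
    show "(\<lambda>n. real n powr (b - c * (1 - m - eta))) \<longlonglongrightarrow> 0"
      using eta(2) by real_asymp
  qed
  then have "eventually (\<lambda>n. b * msize * (real n * tail (d * real n)) + real n powr (b - c * (1 - m - eta)) < eps) sequentially"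
    by (rule order_tendstoD) (use eps in simp)
  then show ?thesis
    using mgf eventually_gt_at_top[of 1]
  proof eventually_elim
    case (elim n)
    show ?case
    proof (intro allI impI)
      fix k assume k: "real k \<le> b * real n"
      let ?p = "measure_pmf.prob (replicate_pmf k bgw)"
      define s where "s = ln (real n) / real n"
      have s: "0 \<le> s" "s * real n = ln (real n)" using elim by (simp_all add: s_def)
      have "?p {ts. c * real n \<le> real (sum_list (map tsize ts))} \<le>
          ?p ({ts. \<exists>t\<in>set ts. \<not> small_degrees (d * real n) t} \<union>
             {ts. c * real n \<le> real (sum_list (map tsize ts)) \<and> (\<forall>t\<in>set ts. small_degrees (d * real n) t)})"
        by (intro measure_pmf.finite_measure_mono) auto
      also have "\<dots> \<le> ?p {ts. \<exists>t\<in>set ts. \<not> small_degrees (d * real n) t} +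
             ?p {ts. c * real n \<le> real (sum_list (map tsize ts)) \<and> (\<forall>t\<in>set ts. small_degrees (d * real n) t)}"
        by (intro measure_Un_le) auto
      also have "\<dots> \<le> b * msize * (real n * tail (d * real n)) + real n powr (b - c * (1 - m - eta))"
      proof (rule add_mono)
        have "?p {ts. \<exists>t\<in>set ts. \<not> small_degrees (d * real n) t} \<le> real k * measure_pmf.prob bgw {t. \<not> small_degrees (d * real n) t}"
          by (rule forest_union)
        also have "\<dots> \<le> (b * real n) * (msize * tail (d * real n))"
          using b by (intro mult_mono k prob_not_small_degrees) auto
        finally show "?p {ts. \<exists>t\<in>set ts. \<not> small_degrees (d * real n) t} \<le> b * msize * (real n * tail (d * real n))"
          by (simp add: mult_ac)
        have "?p {ts. c * real n \<le> real (sum_list (map tsize ts)) \<and> (\<forall>t\<in>set ts. small_degrees (d * real n) t)}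
            \<le> exp (s * real k - s * (1 - m - eta) * (c * real n))"
        proof (rule forest_large_size)
          show "(\<integral>\<^sup>+ t. ennreal (exp (s * (1 - m - eta) * real (tsize t))) *
              indicator {t. small_degrees (d * real n) t} t \<partial>bgw) \<le> ennreal (exp s)"
            using elim(2) by (simp only: s_def mult_1)
          show "0 \<le> s * (1 - m - eta)" using s eta by simp
        qed
        also have "\<dots> \<le> exp (ln (real n) * (b - c * (1 - m - eta)))"
        proof -
          have "s * real k \<le> s * (b * real n)" using k s by (intro mult_left_mono)
          also have "\<dots> = ln (real n) * b" using s(2) by (metis mult.assoc mult.commute)
          finally have "s * real k \<le> ln (real n) * b" .
          moreover have "s * (1 - m - eta) * (c * real n) = (s * real n) * (c * (1 - m - eta))" by (simp only: mult_ac)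
          ultimately show ?thesis using s(2) by (simp add: right_diff_distrib)
        qed
        finally show "?p {ts. c * real n \<le> real (sum_list (map tsize ts)) \<and> (\<forall>t\<in>set ts. small_degrees (d * real n) t)}
            \<le> real n powr (b - c * (1 - m - eta))"
          using elim by (simp add: powr_def mult.commute)
      qed
      finally show "?p {ts. c * real n \<le> real (sum_list (map tsize ts))} \<le> eps" using elim(1) by linarith
    qed
  qed
qed

end

section \<open>The tail of the total size\<close>

context heavy_tailed
begin

lemma prob_replicate_arity_le:
  assumes "\<And>k. real k < b \<Longrightarrow> measure_pmf.prob (replicate_pmf k bgw) {ts. P ts} \<le> e" and e: "0 \<le> e"
  shows "(\<integral>\<^sup>+ s. indicator {s. a \<le> real (length (children s)) \<and> real (length (children s)) < b \<and> P (children s)} s \<partial>bgw)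
     \<le> ennreal (tail a * e)"
proof -
  have inner: "(\<integral>\<^sup>+ ts. indicator {s. a \<le> real (length (children s)) \<and> real (length (children s)) < b \<and> P (children s)} (Node ts)
        \<partial>replicate_pmf k bgw) \<le> indicator {k. a \<le> real k} k * ennreal e" for k
  proof -
    have "(\<integral>\<^sup>+ ts. indicator {s. a \<le> real (length (children s)) \<and> real (length (children s)) < b \<and> P (children s)} (Node ts)
        \<partial>replicate_pmf k bgw) \<le> (\<integral>\<^sup>+ ts. of_bool (a \<le> real k \<and> real k < b) * indicator {ts. P ts} ts \<partial>replicate_pmf k bgw)"
      by (intro nn_integral_mono_AE) (auto simp: AE_measure_pmf_iff set_replicate_pmf indicator_def)
    also have "\<dots> = of_bool (a \<le> real k \<and> real k < b) * ennreal (measure_pmf.prob (replicate_pmf k bgw) {ts. P ts})"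
      by (simp add: nn_integral_cmult measure_pmf.emeasure_eq_measure)
    also have "\<dots> \<le> indicator {k. a \<le> real k} k * ennreal e"
      using assms(1)[of k] by (auto simp: indicator_def ennreal_leI)
    finally show ?thesis .
  qed
  have "(\<integral>\<^sup>+ s. indicator {s. a \<le> real (length (children s)) \<and> real (length (children s)) < b \<and> P (children s)} s \<partial>bgw)
     \<le> (\<integral>\<^sup>+ k. indicator {k. a \<le> real k} k * ennreal e \<partial>mu)"
    by (subst nn_integral_bgw_Node) (intro nn_integral_mono inner)
  also have "\<dots> = ennreal (tail a * e)"
    using e by (simp add: nn_integral_multc tail_def measure_pmf.emeasure_eq_measure ennreal_mult)
  finally show ?thesis .
qed

text \<open>Split at the vertex in question. Either the pruned tree has more than \<open>y\<close>
  vertices, which costs \<open>rest y\<close>, or the forest above the vertex must supply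
  \<open>N - y\<close> vertices, which costs \<open>e\<close>. By independence each cost is
  multiplied by the price \<open>tail a\<close> of the degree.\<close>

lemma middle_degree:
  assumes forest: "\<And>k. real k < b \<Longrightarrow> measure_pmf.prob (replicate_pmf k bgw)
      {ts. N - y \<le> real (sum_list (map tsize ts))} \<le> e"
    and e: "0 \<le> e"
  shows "measure_pmf.prob bgw {t. N \<le> real (tsize t) \<and> (\<exists>u\<in>vertices t. a \<le> real (num_children t u) \<and> real (num_children t u) < b)}
     \<le> tail a * (rest y + msize * e)"
proof -
  define H :: "plane_tree \<Rightarrow> nat list \<Rightarrow> ennreal" where
    "H t u = of_bool (a \<le> real (num_children t u) \<and> real (num_children t u) < b \<and> N \<le> real (tsize t))" for t u
  let ?A = "{t. N \<le> real (tsize t) \<and> (\<exists>u\<in>vertices t. a \<le> real (num_children t u) \<and> real (num_children t u) < b)}"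
  have "ennreal (measure_pmf.prob bgw ?A) = (\<integral>\<^sup>+ t. indicator ?A t \<partial>bgw)"
    by (simp add: measure_pmf.emeasure_eq_measure)
  also have "\<dots> \<le> (\<integral>\<^sup>+ t. (\<Sum>u\<in>vertices t. H t u) \<partial>bgw)"
  proof (rule nn_integral_mono)
    fix t show "indicator ?A t \<le> (\<Sum>u\<in>vertices t. H t u)"
    proof (cases "t \<in> ?A")
      case True
      then obtain u where u: "u \<in> vertices t" "H t u = 1" by (auto simp: H_def)
      have "H t u \<le> (\<Sum>u\<in>vertices t. H t u)" using u(1) by (intro member_le_sum finite_vertices) auto
      with u True show ?thesis by simp
    qed simp
  qed
  also have "\<dots> = ennreal (1 / pmf mu 0) * (\<integral>\<^sup>+ t. (\<Sum>u\<in>leaves t. \<integral>\<^sup>+ s. H (graft t u s) u \<partial>bgw) \<partial>bgw)"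
    by (rule many_to_one)
  also have "\<dots> \<le> ennreal (1 / pmf mu 0) * (\<integral>\<^sup>+ t. (\<Sum>u\<in>leaves t.
      indicator {t. y < real (tsize t)} t * ennreal (tail a) + ennreal (tail a * e)) \<partial>bgw)"
  proof (intro mult_left_mono nn_integral_mono sum_mono)
    fix t u assume u: "u \<in> leaves t"
    show "(\<integral>\<^sup>+ s. H (graft t u s) u \<partial>bgw) \<le> indicator {t. y < real (tsize t)} t * ennreal (tail a) + ennreal (tail a * e)"
    proof (cases "y < real (tsize t)")
      case True
      have "(\<integral>\<^sup>+ s. H (graft t u s) u \<partial>bgw) \<le> (\<integral>\<^sup>+ s. indicator {k. a \<le> real k} (length (children s)) \<partial>bgw)"
        by (intro nn_integral_mono) (auto simp: H_def num_children_graft_at[OF u])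
      also have "\<dots> = ennreal (tail a)"
        by (subst nn_integral_bgw_arity) (simp add: tail_def measure_pmf.emeasure_eq_measure)
      finally show ?thesis using True by (simp add: add_increasing2)
    next
      case False
      have "(\<integral>\<^sup>+ s. H (graft t u s) u \<partial>bgw) \<le> (\<integral>\<^sup>+ s. indicator {s. a \<le> real (length (children s)) \<and>
          real (length (children s)) < b \<and> N - y \<le> real (sum_list (map tsize (children s)))} s \<partial>bgw)"
      proof (intro nn_integral_mono)
        fix s
        have "real (tsize (graft t u s)) = real (tsize t) + real (sum_list (map tsize (children s)))"
          using tsize_graft_leaf[OF u, of s] tsize_children[of s] by linarith
        then show "H (graft t u s) u \<le> indicator {s. a \<le> real (length (children s)) \<and>
          real (length (children s)) < b \<and> N - y \<le> real (sum_list (map tsize (children s)))} s"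
          using False by (auto simp: H_def num_children_graft_at[OF u])
      qed
      also have "\<dots> \<le> ennreal (tail a * e)"
        by (rule prob_replicate_arity_le[OF forest e])
      finally show ?thesis using False by simp
    qed
  qed simp
  also have "\<dots> = ennreal (1 / pmf mu 0) * (\<integral>\<^sup>+ t. of_nat (card (leaves t)) * indicator {t. y < real (tsize t)} t \<partial>bgw) * ennreal (tail a)
     + ennreal (1 / pmf mu 0) * (\<integral>\<^sup>+ t. of_nat (card (leaves t)) \<partial>bgw) * ennreal (tail a * e)"
    by (simp add: distrib_left nn_integral_add nn_integral_multc mult.assoc[symmetric])
  also have "\<dots> = ennreal (rest y * tail a + msize * (tail a * e))"
    unfolding rest_eq nn_integral_leaves
    using e msize_pos tail_nonneg[of a] rest_nonneg[of y] by (simp add: ennreal_mult)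
  finally have "measure_pmf.prob bgw ?A \<le> rest y * tail a + msize * (tail a * e)"
    by (rule ennreal_le_iff[THEN iffD1, rotated]) (use e msize_pos tail_nonneg[of a] rest_nonneg[of y] in simp)
  then show ?thesis by (simp add: algebra_simps)
qed

text \<open>
  A large tree has all degrees below \<open>d n\<close> (negligible by the exponential bound), or a degree above \<open>b n\<close>
  (the main term), or a degree in between; in the last case the subtree at that vertex or the rest of the
  tree is abnormally large.
\<close>

lemma size_tail_upper:
  assumes b: "0 < b" "b < 1 - m" and eps: "0 < eps"
  shows "eventually (\<lambda>n. measure_pmf.prob bgw {t. n \<le> tsize t} \<le> (msize * b powr - beta + eps) * tail (real n)) sequentially"
proof -
  \<comment> \<open>Powers above \<open>beta + 1\<close> are negligible against the tail.
    \<open>C\<close> is such that the exponent \<open>lam * n\<close> in Chernoff's bound, here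
    \<open>C * (1 - m) / 2 * ln n\<close>, equals \<open>kap * ln n\<close>.\<close>
  define kap where "kap = beta + 2"
  define C where "C = 2 * kap / (1 - m)"
  have C: "0 < C" "C * (1 - m - (1 - m) / 2) = kap"
    using beta m_less_1 by (simp_all add: C_def kap_def field_simps)
  obtain d where d: "0 < d" and mgf:
    "eventually (\<lambda>n. (\<integral>\<^sup>+ t. ennreal (exp (C * ln (real n) / real n * (1 - m - (1 - m) / 2) * real (tsize t))) *
          indicator {t. small_degrees (d * real n) t} t \<partial>bgw)
       \<le> ennreal (exp (C * ln (real n) / real n))) sequentially"
    using truncated_size_mgf[of C "(1 - m) / 2"] C(1) m_less_1 by auto
  \<comment> \<open>A share \<open>eta * n\<close> of the vertices is conceded to the pruned tree,
    while the mean size of a forest of \<open>b * n\<close> trees stays below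
    \<open>(1 - eta) * n\<close>.\<close>
  define r where "r = b / (1 - m)"
  have r: "0 < r" "r < 1" "b = r * (1 - m)" using b m_less_1 by (simp_all add: r_def)
  define eta where "eta = (1 - r) / 2"
  have eta: "0 < eta" "0 < 1 - eta" "b < (1 - eta) * (1 - m)"
  proof -
    show "0 < eta" "0 < 1 - eta" using r(1,2) by (simp_all add: eta_def field_simps)
    have "r < 1 - eta" using r(1,2) by (simp add: eta_def field_simps)
    then show "b < (1 - eta) * (1 - m)" unfolding r(3) using m_less_1 by (intro mult_strict_right_mono) simp_all
  qed
  \<comment> \<open>As \<open>tail (d * n) / tail n\<close> tends to \<open>d powr - beta\<close>,
    this forest probability contributes exactly \<open>eps / 2\<close> in the limit.\<close>
  define e where "e = eps / (2 * (d powr - beta * msize))"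
  have e: "0 < e" "d powr - beta * (msize * e) = eps / 2" using eps d msize_pos by (simp_all add: e_def)
  define B where "B n = exp C * real n powr - kap + msize * tail (b * real n) +
      tail (d * real n) * (rest (eta * real n) + msize * e)" for n
  have "(\<lambda>n. exp C * (real n powr - kap / tail (real n)) + msize * (tail (b * real n) / tail (real n)) +
      (tail (d * real n) / tail (real n)) * (rest (eta * real n) + msize * e)) \<longlonglongrightarrow>
      exp C * 0 + msize * b powr - beta + d powr - beta * (0 + msize * e)"
    using b d eta by (intro tendsto_add tendsto_mult tendsto_const tail_ratio rest_tendsto_0 powr_over_tail) (simp_all add: kap_def)
  then have "(\<lambda>n. B n / tail (real n)) \<longlonglongrightarrow> msize * b powr - beta + eps / 2"
    using e(2) by (simp add: B_def add_divide_distrib)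
  then have "eventually (\<lambda>n. B n / tail (real n) < msize * b powr - beta + eps) sequentially"
    by (rule order_tendstoD) (use eps in simp)
  moreover have "eventually (\<lambda>n. \<forall>k. real k \<le> b * real n \<longrightarrow>
     measure_pmf.prob (replicate_pmf k bgw) {ts. (1 - eta) * real n \<le> real (sum_list (map tsize ts))} \<le> e) sequentially"
    by (rule forest_size_upper) (use b eta e in simp_all)
  ultimately show ?thesis
    using mgf eventually_gt_at_top[of 1]
  proof eventually_elim
    case (elim n)
    let ?p = "measure_pmf.prob bgw"
    define s where "s = C * ln (real n) / real n"
    let ?A1 = "{t. real n \<le> real (tsize t) \<and> small_degrees (d * real n) t}"
    let ?A2 = "{t. \<not> small_degrees (b * real n) t}"
    let ?A3 = "{t. real n \<le> real (tsize t) \<and> (\<exists>u\<in>vertices t. d * real n \<le> real (num_children t u) \<and> real (num_children t u) < b * real n)}"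
    have "?p {t. n \<le> tsize t} \<le> ?p (?A1 \<union> ?A2 \<union> ?A3)"
      by (intro measure_pmf.finite_measure_mono) (fastforce simp: small_degrees_def not_less)+
    also have "\<dots> \<le> ?p (?A1 \<union> ?A2) + ?p ?A3" by (intro measure_Un_le) auto
    also have "\<dots> \<le> ?p ?A1 + ?p ?A2 + ?p ?A3" by (intro add_right_mono measure_Un_le) auto
    also have "\<dots> \<le> B n" unfolding B_def
    proof (intro add_mono)
      have "?p ?A1 \<le> exp (s - s * (1 - m - (1 - m) / 2) * real n)"
      proof (rule small_degrees_large_size)
        show "(\<integral>\<^sup>+ t. ennreal (exp (s * (1 - m - (1 - m) / 2) * real (tsize t))) *
          indicator {t. small_degrees (d * real n) t} t \<partial>bgw) \<le> ennreal (exp s)"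
          using elim(3) by (simp only: s_def)
        show "0 \<le> s * (1 - m - (1 - m) / 2)" using C(1) elim(4) m_less_1 by (simp add: s_def)
      qed
      also have "s * (1 - m - (1 - m) / 2) * real n = C * (1 - m - (1 - m) / 2) * ln (real n)"
        using elim(4) by (simp add: s_def)
      also have "\<dots> = kap * ln (real n)" by (simp only: C(2))
      also have "exp (s - kap * ln (real n)) = exp s * real n powr - kap"
        using elim(4) by (simp add: powr_def exp_diff exp_minus divide_inverse)
      also have "\<dots> \<le> exp C * real n powr - kap"
      proof (intro mult_right_mono)
        have "ln (real n) \<le> real n" using elim(4) ln_le_minus_one[of "real n"] by simp
        then have "s \<le> C" using C(1) elim(4) by (simp add: s_def field_simps)
        then show "exp s \<le> exp C" by simp
      qed simp
      finally show "?p ?A1 \<le> exp C * real n powr - kap" .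
      show "?p ?A2 \<le> msize * tail (b * real n)" by (rule prob_not_small_degrees)
      show "?p ?A3 \<le> tail (d * real n) * (rest (eta * real n) + msize * e)"
      proof (rule middle_degree)
        fix k assume "real k < b * real n"
        moreover have "real n - eta * real n = (1 - eta) * real n" by (simp add: algebra_simps)
        ultimately show "measure_pmf.prob (replicate_pmf k bgw)
            {ts. real n - eta * real n \<le> real (sum_list (map tsize ts))} \<le> e"
          using elim(2) by simp
      qed (use e in simp)
    qed
    also have "\<dots> \<le> (msize * b powr - beta + eps) * tail (real n)"
      using elim(1) tail_pos[of "real n"] by (simp add: divide_simps)
    finally show ?case .
  qed
qed

end

section \<open>Condensation at a single vertex\<close>

text \<open>
  The last two conditions bound by \<open>R\<close> the pieces that remain when the loop of \<open>u\<close> is removed; \<open>u\<close> itself is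
  counted in the piece that contains the root.
\<close>

definition good_vertex :: "real \<Rightarrow> real \<Rightarrow> real \<Rightarrow> plane_tree \<Rightarrow> nat list \<Rightarrow> bool" where
  "good_vertex R a b t u \<longleftrightarrow> u \<in> vertices t \<and> a \<le> real (num_children t u) \<and> real (num_children t u) < b \<and>
     real (tsize (graft t u (Node []))) \<le> R \<and> (\<forall>s\<in>set (children (subtree t u)). real (tsize s) \<le> R)"

text \<open>Any vertex other than \<open>u\<close> lies in one of the pieces left after removing the
  loop of \<open>u\<close>, with the same number of children there. The size of the piece exceeds
  that number, so a degree above \<open>R\<close> is impossible.\<close>

lemma good_vertex_unique:
  assumes u: "good_vertex R a b t u" and v: "good_vertex R a' b' t v" and "R < a'"
  shows "v = u"
proof (rule ccontr)
  assume "v \<noteq> u"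
  have ut: "u \<in> vertices t" and vt: "v \<in> vertices t" and R: "R < real (num_children t v)"
    using assms by (auto simp: good_vertex_def)
  have "\<exists>t' w. w \<in> vertices t' \<and> num_children t' w = num_children t v \<and> real (tsize t') \<le> R"
  proof (cases "\<exists>w. v = u @ w")
    case False
    then show ?thesis using num_children_graft[OF ut vt, of "Node []"] u by (auto simp: good_vertex_def)
  next
    case True
    then obtain i w where v: "v = u @ i # w" using \<open>v \<noteq> u\<close> by (metis append_Nil2 neq_Nil_conv)
    obtain ts where ts: "subtree t u = Node ts" by (cases "subtree t u")
    have "i # w \<in> vertices (Node ts)" using vt unfolding v by (simp only: append_in_vertices ts)
    then have iw: "i < length ts" "w \<in> vertices (ts ! i)" by auto
    have "num_children t v = num_children (ts ! i) w" by (simp add: v num_children_append ut ts)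
    moreover have "real (tsize (ts ! i)) \<le> R" using u iw by (simp add: good_vertex_def ts)
    ultimately show ?thesis using iw by metis
  qed
  then show False using num_children_le_tsize R by fastforce
qed

context heavy_tailed
begin

text \<open>The lower half of a law of large numbers needs only a first moment: truncating the sizes
  at a large \<open>N\<close> keeps the mean above \<open>1 / a\<close> and makes the Laplace
  transform expandable to second order.\<close>

lemma forest_size_lower:
  assumes a: "1 - m < a" and eps: "0 < eps"
  shows "eventually (\<lambda>n. \<forall>k. a * real n \<le> real k \<longrightarrow>
     measure_pmf.prob (replicate_pmf k bgw) {ts. real (sum_list (map tsize ts)) < real n} \<le> eps) sequentially"
proof -
  have a0: "0 < a" using a m_less_1 by simp
  have "ennreal (1 / a) < ennreal msize"
    using a a0 m_less_1 by (intro ennreal_lessI) (auto simp: msize_def divide_strict_left_mono)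
  also have "\<dots> = (\<integral>\<^sup>+ t. (SUP N. ennreal (real (min (tsize t) N))) \<partial>bgw)"
    unfolding nn_integral_tsize[symmetric]
  proof (rule nn_integral_cong, rule antisym)
    fix t show "(of_nat (tsize t) :: ennreal) \<le> (SUP N. ennreal (real (min (tsize t) N)))"
      by (rule SUP_upper2[of "tsize t"]) (auto simp: ennreal_of_nat_eq_real_of_nat)
    show "(SUP N. ennreal (real (min (tsize t) N))) \<le> (of_nat (tsize t) :: ennreal)"
      unfolding ennreal_of_nat_eq_real_of_nat by (intro SUP_least ennreal_leI) simp
  qed
  also have "\<dots> = (SUP N. \<integral>\<^sup>+ t. ennreal (real (min (tsize t) N)) \<partial>bgw)"
    by (rule nn_integral_monotone_convergence_SUP) (auto simp: incseq_def le_fun_def intro!: ennreal_leI)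
  finally obtain N where N: "ennreal (1 / a) < (\<integral>\<^sup>+ t. ennreal (real (min (tsize t) N)) \<partial>bgw)"
    by (auto simp: less_SUP_iff)
  define X where "X t = real (min (tsize t) N)" for t
  have X: "0 \<le> X t" "X t \<le> real N" "X t \<le> real (tsize t)" for t by (auto simp: X_def)
  have int: "integrable bgw (\<lambda>t. f (X t))" if "\<And>t. \<bar>f (X t)\<bar> \<le> B" for f :: "real \<Rightarrow> real" and B
    by (rule measure_pmf.integrable_const_bound[where B = B]) (use that in auto)
  define r0 where "r0 = measure_pmf.expectation bgw X"
  have intX: "integrable bgw X" using int[of "\<lambda>x. x" "real N"] X by (simp add: abs_of_nonneg)
  have "1 / a < r0"
  proof -
    have "(\<integral>\<^sup>+ t. ennreal (real (min (tsize t) N)) \<partial>bgw) = ennreal r0"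
      unfolding r0_def X_def[symmetric] using intX X by (intro nn_integral_eq_integral) auto
    with N show ?thesis using a0 by (simp add: ennreal_less_iff)
  qed
  \<comment> \<open>Between \<open>1 / a\<close> and the truncated mean: the gap to the mean pays
    for the quadratic term, the gap to \<open>1 / a\<close> yields exponential decay.\<close>
  define r where "r = (r0 + 1 / a) / 2"
  have r: "1 / a < r" "r < r0" "0 < r"
  proof -
    show "1 / a < r" "r < r0" using \<open>1 / a < r0\<close> unfolding r_def by simp_all
    have "0 < 1 / a" using a0 by simp
    then show "0 < r" using \<open>1 / a < r\<close> by (rule less_trans)
  qed
  have r0N: "r0 \<le> real N"
    unfolding r0_def using X by (intro measure_pmf.integral_le_const intX) auto
  then have N0: "0 < real N" using r by linarith
  \<comment> \<open>Makes the quadratic term \<open>(lam * N)\<^sup>2\<close> equal to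
    \<open>lam * (r0 - r)\<close>, so that it lowers the rate from \<open>r0\<close> to
    \<open>r\<close>.\<close>
  define lam where "lam = (r0 - r) / (real N)\<^sup>2"
  have lam: "0 < lam" "lam * (real N)\<^sup>2 = r0 - r" using r N0 by (simp_all add: lam_def)
  have expX: "exp (- lam * X t) \<le> 1 - lam * X t + lam\<^sup>2 * (real N)\<^sup>2" for t
  proof -
    define y where "y = lam * X t"
    have y: "0 \<le> y" using lam X by (simp add: y_def)
    \<comment> \<open>The right-hand side is \<open>1 + y ^ 3\<close>.\<close>
    have "1 \<le> (1 - y + y\<^sup>2) * (1 + y)" using y by (simp add: algebra_simps power2_eq_square)
    also have "\<dots> \<le> (1 - y + y\<^sup>2) * exp y"
      using exp_ge_add_one_self[of y] zero_le_power2[of "y - 1 / 2"]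
      by (intro mult_left_mono) (simp_all add: power2_eq_square algebra_simps)
    finally have "exp (- y) \<le> 1 - y + y\<^sup>2" by (simp add: exp_minus field_simps)
    also have "y\<^sup>2 \<le> lam\<^sup>2 * (real N)\<^sup>2"
      unfolding y_def power_mult_distrib using X by (intro mult_left_mono power_mono) auto
    finally show ?thesis by (simp add: y_def)
  qed
  have "measure_pmf.expectation bgw (\<lambda>t. exp (- lam * X t)) \<le> measure_pmf.expectation bgw (\<lambda>t. 1 - lam * X t + lam\<^sup>2 * (real N)\<^sup>2)"
  proof (rule integral_mono)
    show "integrable bgw (\<lambda>t. exp (- lam * X t))"
      by (rule int[where B = 1]) (use lam X in auto)
  qed (use intX expX in auto)
  also have "\<dots> = 1 - lam * r0 + lam * (r0 - r)"
    using intX unfolding lam(2)[symmetric] by (simp add: r0_def power2_eq_square mult.assoc)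
  also have "\<dots> \<le> exp (- lam * r)" using exp_ge_add_one_self[of "- lam * r"] by (simp add: algebra_simps)
  finally have E: "measure_pmf.expectation bgw (\<lambda>t. exp (- lam * X t)) \<le> exp (- lam * r)" .
  have laplace: "(\<integral>\<^sup>+ t. ennreal (exp (- lam * real (tsize t))) \<partial>bgw) \<le> ennreal (exp (- lam * r))"
  proof -
    have "(\<integral>\<^sup>+ t. ennreal (exp (- lam * real (tsize t))) \<partial>bgw) \<le> (\<integral>\<^sup>+ t. ennreal (exp (- lam * X t)) \<partial>bgw)"
      using lam X(3) by (intro nn_integral_mono ennreal_leI) simp
    also have "\<dots> = ennreal (measure_pmf.expectation bgw (\<lambda>t. exp (- lam * X t)))"
      by (intro nn_integral_eq_integral int[where B = 1]) (use lam X in auto)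
    finally show ?thesis using E by (meson ennreal_leI order_trans)
  qed
  have forest: "measure_pmf.prob (replicate_pmf k bgw) {ts. real (sum_list (map tsize ts)) < real n} \<le> exp (lam * (real n - r * real k))" for k n
  proof -
    let ?A = "{ts. real (sum_list (map tsize ts)) < real n}"
    let ?g = "\<lambda>t. ennreal (exp (- lam * real (tsize t)))"
    have "ennreal (measure_pmf.prob (replicate_pmf k bgw) ?A) = (\<integral>\<^sup>+ ts. indicator ?A ts \<partial>replicate_pmf k bgw)"
      by (simp add: measure_pmf.emeasure_eq_measure)
    also have "\<dots> \<le> (\<integral>\<^sup>+ ts. ennreal (exp (lam * real n)) * prod_list (map ?g ts) \<partial>replicate_pmf k bgw)"
    proof (rule nn_integral_mono)
      fix ts
      have p: "prod_list (map ?g ts) = ennreal (exp (- lam * real (sum_list (map tsize ts))))"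
        by (induction ts) (simp_all add: algebra_simps exp_add ennreal_mult' exp_diff divide_inverse exp_minus)
      show "indicator ?A ts \<le> ennreal (exp (lam * real n)) * prod_list (map ?g ts)"
      proof (cases "ts \<in> ?A")
        case True
        then have "lam * real (sum_list (map tsize ts)) \<le> lam * real n" using lam by (intro mult_left_mono) auto
        then have "1 \<le> exp (lam * real n) * exp (- lam * real (sum_list (map tsize ts)))"
          by (simp add: exp_add[symmetric])
        then have "ennreal 1 \<le> ennreal (exp (lam * real n)) * ennreal (exp (- lam * real (sum_list (map tsize ts))))"
          by (simp only: ennreal_mult[symmetric] exp_ge_zero ennreal_leI)
        then show ?thesis unfolding p using True by simp
      qed simp
    qed
    also have "\<dots> = ennreal (exp (lam * real n)) * (\<integral>\<^sup>+ t. ?g t \<partial>bgw) ^ k"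
      by (simp add: nn_integral_cmult nn_integral_replicate_prod_list)
    also have "\<dots> \<le> ennreal (exp (lam * real n)) * ennreal (exp (- lam * r)) ^ k"
      by (intro mult_left_mono power_mono laplace) auto
    also have "ennreal (exp (- lam * r)) ^ k = ennreal (exp (- lam * r * real k))"
      by (simp only: ennreal_power exp_ge_zero exp_of_nat2_mult)
    also have "ennreal (exp (lam * real n)) * ennreal (exp (- lam * r * real k)) = ennreal (exp (lam * (real n - r * real k)))"
      by (simp add: ennreal_mult[symmetric] exp_add[symmetric] algebra_simps)
    finally show ?thesis by (rule ennreal_le_iff[THEN iffD1, rotated]) simp
  qed
  have ra: "1 < r * a" using r(1) a0 by (simp add: field_simps)
  have "(\<lambda>n. exp (lam * (1 - r * a) * real n)) \<longlonglongrightarrow> 0"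
  proof -
    define z where "z = lam * (1 - r * a)"
    have "z < 0" using lam ra by (simp add: z_def mult_less_0_iff)
    then have "(\<lambda>n. exp (z * real n)) \<longlonglongrightarrow> 0" by real_asymp
    then show ?thesis by (simp only: z_def)
  qed
  then have "eventually (\<lambda>n. exp (lam * (1 - r * a) * real n) < eps) sequentially"
    by (rule order_tendstoD) (rule eps)
  then show ?thesis
  proof eventually_elim
    case (elim n)
    show ?case
    proof (intro allI impI)
      fix k assume k: "a * real n \<le> real k"
      have "r * (a * real n) \<le> r * real k" using k r by (intro mult_left_mono) auto
      then have "real n - r * real k \<le> (1 - r * a) * real n" by (simp add: algebra_simps)
      then have "lam * (real n - r * real k) \<le> lam * ((1 - r * a) * real n)" using lam by (intro mult_left_mono) auto
      then have "exp (lam * (real n - r * real k)) \<le> exp (lam * (1 - r * a) * real n)" by (simp add: mult.assoc)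
      with forest[of k n] elim show "measure_pmf.prob (replicate_pmf k bgw) {ts. real (sum_list (map tsize ts)) < real n} \<le> eps"
        by linarith
    qed
  qed
qed

text \<open>Union bound: a single tree reaches size \<open>c * n\<close> with probability of order
  \<open>tail (c * n)\<close>, and \<open>n\<close> times this tends to 0.\<close>

lemma forest_no_large_tree:
  assumes b: "0 < b" and c: "0 < c" and eps: "0 < eps"
  shows "eventually (\<lambda>n. \<forall>k. real k \<le> b * real n \<longrightarrow>
     measure_pmf.prob (replicate_pmf k bgw) {ts. \<exists>t\<in>set ts. c * real n < real (tsize t)} \<le> eps) sequentially"
proof -
  \<comment> \<open>The constant of \<open>size_tail_upper\<close> for threshold
    \<open>(1 - m) / 2\<close> and slack 1; only the order of magnitude matters.\<close>
  define K where "K = msize * ((1 - m) / 2) powr - beta + 1"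
  have K: "0 \<le> K" using msize_pos by (simp add: K_def)
  have "eventually (\<lambda>n. measure_pmf.prob bgw {t. n \<le> tsize t} \<le> K * tail (real n)) sequentially"
    unfolding K_def using m_less_1 by (intro size_tail_upper) auto
  moreover have "filterlim (\<lambda>n. nat \<lceil>c * real n\<rceil>) at_top sequentially"
    using c by real_asymp
  ultimately have ev: "eventually (\<lambda>n. measure_pmf.prob bgw {t. nat \<lceil>c * real n\<rceil> \<le> tsize t} \<le> K * tail (real (nat \<lceil>c * real n\<rceil>))) sequentially"
    by (rule eventually_compose_filterlim)
  have "(\<lambda>n. b * K * (real n * tail (c * real n))) \<longlonglongrightarrow> b * K * 0"
    by (intro tendsto_intros n_tail_tendsto_0 c)
  then have "eventually (\<lambda>n. b * K * (real n * tail (c * real n)) < eps) sequentially"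
    by (rule order_tendstoD) (use eps in simp)
  with ev show ?thesis
  proof eventually_elim
    case (elim n)
    show ?case
    proof (intro allI impI)
      fix k assume k: "real k \<le> b * real n"
      have "measure_pmf.prob bgw {t. c * real n < real (tsize t)} \<le> measure_pmf.prob bgw {t. nat \<lceil>c * real n\<rceil> \<le> tsize t}"
        by (intro measure_pmf.finite_measure_mono) (auto simp: nat_ceiling_le_eq)
      also have "\<dots> \<le> K * tail (c * real n)" using elim(1) tail_ceiling[of "c * real n"] by simp
      finally have p: "measure_pmf.prob bgw {t. c * real n < real (tsize t)} \<le> K * tail (c * real n)" .
      have "measure_pmf.prob (replicate_pmf k bgw) {ts. \<exists>t\<in>set ts. c * real n < real (tsize t)} \<le>
          real k * measure_pmf.prob bgw {t. c * real n < real (tsize t)}"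
        by (rule forest_union)
      also have "\<dots> \<le> (b * real n) * (K * tail (c * real n))"
        using b by (intro mult_mono k p) auto
      also have "\<dots> \<le> eps" using elim(2) by (simp add: mult_ac)
      finally show "measure_pmf.prob (replicate_pmf k bgw) {ts. \<exists>t\<in>set ts. c * real n < real (tsize t)} \<le> eps" .
    qed
  qed
qed

lemma prob_replicate_arity_ge:
  assumes P: "\<And>k. a \<le> real k \<Longrightarrow> real k < b \<Longrightarrow> measure_pmf.prob (replicate_pmf k bgw) {ts. \<not> P ts} \<le> e"
    and ab: "a \<le> b" and e: "0 \<le> e" "e \<le> 1"
  shows "ennreal ((tail a - tail b) * (1 - e)) \<le>
     (\<integral>\<^sup>+ s. of_bool (a \<le> real (length (children s)) \<and> real (length (children s)) < b \<and> P (children s)) \<partial>bgw)"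
proof -
  have inner: "indicator {k. a \<le> real k \<and> real k < b} k * ennreal (1 - e) \<le>
     (\<integral>\<^sup>+ ts. of_bool (a \<le> real (length (children (Node ts))) \<and> real (length (children (Node ts))) < b \<and> P (children (Node ts)))
        \<partial>replicate_pmf k bgw)" for k
  proof (cases "a \<le> real k \<and> real k < b")
    case True
    have "1 - e \<le> measure_pmf.prob (replicate_pmf k bgw) {ts. P ts}"
      using P[of k] True measure_pmf.prob_compl[of "{ts. P ts}" "replicate_pmf k bgw"]
      by (simp add: Compl_eq_Diff_UNIV[symmetric] Collect_neg_eq)
    then have "ennreal (1 - e) \<le> (\<integral>\<^sup>+ ts. indicator {ts. P ts} ts \<partial>replicate_pmf k bgw)"
      by (simp add: measure_pmf.emeasure_eq_measure ennreal_leI)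
    also have "\<dots> \<le> (\<integral>\<^sup>+ ts. of_bool (a \<le> real (length (children (Node ts))) \<and> real (length (children (Node ts))) < b \<and> P (children (Node ts)))
        \<partial>replicate_pmf k bgw)"
      using True by (intro nn_integral_mono_AE) (auto simp: AE_measure_pmf_iff set_replicate_pmf indicator_def)
    finally show ?thesis using True by simp
  qed simp
  have diff: "measure_pmf.prob mu {k. a \<le> real k \<and> real k < b} = tail a - tail b"
  proof -
    have "{k. a \<le> real k \<and> real k < b} = {k. a \<le> real k} - {k. b \<le> real k}" by auto
    moreover have "measure_pmf.prob mu ({k. a \<le> real k} - {k. b \<le> real k}) = tail a - tail b"
      unfolding tail_def
    proof (rule measure_pmf.finite_measure_Diff)
      show "{k. b \<le> real k} \<subseteq> {k. a \<le> real k}" using ab by (blast intro: order_trans)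
    qed simp_all
    ultimately show ?thesis by (rule trans[OF arg_cong])
  qed
  have "ennreal ((tail a - tail b) * (1 - e)) = (\<integral>\<^sup>+ k. indicator {k. a \<le> real k \<and> real k < b} k * ennreal (1 - e) \<partial>mu)"
    using e tail_antimono[OF ab] by (simp add: nn_integral_multc measure_pmf.emeasure_eq_measure diff ennreal_mult)
  also have "\<dots> \<le> (\<integral>\<^sup>+ s. of_bool (a \<le> real (length (children s)) \<and> real (length (children s)) < b \<and> P (children s)) \<partial>bgw)"
    by (subst nn_integral_bgw_Node) (intro nn_integral_mono inner)
  finally show ?thesis .
qed

text \<open>\<open>many_to_one\<close> computes an expected number of good vertices. As
  \<open>R < a\<close>, a good vertex is unique, so this expectation is a probability and nothing is
  lost by overcounting.\<close>

lemma prob_good_vertex_ge: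
  assumes forest: "\<And>k. a \<le> real k \<Longrightarrow> real k < b \<Longrightarrow> measure_pmf.prob (replicate_pmf k bgw)
      {ts. \<not> (n \<le> sum_list (map tsize ts) \<and> (\<forall>t\<in>set ts. real (tsize t) \<le> R))} \<le> e"
    and R: "R < a" and ab: "a \<le> b" and e: "0 \<le> e" "e \<le> 1"
  shows "(msize - rest R) * ((tail a - tail b) * (1 - e)) \<le>
     measure_pmf.prob bgw {t. n \<le> tsize t \<and> (\<exists>u. good_vertex R a b t u)}"
proof -
  define H :: "plane_tree \<Rightarrow> nat list \<Rightarrow> ennreal" where
    "H t u = of_bool (good_vertex R a b t u \<and> n \<le> tsize t)" for t u
  let ?A = "{t. n \<le> tsize t \<and> (\<exists>u. good_vertex R a b t u)}"
  let ?q = "ennreal ((tail a - tail b) * (1 - e))"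
  have "ennreal (msize - rest R) * ?q = ennreal (1 / pmf mu 0) *
      (\<integral>\<^sup>+ t. of_nat (card (leaves t)) * indicator {t. real (tsize t) \<le> R} t \<partial>bgw) * ?q"
    by (simp only: rest_complement)
  also have "\<dots> = ennreal (1 / pmf mu 0) * (\<integral>\<^sup>+ t. (\<Sum>u\<in>leaves t. indicator {t. real (tsize t) \<le> R} t * ?q) \<partial>bgw)"
    by (simp add: nn_integral_multc mult.assoc[symmetric])
  also have "\<dots> \<le> ennreal (1 / pmf mu 0) * (\<integral>\<^sup>+ t. (\<Sum>u\<in>leaves t. \<integral>\<^sup>+ s. H (graft t u s) u \<partial>bgw) \<partial>bgw)"
  proof (intro mult_left_mono nn_integral_mono sum_mono)
    fix t u assume u: "u \<in> leaves t"
    show "indicator {t. real (tsize t) \<le> R} t * ?q \<le> (\<integral>\<^sup>+ s. H (graft t u s) u \<partial>bgw)"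
    proof (cases "real (tsize t) \<le> R")
      case True
      have ut: "u \<in> vertices t" "subtree t u = Node []" using u leaf_iff[of u t] by (auto simp: leaves_def)
      have g: "graft (graft t u s) u (Node []) = t" for s
        using graft_subtree[OF ut(1)] ut by (simp add: graft_graft)
      have "?q \<le> (\<integral>\<^sup>+ s. of_bool (a \<le> real (length (children s)) \<and> real (length (children s)) < b \<and>
          (n \<le> sum_list (map tsize (children s)) \<and> (\<forall>t\<in>set (children s). real (tsize t) \<le> R))) \<partial>bgw)"
        by (rule prob_replicate_arity_ge[OF forest ab e])
      also have "\<dots> \<le> (\<integral>\<^sup>+ s. H (graft t u s) u \<partial>bgw)"
      proof (intro nn_integral_mono)
        fix s
        have "tsize (graft t u s) = tsize t + sum_list (map tsize (children s))"
          using tsize_graft_leaf[OF u, of s] tsize_children[of s] by linarith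
        then show "of_bool (a \<le> real (length (children s)) \<and> real (length (children s)) < b \<and>
          (n \<le> sum_list (map tsize (children s)) \<and> (\<forall>t\<in>set (children s). real (tsize t) \<le> R))) \<le> H (graft t u s) u"
          using True ut u by (auto simp: H_def good_vertex_def num_children_graft_at in_vertices_graft g subtree_graft)
      qed
      finally show ?thesis using True by simp
    qed simp
  qed simp
  also have "\<dots> = (\<integral>\<^sup>+ t. (\<Sum>u\<in>vertices t. H t u) \<partial>bgw)"
    by (rule many_to_one[symmetric])
  also have "\<dots> \<le> (\<integral>\<^sup>+ t. indicator ?A t \<partial>bgw)"
  proof (rule nn_integral_mono)
    fix t show "(\<Sum>u\<in>vertices t. H t u) \<le> indicator ?A t"
    proof (cases "t \<in> ?A")
      case True
      then obtain u where u: "good_vertex R a b t u" by blast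
      have "(\<Sum>v\<in>vertices t. H t v) = (\<Sum>v\<in>{u}. H t v)"
      proof (rule sum.mono_neutral_right)
        show "{u} \<subseteq> vertices t" using u by (simp add: good_vertex_def)
        show "\<forall>v\<in>vertices t - {u}. H t v = 0" using good_vertex_unique[OF u _ R] by (auto simp: H_def)
      qed (rule finite_vertices)
      also have "\<dots> = H t u" by simp
      also have "\<dots> \<le> 1" by (simp add: H_def)
      finally show ?thesis using True by simp
    next
      case False
      then have "H t u = 0" for u by (auto simp: H_def)
      then show ?thesis by simp
    qed
  qed
  also have "\<dots> = ennreal (measure_pmf.prob bgw ?A)" by (simp add: measure_pmf.emeasure_eq_measure)
  finally have "ennreal ((msize - rest R) * ((tail a - tail b) * (1 - e))) \<le> ennreal (measure_pmf.prob bgw ?A)"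
    using e tail_antimono[OF ab] by (simp add: ennreal_mult'')
  then show ?thesis by (rule ennreal_le_iff[THEN iffD1, rotated]) simp
qed

text \<open>A root of degree at least \<open>n\<close> is enough.\<close>

lemma size_prob_pos: "0 < measure_pmf.prob bgw {t. n \<le> tsize t}"
proof -
  have "0 < tail (real n)" by (rule tail_pos)
  also have "tail (real n) = measure_pmf.prob bgw {t. real n \<le> real (length (children t))}" by (rule prob_arity[symmetric])
  also have "\<dots> \<le> measure_pmf.prob bgw {t. n \<le> tsize t}"
  proof (intro measure_pmf.finite_measure_mono subsetI)
    fix t assume "t \<in> {t. real n \<le> real (length (children t))}"
    then show "t \<in> {t. n \<le> tsize t}"
      using num_children_le_tsize[OF Nil_in_vertices, of t] by (simp add: num_children_Nil)
  qed simp
  finally show ?thesis .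
qed

text \<open>Quotient of \<open>prob_good_vertex_ge\<close> and \<open>size_tail_upper\<close>. Since
  \<open>1 - m < a\<close>, the forest above the vertex typically has \<open>n\<close> vertices by
  itself, so the size condition costs nothing to leading order.\<close>

lemma condensation:
  assumes a: "1 - m < a" and ab: "a < b" and c: "0 < c" "c < a" and eps: "0 < eps"
  shows "eventually (\<lambda>n. ((1 - m) / a) powr beta - ((1 - m) / b) powr beta - eps <
     measure_pmf.prob bgw {t. n \<le> tsize t \<and> (\<exists>u. good_vertex (c * real n) (a * real n) (b * real n) t u)} /
     measure_pmf.prob bgw {t. n \<le> tsize t}) sequentially"
proof -
  let ?p = "measure_pmf.prob bgw"
  define D where "D = a powr - beta - b powr - beta"
  \<comment> \<open>The limiting quotient when all slacks in numerator and denominator equal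
    \<open>x\<close>. It is continuous at 0, where it takes the target value, so a small
    \<open>x\<close> loses less than \<open>eps\<close>.\<close>
  define g where "g x = msize * (D * (1 - x)) / (msize * (1 - m - x) powr - beta + x)" for x
  have a0: "0 < a" "0 < b" using a ab m_less_1 by simp_all
  have target: "((1 - m) / a) powr beta - ((1 - m) / b) powr beta = g 0"
    using a0 m_less_1 msize_pos by (simp add: g_def D_def powr_divide powr_minus field_simps)
  have "(g \<longlongrightarrow> msize * (D * (1 - 0)) / (msize * (1 - m - 0) powr - beta + 0)) (at_right 0)"
    unfolding g_def using m_less_1 msize_pos by (intro tendsto_intros) auto
  then have "(g \<longlongrightarrow> g 0) (at_right 0)" by (simp add: g_def)
  then have "eventually (\<lambda>x. g 0 - eps < g x) (at_right 0)" by (rule order_tendstoD) (use eps in simp)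
  moreover have "eventually (\<lambda>x. x \<in> {0<..<min 1 (1 - m)}) (at_right 0)"
    using m_less_1 by (intro eventually_at_right_real) simp
  ultimately have "eventually (\<lambda>x. g 0 - eps < g x \<and> x \<in> {0<..<min 1 (1 - m)}) (at_right 0)"
    by (rule eventually_conj)
  then obtain x where x: "g 0 - eps < g x" "x < 1" "x < 1 - m" "0 < x"
    using eventually_happens[of _ "at_right (0::real)"] by (auto simp: trivial_limit_at_right_real)
  define K where "K = msize * (1 - m - x) powr - beta + x"
  have K: "0 < K" using x msize_pos by (simp add: K_def add_nonneg_pos)
  have up: "eventually (\<lambda>n. ?p {t. n \<le> tsize t} \<le> K * tail (real n)) sequentially"
    unfolding K_def using x by (intro size_tail_upper) auto
  have f1: "eventually (\<lambda>n. \<forall>k. a * real n \<le> real k \<longrightarrow>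
     measure_pmf.prob (replicate_pmf k bgw) {ts. real (sum_list (map tsize ts)) < real n} \<le> x / 2) sequentially"
    using x by (intro forest_size_lower a) auto
  have f2: "eventually (\<lambda>n. \<forall>k. real k \<le> b * real n \<longrightarrow>
     measure_pmf.prob (replicate_pmf k bgw) {ts. \<exists>t\<in>set ts. c * real n < real (tsize t)} \<le> x / 2) sequentially"
    using x a0 c by (intro forest_no_large_tree) auto
  define B where "B n = (msize - rest (c * real n)) * ((tail (a * real n) - tail (b * real n)) * (1 - x))" for n
  have "(\<lambda>n. (msize - rest (c * real n)) * ((tail (a * real n) / tail (real n) - tail (b * real n) / tail (real n)) * (1 - x)) / K)
      \<longlonglongrightarrow> (msize - 0) * ((a powr - beta - b powr - beta) * (1 - x)) / K"
    using K by (intro tendsto_intros rest_tendsto_0 tail_ratio a0 c) simp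
  then have "(\<lambda>n. B n / (K * tail (real n))) \<longlonglongrightarrow> g x"
    using tail_pos K by (simp add: B_def g_def K_def[symmetric] D_def[symmetric] diff_divide_distrib[symmetric] mult_ac)
  then have "eventually (\<lambda>n. g 0 - eps < B n / (K * tail (real n))) sequentially"
    by (rule order_tendstoD) (rule x)
  then show ?thesis
    using up f1 f2 eventually_gt_at_top[of 0]
  proof eventually_elim
    case (elim n)
    have "B n \<le> ?p {t. n \<le> tsize t \<and> (\<exists>u. good_vertex (c * real n) (a * real n) (b * real n) t u)}"
      unfolding B_def
    proof (rule prob_good_vertex_ge)
      fix k assume k: "a * real n \<le> real k" "real k < b * real n"
      have "measure_pmf.prob (replicate_pmf k bgw) {ts. \<not> (n \<le> sum_list (map tsize ts) \<and> (\<forall>t\<in>set ts. real (tsize t) \<le> c * real n))}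
         \<le> measure_pmf.prob (replicate_pmf k bgw) ({ts. real (sum_list (map tsize ts)) < real n} \<union>
            {ts. \<exists>t\<in>set ts. c * real n < real (tsize t)})"
        by (intro measure_pmf.finite_measure_mono) (auto simp: not_le)
      also have "\<dots> \<le> measure_pmf.prob (replicate_pmf k bgw) {ts. real (sum_list (map tsize ts)) < real n} +
          measure_pmf.prob (replicate_pmf k bgw) {ts. \<exists>t\<in>set ts. c * real n < real (tsize t)}"
        by (intro measure_Un_le) auto
      also have "\<dots> \<le> x / 2 + x / 2" using elim(3,4) k by (intro add_mono) auto
      finally show "measure_pmf.prob (replicate_pmf k bgw)
          {ts. \<not> (n \<le> sum_list (map tsize ts) \<and> (\<forall>t\<in>set ts. real (tsize t) \<le> c * real n))} \<le> x" by simp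
    qed (use x c ab elim(5) in auto)
    then have "B n / (K * tail (real n)) \<le> ?p {t. n \<le> tsize t \<and> (\<exists>u. good_vertex (c * real n) (a * real n) (b * real n) t u)} / (K * tail (real n))"
      using K tail_pos by (intro divide_right_mono) (auto intro: less_imp_le)
    also have "\<dots> \<le> ?p {t. n \<le> tsize t \<and> (\<exists>u. good_vertex (c * real n) (a * real n) (b * real n) t u)} / ?p {t. n \<le> tsize t}"
      using elim(2) K tail_pos size_prob_pos by (intro divide_left_mono) auto
    finally show ?case using elim(1) unfolding target by linarith
  qed
qed

end

section \<open>Looptrees with one large loop\<close>

lemma mdist_self: "x \<in> mspace X \<Longrightarrow> mdist X x x = 0"
  by simp

lemma mdist_loop_edge: "(x, y) \<in> loop_edges t \<Longrightarrow> mdist (loop t) x y \<le> 1"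
  unfolding mdist_loop graph_dist_def
  by (rule order_trans[of _ "real 1"], unfold of_nat_le_iff) (auto intro: Least_le)

lemma loop_edge_vertices: "(x, y) \<in> loop_edges t \<Longrightarrow> x \<in> vertices t \<and> y \<in> vertices t"
  by (auto simp: loop_edges_def)

text \<open>
  A bound on the distance to the root which depends on the address only, so that it can be estimated in the
  pruned tree.
\<close>

definition address_sum :: "nat list \<Rightarrow> nat" where
  "address_sum v = sum_list (map Suc v)"

lemma address_sum_simps [simp]:
  "address_sum [] = 0" "address_sum (i # v) = Suc i + address_sum v"
  "address_sum (v @ [i]) = address_sum v + Suc i"
  by (simp_all add: address_sum_def)

text \<open>A step to child number \<open>i\<close> passes \<open>i\<close> earlier siblings, each
  carrying at least one vertex that is counted nowhere else.\<close>

lemma address_sum_less_tsize: "v \<in> vertices t \<Longrightarrow> address_sum v < tsize t"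
proof (induction t v rule: subtree.induct)
  case (1 t) show ?case by (simp add: tsize_pos)
next
  case (2 ts i v)
  then have i: "i < length ts" "v \<in> vertices (ts ! i)" by auto
  have "i + tsize (ts ! i) = (\<Sum>j<i. 1) + tsize (ts ! i)" by simp
  also have "\<dots> \<le> (\<Sum>j<i. tsize (ts ! j)) + tsize (ts ! i)"
    by (intro add_right_mono sum_mono) (simp add: Suc_le_eq tsize_pos)
  also have "\<dots> = (\<Sum>j<Suc i. tsize (ts ! j))" by simp
  also have "\<dots> \<le> (\<Sum>j<length ts. tsize (ts ! j))" using i by (intro sum_mono2) auto
  finally have "i + tsize (ts ! i) < tsize (Node ts)" by (simp add: tsize_Node sum_list_map_nth del: vertices.simps)
  with 2(1)[OF i(2)] show ?case by simp
qed

lemma mdist_loop_child: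
  assumes "w @ [i] \<in> vertices t" shows "mdist (loop t) w (w @ [i]) \<le> real (Suc i)"
  using assms
proof (induction i)
  case 0
  then have "w \<in> vertices t" by (simp add: snoc_in_vertices)
  with 0 have "(w, w @ [0]) \<in> loop_edges t" by (auto simp: loop_edges_def)
  then show ?case using mdist_loop_edge by fastforce
next
  case (Suc i)
  then have v: "w \<in> vertices t" "w @ [i] \<in> vertices t" by (simp_all add: snoc_in_vertices)
  with Suc.prems have "(w @ [i], w @ [Suc i]) \<in> loop_edges t" unfolding loop_edges_def by blast
  then have "mdist (loop t) (w @ [i]) (w @ [Suc i]) \<le> 1" by (rule mdist_loop_edge)
  moreover have "mdist (loop t) w (w @ [Suc i]) \<le> mdist (loop t) w (w @ [i]) + mdist (loop t) (w @ [i]) (w @ [Suc i])"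
    by (rule mdist_triangle) (use v Suc.prems in \<open>simp_all add: mspace_loop\<close>)
  ultimately show ?case using Suc.IH[OF v(2)] by simp
qed

lemma mdist_loop_append:
  assumes "w @ v \<in> vertices t" shows "mdist (loop t) w (w @ v) \<le> real (address_sum v)"
  using assms
proof (induction v rule: rev_induct)
  case Nil
  then show ?case by (simp add: mspace_loop mdist_self)
next
  case (snoc i v)
  then have "(w @ v) @ [i] \<in> vertices t" by simp
  then have v: "w @ v \<in> vertices t" "w \<in> vertices t" by (simp_all only: snoc_in_vertices append_in_vertices)
  have "mdist (loop t) (w @ v) ((w @ v) @ [i]) \<le> real (Suc i)"
    by (rule mdist_loop_child) fact
  moreover have "mdist (loop t) w ((w @ v) @ [i]) \<le> mdist (loop t) w (w @ v) + mdist (loop t) (w @ v) ((w @ v) @ [i])"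
    by (rule mdist_triangle) (use v snoc.prems in \<open>simp_all add: mspace_loop\<close>)
  ultimately show ?case using snoc.IH[OF v(1)] by simp
qed

text \<open>A map that moves the ends of every edge by at most \<open>e\<close> is
  \<open>e\<close>-Lipschitz for the graph distance; lower bounds on loop distances thus follow from
  a projection.\<close>

lemma mdist_loop_ge:
  assumes p: "\<And>x y. (x, y) \<in> loop_edges t \<Longrightarrow> mdist C (p x) (p y) \<le> e"
    and C: "\<And>x. x \<in> vertices t \<Longrightarrow> p x \<in> mspace C"
    and x: "x \<in> vertices t" and y: "y \<in> vertices t"
  shows "mdist C (p x) (p y) \<le> e * mdist (loop t) x y"
proof -
  have path: "mdist C (p x) (p y) \<le> e * real n" if "(x, y) \<in> loop_edges t ^^ n" for n y
    using that
  proof (induction n arbitrary: y)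
    case 0
    then show ?case using C[OF x] by (simp add: mdist_self)
  next
    case (Suc n)
    then obtain z where z: "(x, z) \<in> loop_edges t ^^ n" "(z, y) \<in> loop_edges t" by auto
    have "z \<in> vertices t" "y \<in> vertices t" using loop_edge_vertices[OF z(2)] by auto
    then have "mdist C (p x) (p y) \<le> mdist C (p x) (p z) + mdist C (p z) (p y)"
      using x by (intro mdist_triangle C)
    with Suc.IH[OF z(1)] p[OF z(2)] show ?case by (simp add: algebra_simps)
  qed
  have "(x, y) \<in> loop_edges t ^^ graph_dist (loop_edges t) x y"
    unfolding graph_dist_def using loop_connected[OF x y] by (rule LeastI_ex)
  from path[OF this] show ?thesis by (simp add: mdist_loop)
qed

text \<open>
  The position on the loop of \<open>u\<close> of the projection of \<open>x\<close>: \<open>0\<close> for \<open>u\<close> and everything outside the subtree at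
  \<open>u\<close>, and \<open>i + 1\<close> for the descendants of the child number \<open>i\<close>.
\<close>

definition loop_pos :: "nat list \<Rightarrow> nat list \<Rightarrow> nat" where
  "loop_pos u x = (if take (length u) x = u then (case drop (length u) x of [] \<Rightarrow> 0 | i # _ \<Rightarrow> Suc i) else 0)"

lemma loop_pos_below [simp]: "loop_pos u (u @ i # v) = Suc i" "loop_pos u u = 0"
  by (simp_all add: loop_pos_def)

lemma loop_pos_outside: "\<nexists>v. x = u @ v \<Longrightarrow> loop_pos u x = 0"
  unfolding loop_pos_def by (metis append_take_drop_id)

lemma loop_pos_snoc: "loop_pos u (w @ [i]) = (if w = u then Suc i else loop_pos u w)"
proof (cases "\<exists>v. w = u @ v")
  case True
  then obtain v where "w = u @ v" by blast
  then show ?thesis by (cases v) simp_all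
next
  case False
  then have "loop_pos u w = 0" by (rule loop_pos_outside)
  moreover have "loop_pos u (w @ [i]) = 0"
  proof (cases "\<exists>z. w @ [i] = u @ z")
    case True
    then obtain z where z: "w @ [i] = u @ z" by blast
    have "z = []"
    proof (rule ccontr)
      assume "z \<noteq> []"
      then have "w = u @ butlast z" using z by (metis butlast_append butlast_snoc)
      with False show False by blast
    qed
    with z show ?thesis by simp
  qed (rule loop_pos_outside)
  ultimately show ?thesis using False by auto
qed

text \<open>An edge stays inside a piece or moves one step along the loop of \<open>u\<close>; the
  last alternative is the step between the last child and \<open>u\<close>.\<close>

lemma loop_pos_edge:
  assumes "(x, y) \<in> loop_edges t"
  shows "loop_pos u x = loop_pos u y \<or> loop_pos u x = Suc (loop_pos u y) \<or> loop_pos u y = Suc (loop_pos u x) \<or>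
    {loop_pos u x, loop_pos u y} = {0, num_children t u}"
proof -
  have "(\<exists>w i. {x, y} = {w @ [i], w @ [Suc i]}) \<or>
     (\<exists>w. {x, y} = {w, w @ [0]} \<or> {x, y} = {w, w @ [num_children t w - 1]})"
    using assms by (simp add: loop_edges_def)
  then show ?thesis
  proof (elim disjE exE)
    \<comment> \<open>For \<open>w = u\<close> this is the edge that closes the loop; if
      \<open>u\<close> is a leaf, \<open>num_children t u - 1\<close> is 0 and the positions are 0
      and 1.\<close>
    fix w assume "{x, y} = {w, w @ [num_children t w - 1]}"
    then show ?thesis
      by (cases "w = u"; cases "num_children t u") (auto simp: doubleton_eq_iff loop_pos_snoc)
  next
    fix w assume "{x, y} = {w, w @ [0]}"
    then show ?thesis by (cases "w = u") (auto simp: doubleton_eq_iff loop_pos_snoc)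
  next
    fix w i assume "{x, y} = {w @ [i], w @ [Suc i]}"
    then show ?thesis by (cases "w = u") (auto simp: doubleton_eq_iff loop_pos_snoc)
  qed
qed

lemma loop_pos_le:
  assumes "u \<in> vertices t" "x \<in> vertices t" shows "loop_pos u x \<le> num_children t u"
proof (cases "\<exists>i v. x = u @ i # v")
  case True
  then obtain i v where x: "x = u @ i # v" by blast
  then have "(u @ [i]) @ v \<in> vertices t" using assms by simp
  then have "u @ [i] \<in> vertices t" by (simp only: append_in_vertices)
  then show ?thesis by (simp add: x snoc_in_vertices Suc_le_eq)
next
  case False
  then have "loop_pos u x = 0"
    by (cases "\<exists>v. x = u @ v") (metis append_Nil2 loop_pos_below(2) neq_Nil_conv, simp add: loop_pos_outside)
  then show ?thesis by simp
qed

section \<open>Comparison of the loop with the circle\<close>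

lemma mspace_unit_circle: "mspace unit_circle = {0..<1}"
  unfolding unit_circle_def by (rule Metric_space.mspace_metric[OF Metric_space_unit_circle])

lemma mdist_unit_circle:
  assumes "s \<in> {0..<1}" "t \<in> {0..<1}"
  shows "mdist unit_circle s t = min \<bar>s - t\<bar> (1 - \<bar>s - t\<bar>)"
  unfolding unit_circle_def Metric_space.mdist_metric[OF Metric_space_unit_circle] arc_dist_eq[OF assms] ..

text \<open>The loop of a vertex with \<open>k\<close> children contains the vertex too, hence is a
  cycle of length \<open>k + 1\<close>, embedded here as a regular grid.\<close>

lemma mdist_unit_circle_grid:
  assumes "a \<le> k" "b \<le> k"
  shows "real (Suc k) * mdist unit_circle (real a / real (Suc k)) (real b / real (Suc k)) =
    min \<bar>real a - real b\<bar> (real (Suc k) - \<bar>real a - real b\<bar>)"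
proof -
  have "\<bar>real a / real (Suc k) - real b / real (Suc k)\<bar> = \<bar>real a - real b\<bar> / real (Suc k)"
    by (simp add: diff_divide_distrib[symmetric])
  then have "mdist unit_circle (real a / real (Suc k)) (real b / real (Suc k)) =
      min (\<bar>real a - real b\<bar> / real (Suc k)) (1 - \<bar>real a - real b\<bar> / real (Suc k))"
    using assms by (subst mdist_unit_circle) (simp_all add: divide_simps)
  then show ?thesis by (simp add: min_mult_distrib_left right_diff_distrib)
qed

context
  fixes t :: plane_tree and u :: "nat list" and k :: nat
  assumes u: "u \<in> vertices t" and k: "num_children t u = k"
begin

text \<open>Position 0 is \<open>u\<close> itself, which shifts the children by one; on the loop
  this inverts \<open>loop_pos\<close>.\<close>

definition loop_vertex :: "nat \<Rightarrow> nat list" where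
  "loop_vertex a = (if a = 0 then u else u @ [a - 1])"

lemma loop_vertex_in: "a \<le> k \<Longrightarrow> loop_vertex a \<in> vertices t"
  using u k by (auto simp: loop_vertex_def snoc_in_vertices)

lemma loop_pos_loop_vertex: "loop_pos u (loop_vertex a) = a"
  by (simp add: loop_vertex_def)

lemma mdist_loop_vertex_le:
  assumes "a \<le> b" "b \<le> k"
  shows "mdist (loop t) (loop_vertex a) (loop_vertex b) \<le> real b - real a"
  using assms
proof (induction b)
  case 0
  then show ?case using loop_vertex_in[of 0] by (simp add: mspace_loop mdist_self)
next
  case (Suc b)
  show ?case
  proof (cases "a = Suc b")
    case True
    then show ?thesis using loop_vertex_in[OF Suc.prems(2)] by (simp add: mspace_loop mdist_self)
  next
    case False
    have v: "loop_vertex a \<in> vertices t" "loop_vertex b \<in> vertices t" "loop_vertex (Suc b) \<in> vertices t"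
      using Suc.prems False by (intro loop_vertex_in; simp)+
    have "(loop_vertex b, loop_vertex (Suc b)) \<in> loop_edges t"
    proof (cases b)
      case 0
      then show ?thesis using v by (auto simp: loop_edges_def loop_vertex_def)
    next
      case (Suc c)
      then have "{loop_vertex b, loop_vertex (Suc b)} = {u @ [c], u @ [Suc c]}" by (simp add: loop_vertex_def)
      then show ?thesis using v unfolding loop_edges_def by blast
    qed
    then have "mdist (loop t) (loop_vertex b) (loop_vertex (Suc b)) \<le> 1" by (rule mdist_loop_edge)
    moreover have "mdist (loop t) (loop_vertex a) (loop_vertex (Suc b)) \<le>
        mdist (loop t) (loop_vertex a) (loop_vertex b) + mdist (loop t) (loop_vertex b) (loop_vertex (Suc b))"
      using v by (intro mdist_triangle) (simp_all add: mspace_loop)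
    ultimately show ?thesis using Suc False by simp
  qed
qed

lemma mdist_loop_vertex_close: "mdist (loop t) (loop_vertex 0) (loop_vertex k) \<le> 1"
proof (cases k)
  case 0
  then show ?thesis using loop_vertex_in[of 0] by (simp add: mspace_loop mdist_self)
next
  case (Suc c)
  have "{loop_vertex 0, loop_vertex k} = {u, u @ [num_children t u - 1]}" using k Suc by (simp add: loop_vertex_def)
  then have "(loop_vertex 0, loop_vertex k) \<in> loop_edges t"
    using loop_vertex_in[of 0] loop_vertex_in[of k] unfolding loop_edges_def by blast
  then show ?thesis by (rule mdist_loop_edge)
qed

text \<open>The two terms of the minimum are the two ways round the loop, the second through the
  edge between \<open>u\<close> and its last child.\<close>

lemma mdist_loop_vertex:
  assumes "a \<le> k" "b \<le> k"
  shows "mdist (loop t) (loop_vertex a) (loop_vertex b) \<le> min \<bar>real a - real b\<bar> (real (Suc k) - \<bar>real a - real b\<bar>)"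
proof -
  have le: "mdist (loop t) (loop_vertex a) (loop_vertex b) \<le> min \<bar>real a - real b\<bar> (real (Suc k) - \<bar>real a - real b\<bar>)"
    if ab: "a \<le> b" "b \<le> k" for a b
  proof -
    have v: "loop_vertex a \<in> mspace (loop t)" "loop_vertex b \<in> mspace (loop t)"
      "loop_vertex 0 \<in> mspace (loop t)" "loop_vertex k \<in> mspace (loop t)"
      unfolding mspace_loop using ab by (intro loop_vertex_in; simp)+
    have "mdist (loop t) (loop_vertex a) (loop_vertex b) \<le> mdist (loop t) (loop_vertex a) (loop_vertex 0) +
        mdist (loop t) (loop_vertex 0) (loop_vertex k) + mdist (loop t) (loop_vertex k) (loop_vertex b)"
      using mdist_triangle[OF v(1,3,2)] mdist_triangle[OF v(3,4,2)] by linarith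
    moreover have "mdist (loop t) (loop_vertex a) (loop_vertex 0) \<le> real a"
      using mdist_loop_vertex_le[of 0 a] ab by (simp add: mdist_commute)
    moreover have "mdist (loop t) (loop_vertex k) (loop_vertex b) \<le> real k - real b"
      using mdist_loop_vertex_le[of b k] ab by (simp add: mdist_commute)
    ultimately have "mdist (loop t) (loop_vertex a) (loop_vertex b) \<le> real (Suc k) - (real b - real a)"
      using mdist_loop_vertex_close by simp
    then show ?thesis using mdist_loop_vertex_le[OF ab] ab by simp
  qed
  show ?thesis
  proof (cases "a \<le> b")
    case False
    then show ?thesis using le[of b a] assms by (simp add: mdist_commute abs_minus_commute)
  qed (use le assms in simp)
qed

definition circle_pos :: "nat list \<Rightarrow> real" where
  "circle_pos x = real (loop_pos u x) / real (Suc k)"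

lemma circle_pos_in: "x \<in> vertices t \<Longrightarrow> circle_pos x \<in> {0..<1}"
  using loop_pos_le[OF u, of x] k by (simp add: circle_pos_def divide_less_eq)

text \<open>The rest of the tree offers no shortcut: projecting to the loop moves the ends of every
  edge by at most one step of the grid.\<close>

lemma circle_pos_le:
  assumes "x \<in> vertices t" "y \<in> vertices t"
  shows "real (Suc k) * mdist unit_circle (circle_pos x) (circle_pos y) \<le> mdist (loop t) x y"
proof -
  have "mdist unit_circle (circle_pos x) (circle_pos y) \<le> 1 / real (Suc k) * mdist (loop t) x y"
  proof (rule mdist_loop_ge[OF _ _ assms])
    fix x y assume e: "(x, y) \<in> loop_edges t"
    have le: "loop_pos u x \<le> k" "loop_pos u y \<le> k"
      using loop_pos_le[OF u] loop_edge_vertices[OF e] k by auto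
    have "min \<bar>real (loop_pos u x) - real (loop_pos u y)\<bar> (real (Suc k) - \<bar>real (loop_pos u x) - real (loop_pos u y)\<bar>) \<le> 1"
      using loop_pos_edge[OF e, of u] k by (auto simp: doubleton_eq_iff min_def)
    then have "real (Suc k) * mdist unit_circle (circle_pos x) (circle_pos y) \<le> 1"
      unfolding circle_pos_def mdist_unit_circle_grid[OF le] .
    then show "mdist unit_circle (circle_pos x) (circle_pos y) \<le> 1 / real (Suc k)"
      by (simp add: field_simps)
  qed (simp add: mspace_unit_circle circle_pos_in del: atLeastLessThan_iff)
  then show ?thesis by (simp add: field_simps)
qed

text \<open>Below a child of \<open>u\<close> the distance to that child is at most
  \<open>R\<close>. Outside the subtree, \<open>x\<close> and \<open>u\<close> are joined through
  the root, each at distance at most \<open>R\<close>, which explains the factor 2.\<close>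

lemma mdist_to_loop:
  assumes R: "real (tsize (graft t u (Node []))) \<le> R" "\<And>s. s \<in> set (children (subtree t u)) \<Longrightarrow> real (tsize s) \<le> R"
    and x: "x \<in> vertices t"
  shows "mdist (loop t) x (loop_vertex (loop_pos u x)) \<le> 2 * R"
proof -
  have "0 \<le> R" using R(1) by (rule order_trans[rotated]) simp
  show ?thesis
  proof (cases "\<exists>v. x = u @ v")
    case True
    then obtain v where v: "x = u @ v" by blast
    show ?thesis
    proof (cases v)
      case Nil
      then show ?thesis using v x \<open>0 \<le> R\<close> by (simp add: loop_vertex_def mspace_loop mdist_self)
    next
      case (Cons i w)
      obtain ts where ts: "subtree t u = Node ts" by (cases "subtree t u")
      have "i # w \<in> vertices (Node ts)" using x unfolding v Cons by (simp only: append_in_vertices ts)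
      then have iw: "i < length ts" "w \<in> vertices (ts ! i)" by auto
      have "mdist (loop t) (u @ [i]) ((u @ [i]) @ w) \<le> real (address_sum w)"
        using x by (intro mdist_loop_append) (simp add: v Cons)
      also have "\<dots> \<le> real (tsize (ts ! i))" using address_sum_less_tsize[OF iw(2)] by simp
      also have "\<dots> \<le> R" using iw by (intro R) (simp add: ts)
      finally show ?thesis using \<open>0 \<le> R\<close> by (simp add: v Cons loop_vertex_def mdist_commute)
    qed
  next
    case False
    have "address_sum x < tsize (graft t u (Node []))"
      using num_children_graft[OF u x False] by (intro address_sum_less_tsize) simp
    moreover have "address_sum u < tsize (graft t u (Node []))"
      using in_vertices_graft[OF u] by (rule address_sum_less_tsize)
    ultimately have "real (address_sum x) + real (address_sum u) \<le> 2 * R" using R(1) by linarith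
    moreover have "mdist (loop t) x u \<le> mdist (loop t) [] x + mdist (loop t) [] u"
      using mdist_triangle[of x "loop t" "[]" u] x u Nil_in_vertices by (simp add: mspace_loop mdist_commute)
    moreover have "mdist (loop t) [] x \<le> real (address_sum x)" "mdist (loop t) [] u \<le> real (address_sum u)"
      using mdist_loop_append[of "[]" x t] mdist_loop_append[of "[]" u t] x u by simp_all
    ultimately show ?thesis using loop_pos_outside[OF False] by (simp add: loop_vertex_def)
  qed
qed

lemma loop_circle_distortion:
  assumes R: "real (tsize (graft t u (Node []))) \<le> R" "\<And>s. s \<in> set (children (subtree t u)) \<Longrightarrow> real (tsize s) \<le> R"
    and x: "x \<in> vertices t" and y: "y \<in> vertices t"
  shows "\<bar>mdist (loop t) x y - real (Suc k) * mdist unit_circle (circle_pos x) (circle_pos y)\<bar> \<le> 4 * R"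
proof -
  have "0 \<le> R" using R(1) by (rule order_trans[rotated]) simp
  let ?x = "loop_vertex (loop_pos u x)" and ?y = "loop_vertex (loop_pos u y)"
  have le: "loop_pos u x \<le> k" "loop_pos u y \<le> k" using loop_pos_le[OF u] x y k by auto
  have v: "x \<in> mspace (loop t)" "y \<in> mspace (loop t)" "?x \<in> mspace (loop t)" "?y \<in> mspace (loop t)"
    unfolding mspace_loop using x y le by (auto intro: loop_vertex_in)
  have "mdist (loop t) x y \<le> mdist (loop t) x ?x + mdist (loop t) ?x ?y + mdist (loop t) y ?y"
    using mdist_triangle[OF v(1,3,2)] mdist_triangle[OF v(3,4,2)] mdist_commute[of "loop t" y ?y] by linarith
  also have "\<dots> \<le> 2 * R + real (Suc k) * mdist unit_circle (circle_pos x) (circle_pos y) + 2 * R"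
    unfolding circle_pos_def mdist_unit_circle_grid[OF le]
    by (intro add_mono mdist_to_loop mdist_loop_vertex R x y le)
  finally show ?thesis using circle_pos_le[OF x y] \<open>0 \<le> R\<close> by linarith
qed

lemma gh_loop_circle:
  fixes n :: nat and a :: real
  assumes R: "real (tsize (graft t u (Node []))) \<le> R" "\<And>s. s \<in> set (children (subtree t u)) \<Longrightarrow> real (tsize s) \<le> R"
    and n: "0 < n" and a: "0 < a"
  shows "dist (gh_class (scale_metric (1 / real n) (loop t))) (gh_class (scale_metric a unit_circle)) \<le>
    (4 * R + 3) / real n + \<bar>real k / real n - a\<bar>"
proof -
  have R0: "0 \<le> R" using R(1) by (rule order_trans[rotated]) simp
  \<comment> \<open>Each vertex corresponds to the whole arc of length \<open>1 / (k + 1)\<close>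
    that begins at its position, so that every point of the circle is reached.\<close>
  define C where "C = {(x, s). x \<in> vertices t \<and> s \<in> {0..<1::real} \<and> nat \<lfloor>s * real (Suc k)\<rfloor> = loop_pos u x}"
  \<comment> \<open>\<open>4 * R\<close> pays for projecting two vertices to the loop, 2 for
    rounding two points to the grid, and 1 for replacing the loop length \<open>k + 1\<close> by
    \<open>k\<close>.\<close>
  define r where "r = (4 * R + 3) / real n + \<bar>real k / real n - a\<bar>"
  have r: "0 < r" 
  proof -
    have "0 < 4 * R + 3" using R0 by linarith
    then have "0 < (4 * R + 3) / real n" using n by simp
    then show ?thesis unfolding r_def by linarith
  qed
  have close: "mdist unit_circle s (circle_pos x) \<le> 1 / real (Suc k)" if "(x, s) \<in> C" for x s
  proof -
    have x: "x \<in> vertices t" "s \<in> {0..<1}" "nat \<lfloor>s * real (Suc k)\<rfloor> = loop_pos u x" using that by (auto simp: C_def)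
    have "0 \<le> s * real (Suc k)" using x(2) by simp
    then have "real (loop_pos u x) \<le> s * real (Suc k)" "s * real (Suc k) \<le> real (loop_pos u x) + 1"
      unfolding x(3)[symmetric] by linarith+
    then have "\<bar>s - circle_pos x\<bar> \<le> 1 / real (Suc k)" 
    proof -
      assume p: "real (loop_pos u x) \<le> s * real (Suc k)" "s * real (Suc k) \<le> real (loop_pos u x) + 1"
      have "s - circle_pos x = (s * real (Suc k) - real (loop_pos u x)) / real (Suc k)"
        by (simp add: circle_pos_def diff_divide_distrib del: of_nat_Suc)
      then have "\<bar>s - circle_pos x\<bar> = \<bar>s * real (Suc k) - real (loop_pos u x)\<bar> / real (Suc k)"
        by (simp add: abs_divide del: of_nat_Suc)
      also have "\<dots> \<le> 1 / real (Suc k)" using p by (intro divide_right_mono) auto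
      finally show ?thesis .
    qed
    moreover have "mdist unit_circle s (circle_pos x) \<le> \<bar>s - circle_pos x\<bar>"
      using mdist_unit_circle[OF x(2) circle_pos_in[OF x(1)]] by simp
    ultimately show ?thesis by linarith
  qed
  have "gh_corr (scale_metric (1 / real n) (loop t)) (scale_metric a unit_circle) C r"
  proof (rule gh_corrI)
    show "x \<in> mspace (scale_metric (1 / real n) (loop t)) \<and> s \<in> mspace (scale_metric a unit_circle)" if "(x, s) \<in> C" for x s
      using that by (auto simp: C_def mspace_loop mspace_unit_circle)
    show "\<exists>s. (x, s) \<in> C" if "x \<in> mspace (scale_metric (1 / real n) (loop t))" for x
    proof -
      have x: "x \<in> vertices t" using that by (simp add: mspace_loop)
      have "(x, circle_pos x) \<in> C" unfolding C_def using x circle_pos_in[OF x] by (auto simp: circle_pos_def)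
      then show ?thesis by blast
    qed
    show "\<exists>x. (x, s) \<in> C" if "s \<in> mspace (scale_metric a unit_circle)" for s
    proof -
      have s: "0 \<le> s" "s < 1" using that by (simp_all add: mspace_unit_circle)
      have "s * real (Suc k) < real (Suc k)" using s by simp
      then have "nat \<lfloor>s * real (Suc k)\<rfloor> \<le> k" by linarith
      then have "(loop_vertex (nat \<lfloor>s * real (Suc k)\<rfloor>), s) \<in> C"
        using s loop_vertex_in by (simp add: C_def loop_pos_loop_vertex)
      then show ?thesis by blast
    qed
    fix x s x' s' assume xs: "(x, s) \<in> C" "(x', s') \<in> C"
    then have x: "x \<in> vertices t" "x' \<in> vertices t" "s \<in> {0..<1}" "s' \<in> {0..<1}" by (auto simp: C_def)
    let ?d = "mdist (loop t) x x'" and ?c = "mdist unit_circle s s'" and ?q = "mdist unit_circle (circle_pos x) (circle_pos x')"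
    have m: "s \<in> mspace unit_circle" "s' \<in> mspace unit_circle" "circle_pos x \<in> mspace unit_circle" "circle_pos x' \<in> mspace unit_circle"
      unfolding mspace_unit_circle using x circle_pos_in by auto
    have "?c \<le> mdist unit_circle s (circle_pos x) + ?q + mdist unit_circle s' (circle_pos x')"
      using mdist_triangle[OF m(1,3,2)] mdist_triangle[OF m(3,4,2)] mdist_commute[of unit_circle s' "circle_pos x'"] by linarith
    moreover have "?q \<le> mdist unit_circle s (circle_pos x) + ?c + mdist unit_circle s' (circle_pos x')"
      using mdist_triangle[OF m(3,1,4)] mdist_triangle[OF m(1,2,4)] mdist_commute[of unit_circle s "circle_pos x"] by linarith
    ultimately have "\<bar>?q - ?c\<bar> \<le> 2 / real (Suc k)" using close[OF xs(1)] close[OF xs(2)] by linarith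
    then have "real (Suc k) * \<bar>?q - ?c\<bar> \<le> real (Suc k) * (2 / real (Suc k))" by (intro mult_left_mono) auto
    then have "\<bar>real (Suc k) * ?q - real (Suc k) * ?c\<bar> \<le> 2"
      by (simp add: right_diff_distrib[symmetric] abs_mult del: of_nat_Suc)
    with loop_circle_distortion[OF R x(1,2)] have "\<bar>?d - real (Suc k) * ?c\<bar> \<le> 4 * R + 2" by linarith
    then have "\<bar>?d - real (Suc k) * ?c\<bar> / real n \<le> (4 * R + 2) / real n" by (intro divide_right_mono) auto
    then have 1: "\<bar>?d / real n - real (Suc k) / real n * ?c\<bar> \<le> (4 * R + 2) / real n"
    proof -
      assume d: "\<bar>?d - real (Suc k) * ?c\<bar> / real n \<le> (4 * R + 2) / real n"
      have "?d / real n - real (Suc k) / real n * ?c = (?d - real (Suc k) * ?c) / real n"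
        by (simp add: diff_divide_distrib del: of_nat_Suc)
      with d show ?thesis by (simp add: abs_divide del: of_nat_Suc)
    qed
    have c1: "0 \<le> ?c" "?c \<le> 1" using mdist_unit_circle[OF x(3,4)] x(3,4) by (auto simp: min_def)
    have "\<bar>real (Suc k) / real n - a\<bar> * ?c \<le> \<bar>real (Suc k) / real n - a\<bar> * 1"
      using c1 by (intro mult_left_mono) auto
    then have 2: "\<bar>real (Suc k) / real n * ?c - a * ?c\<bar> \<le> \<bar>real (Suc k) / real n - a\<bar>"
    proof -
      have "real (Suc k) / real n * ?c - a * ?c = (real (Suc k) / real n - a) * ?c" by (rule left_diff_distrib[symmetric])
      then have "\<bar>real (Suc k) / real n * ?c - a * ?c\<bar> = \<bar>real (Suc k) / real n - a\<bar> * ?c"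
        using c1 by (simp only: abs_mult abs_of_nonneg)
      moreover assume "\<bar>real (Suc k) / real n - a\<bar> * ?c \<le> \<bar>real (Suc k) / real n - a\<bar> * 1"
      ultimately show ?thesis by (simp only: mult_1_right)
    qed
    have "real (Suc k) / real n - a = (real k / real n - a) + 1 / real n" by (simp add: add_divide_distrib)
    then have 3: "\<bar>real (Suc k) / real n - a\<bar> \<le> \<bar>real k / real n - a\<bar> + 1 / real n"
      using abs_triangle_ineq[of "real k / real n - a" "1 / real n"] by simp
    have 4: "(4 * R + 2) / real n + 1 / real n = (4 * R + 3) / real n" by (simp add: add_divide_distrib[symmetric])
    have "\<bar>?d / real n - a * ?c\<bar> \<le> \<bar>?d / real n - real (Suc k) / real n * ?c\<bar> + \<bar>real (Suc k) / real n * ?c - a * ?c\<bar>"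
      by (rule order_trans[OF _ abs_triangle_ineq]) simp
    also have "\<dots> \<le> (4 * R + 2) / real n + (\<bar>real k / real n - a\<bar> + 1 / real n)"
      by (intro add_mono 1 order_trans[OF 2 3])
    also have "\<dots> = r" unfolding r_def 4[symmetric] by (simp only: ac_simps)
    finally have "\<bar>?d / real n - a * ?c\<bar> \<le> r" .
    then show "\<bar>mdist (scale_metric (1 / real n) (loop t)) x x' - mdist (scale_metric a unit_circle) s s'\<bar> \<le> 2 * r"
      using n a r by (simp add: mdist_scale_metric)
  qed
  then have "gh_dist (scale_metric (1 / real n) (loop t)) (scale_metric a unit_circle) \<le> r"
    by (intro gh_dist_le compact_metric_scale compact_metric_loop compact_metric_unit_circle r)
  then show ?thesis
    unfolding r_def by (simp add: dist_gh_class compact_metric_scale compact_metric_loop compact_metric_unit_circle)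
qed

end

section \<open>Convergence in distribution\<close>

definition circle_class :: "real \<Rightarrow> gh_space" where
  "circle_class a = gh_class (scale_metric a unit_circle)"

lemma dist_circle_class:
  assumes "0 < a" "0 < b" shows "dist (circle_class a) (circle_class b) \<le> \<bar>a - b\<bar>"
proof -
  have "mdist unit_circle s t \<le> 1" if "s \<in> mspace unit_circle" "t \<in> mspace unit_circle" for s t
    using that by (auto simp: mspace_unit_circle mdist_unit_circle min_def)
  from gh_dist_scale_le[OF compact_metric_unit_circle assms zero_less_one this] show ?thesis
    by (simp add: circle_class_def dist_gh_class compact_metric_scale compact_metric_unit_circle)
qed

lemma continuous_on_circle_class: "continuous_on {0<..} circle_class"
proof (rule lipschitz_on_continuous_on)
  show "1-lipschitz_on {0<..} circle_class"
    by (rule lipschitz_onI) (auto simp: dist_circle_class dist_real_def)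
qed

text \<open>Lebesgue number lemma. Test functions need not be uniformly continuous; here only
  \<open>x\<close> is confined to the compact set (later of circles), while \<open>y\<close> is
  arbitrary (later a rescaled looptree).\<close>

lemma uniform_near_compact:
  fixes f :: "'a::metric_space \<Rightarrow> real"
  assumes f: "continuous_on UNIV f" and K: "compact K" and e: "0 < e"
  obtains d where "0 < d" "\<And>x y. x \<in> K \<Longrightarrow> dist x y < d \<Longrightarrow> \<bar>f y - f x\<bar> < e"
proof -
  define G where "G = (\<lambda>c. f -` ball c (e / 2)) ` UNIV"
  have "open S" if "S \<in> G" for S
    using that f by (auto simp: G_def intro: open_vimage)
  moreover have "x \<in> \<Union>G" for x
    by (rule UnionI[of "f -` ball (f x) (e / 2)"]) (use e in \<open>auto simp: G_def\<close>)
  then have "K \<subseteq> \<Union>G" by blast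
  ultimately obtain d where d: "0 < d" "\<And>x. x \<in> K \<Longrightarrow> \<exists>S\<in>G. ball x d \<subseteq> S"
    using Heine_Borel_lemma[OF K] by metis
  have "\<bar>f y - f x\<bar> < e" if xy: "x \<in> K" "dist x y < d" for x y
  proof -
    obtain c where c: "ball x d \<subseteq> f -` ball c (e / 2)" using d(2)[OF xy(1)] by (auto simp: G_def)
    have "x \<in> ball x d" "y \<in> ball x d" using xy d(1) by auto
    with c have "f x \<in> ball c (e / 2)" "f y \<in> ball c (e / 2)" by blast+
    then have "dist c (f x) < e / 2" "dist c (f y) < e / 2" by simp_all
    then show ?thesis unfolding dist_real_def by linarith
  qed
  with d(1) that show ?thesis by blast
qed

context heavy_tailed
begin

lemma prob_space_conditioned: "prob_space (uniform_measure bgw {t. n \<le> tsize t})"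
proof (rule prob_space_uniform_measure)
  show "emeasure bgw {t. n \<le> tsize t} \<noteq> 0"
    using size_prob_pos[of n] by (simp add: measure_pmf.emeasure_eq_measure)
qed (simp add: measure_pmf.emeasure_eq_measure)

text \<open>
  A lower bound suffices, because it can be applied both to \<open>B + f\<close> and to \<open>B - f\<close>.
\<close>

lemma conditioned_liminf:
  fixes f :: "gh_space \<Rightarrow> real" and M :: "'a measure" and J :: "'a \<Rightarrow> real"
  assumes f: "continuous_on UNIV f" and f0: "\<And>x. 0 \<le> f x" and fB: "\<And>x. f x \<le> B"
    and M: "prob_space M" and J[measurable]: "J \<in> borel_measurable M"
    and tail_J: "\<And>x. x \<ge> 1 - m \<Longrightarrow> measure M {w \<in> space M. J w \<ge> x} = ((1 - m) / x) powr beta"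
    and e: "0 < e"
  shows "eventually (\<lambda>n. (\<integral>w. f (circle_class (J w)) \<partial>M) - e \<le>
     (\<integral>t. f (gh_class (scale_metric (1 / real n) (loop t))) \<partial>uniform_measure bgw {t. n \<le> tsize t})) sequentially"
proof -
  interpret M: prob_space M by (rule M)
  have B: "0 \<le> B" using f0 fB order_trans by blast
  define F where "F x = ((1 - m) / x) powr beta" for x
  define h where "h a = f (circle_class a)" for a
  have h: "0 \<le> h a" "h a \<le> B" for a by (simp_all add: h_def f0 fB)
  define e1 where "e1 = e / 8"
  define e2 where "e2 = e / (8 * (B + 1))"
  have e12: "0 < e1" "0 < e2" using e B by (simp_all add: e1_def e2_def)
  \<comment> \<open>The cuts at \<open>lo\<close> and \<open>hi\<close> lose mass at most
    \<open>e2\<close> each; \<open>lo\<close> stays strictly above \<open>1 - m\<close>, as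
    \<open>condensation\<close> requires.\<close>
  obtain lo where lo: "1 - m < lo" "1 - e2 < F lo"
  proof -
    have "isCont F (1 - m)" unfolding F_def using m_less_1 by (intro continuous_intros) auto
    then have "(F \<longlongrightarrow> F (1 - m)) (at_right (1 - m))"
      unfolding isCont_def by (rule tendsto_mono[OF at_le, rotated]) simp
    moreover have "F (1 - m) = 1" using m_less_1 by (simp add: F_def)
    ultimately have "eventually (\<lambda>x. 1 - e2 < F x) (at_right (1 - m))"
      using e12 by (intro order_tendstoD(1)) auto
    then have "eventually (\<lambda>x. 1 - e2 < F x \<and> 1 - m < x) (at_right (1 - m))"
      by (intro eventually_conj eventually_at_right_less)
    then show thesis using that eventually_happens'[OF trivial_limit_at_right_real] by blast
  qed
  obtain hi where hi: "lo < hi" "F hi < e2"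
  proof -
    have "(F \<longlongrightarrow> 0) at_top"
    proof -
      define r where "r = 1 - m"
      have "0 < r" "0 < beta" using m_less_1 beta by (simp_all add: r_def)
      then have "((\<lambda>x. (r / x) powr beta) \<longlongrightarrow> 0) at_top" by real_asymp
      then show ?thesis by (simp add: F_def[abs_def] r_def)
    qed
    then have "eventually (\<lambda>x. F x < e2) at_top" using e12 by (intro order_tendstoD(2)) auto
    then have "eventually (\<lambda>x. F x < e2 \<and> lo < x) at_top" by (intro eventually_conj eventually_gt_at_top)
    then show thesis using that eventually_happens'[OF trivial_limit_at_top_linorder] by blast
  qed
  have lo0: "0 < lo" using lo m_less_1 by simp
  have "compact (circle_class ` {lo..hi})"
    using lo0 by (intro compact_continuous_image continuous_on_subset[OF continuous_on_circle_class]) auto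
  then obtain d where d: "0 < d" "\<And>x y. x \<in> circle_class ` {lo..hi} \<Longrightarrow> dist x y < d \<Longrightarrow> \<bar>f y - f x\<bar> < e1"
    using uniform_near_compact[OF f _ e12(1)] by blast
  obtain N :: nat where N: "0 < N" "(hi - lo) / real N < d / 2"
  proof -
    have "(\<lambda>N. (hi - lo) / real N) \<longlonglongrightarrow> 0" by real_asymp
    then have "eventually (\<lambda>N. (hi - lo) / real N < d / 2) sequentially" using d(1) by (intro order_tendstoD(2)) auto
    then have "eventually (\<lambda>N. (hi - lo) / real N < d / 2 \<and> 0 < N) sequentially"
      by (intro eventually_conj eventually_gt_at_top)
    then show thesis using that eventually_happens'[OF sequentially_bot] by blast
  qed
  define st where "st = (hi - lo) / real N"
  define a where "a i = lo + real i * st" for i :: nat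
  have st: "0 < st" "st < d / 2" using hi N by (simp_all add: st_def)
  have aN: "a N = hi" "a 0 = lo" using N by (simp_all add: a_def st_def)
  have aSuc: "a (Suc i) = a i + st" for i by (simp add: a_def algebra_simps)
  have amono: "a i \<le> a j" if "i \<le> j" for i j using that st by (simp add: a_def mult_right_mono)
  have ain: "a i \<in> {lo..hi}" if "i \<le> N" for i using amono[of 0 i] amono[of i N] that aN by simp
  have alo: "1 - m < a i" "lo \<le> a i" "0 < a i" for i using amono[of 0 i] lo lo0 aN by auto
  \<comment> \<open>\<open>c < lo\<close> makes good vertices unique. The distance \<open>d\<close>
    is spent as \<open>d / 4\<close> on the pieces, \<open>d / 2\<close> on the mesh and
    \<open>d / 4\<close> on the term \<open>3 / n\<close>.\<close>
  define c where "c = min (d / 16) (lo / 2)"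
  have c: "0 < c" "c < lo" "4 * c \<le> d / 4" using d(1) lo0 by (auto simp: c_def)
  have ca: "c < a i" for i using c(2) alo(2)[of i] by linarith
  define G where "G n i = {t. \<exists>u. good_vertex (c * real n) (a i * real n) (a (Suc i) * real n) t u}" for n i
  define p where "p i = F (a i) - F (a (Suc i))" for i
  \<comment> \<open>A lower bound for the test function on the trees of cell \<open>i\<close>, cut
    at 0 so that it can multiply lower bounds on probabilities.\<close>
  define v where "v i = max 0 (h (a i) - e1)" for i
  have v: "0 \<le> v i" "v i \<le> B" for i using h[of "a i"] e12 B by (auto simp: v_def)
  define e3 where "e3 = e / (4 * (real N * B + 1))"
  have NB: "0 < real N * B + 1" using B by (intro add_nonneg_pos) auto
  have e3: "0 < e3" "real N * B * e3 \<le> e / 4"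
  proof -
    show "0 < e3" using e NB by (simp add: e3_def)
    have "D * (e / (4 * D)) = e / 4" if "0 < D" for D using that by simp
    then have "(real N * B + 1) * e3 = e / 4" using NB unfolding e3_def by blast
    moreover have "real N * B * e3 \<le> (real N * B + 1) * e3" using \<open>0 < e3\<close> by (intro mult_right_mono) auto
    ultimately show "real N * B * e3 \<le> e / 4" by simp
  qed
  have Fnonneg: "0 \<le> F x" for x by (simp add: F_def)
  have sum_p: "(\<Sum>i<N. p i) = F lo - F hi"
    unfolding p_def using sum_lessThan_telescope'[of "\<lambda>i. F (a i)" N] by (simp add: aN)
  have F_le_1: "F lo \<le> 1"
    using tail_J[of lo] lo M.prob_le_1[of "{w \<in> space M. J w \<ge> lo}"] by (simp add: F_def)

  \<comment> \<open>On cell \<open>i\<close> the integrand exceeds \<open>h (a i)\<close> by less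
    than \<open>e1\<close>, and \<open>h (a i)\<close> exceeds \<open>v i\<close> by at most
    \<open>e1\<close>. Outside the cells it is at most \<open>B\<close>, on mass at most
    \<open>2 * e2\<close>.\<close>
  have limit_law: "(\<integral>w. h (J w) \<partial>M) \<le> (\<Sum>i<N. v i * p i) + 2 * e1 + 2 * (B * e2)"
  proof -
    define I where "I i = {w \<in> space M. a i \<le> J w \<and> J w < a (Suc i)}" for i
    have I[measurable]: "I i \<in> sets M" for i unfolding I_def by measurable
    have pI: "measure M (I i) = p i" for i
    proof -
      have "I i = {w \<in> space M. a i \<le> J w} - {w \<in> space M. a (Suc i) \<le> J w}" by (auto simp: I_def)
      moreover have "measure M ({w \<in> space M. a i \<le> J w} - {w \<in> space M. a (Suc i) \<le> J w}) =
          measure M {w \<in> space M. a i \<le> J w} - measure M {w \<in> space M. a (Suc i) \<le> J w}"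
        using st by (intro M.finite_measure_Diff) (auto simp: aSuc)
      ultimately show ?thesis using tail_J[of "a i"] tail_J[of "a (Suc i)"] alo[of i] alo[of "Suc i"] by (simp add: p_def F_def)
    qed
    define Out where "Out = {w \<in> space M. \<not> (lo \<le> J w \<and> J w < hi)}"
    have Out[measurable]: "Out \<in> sets M" unfolding Out_def by measurable
    have pOut: "measure M Out \<le> 2 * e2"
    proof -
      have "Out = space M - ({w \<in> space M. lo \<le> J w} - {w \<in> space M. hi \<le> J w})" by (auto simp: Out_def)
      then have "measure M Out = 1 - measure M ({w \<in> space M. lo \<le> J w} - {w \<in> space M. hi \<le> J w})"
        by (simp add: M.prob_compl)
      also have "measure M ({w \<in> space M. lo \<le> J w} - {w \<in> space M. hi \<le> J w}) = F lo - F hi"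
        using hi lo tail_J[of lo] tail_J[of hi] by (subst M.finite_measure_Diff) (auto simp: F_def)
      finally show ?thesis using lo hi by linarith
    qed
    have pw: "h (J w) \<le> (\<Sum>i<N. (v i + 2 * e1) * indicator (I i) w) + B * indicator Out w" if w: "w \<in> space M" for w
    proof (cases "w \<in> Out")
      case True
      have "0 \<le> (\<Sum>i<N. (v i + 2 * e1) * indicator (I i) w)"
        using v e12 by (intro sum_nonneg mult_nonneg_nonneg add_nonneg_nonneg) auto
      then show ?thesis using True h(2)[of "J w"] by simp
    next
      case False
      then have Jw: "lo \<le> J w" "J w < hi" using w by (auto simp: Out_def)
      have ex: "\<exists>i. J w < a i" using Jw(2) aN(1) by blast
      define j where "j = (LEAST i. J w < a i)"
      have j: "J w < a j" "\<And>i. i < j \<Longrightarrow> a i \<le> J w"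
        unfolding j_def using LeastI_ex[OF ex] not_less_Least by (auto simp: not_less[symmetric])
      have "j \<le> N" unfolding j_def using Jw(2) aN(1) by (intro Least_le) simp
      moreover have "j \<noteq> 0" using j(1) Jw(1) aN(2) by (intro notI) simp
      ultimately obtain i where i: "j = Suc i" "i < N" by (cases j) auto
      have Jai: "a i \<le> J w" "J w < a (Suc i)" using j i by auto
      have "dist (circle_class (a i)) (circle_class (J w)) \<le> \<bar>a i - J w\<bar>"
        using alo Jw lo0 by (intro dist_circle_class) auto
      also have "\<dots> < d" using Jai aSuc[of i] st d(1) by linarith
      finally have "\<bar>h (J w) - h (a i)\<bar> < e1" unfolding h_def using ain[of i] i by (intro d(2)) auto
      then have "h (J w) \<le> v i + 2 * e1" unfolding v_def by linarith
      also have "\<dots> = (v i + 2 * e1) * indicator (I i) w" using Jai w by (simp add: I_def)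
      also have "\<dots> \<le> (\<Sum>i<N. (v i + 2 * e1) * indicator (I i) w)"
        using i v e12 by (intro member_le_sum mult_nonneg_nonneg add_nonneg_nonneg) auto
      finally show ?thesis using False by simp
    qed
    have ind: "integrable M (\<lambda>w. r * indicator A w)" if "A \<in> sets M" for A and r :: real
      using that by (intro integrable_mult_right integrable_real_indicator) (auto simp: M.emeasure_eq_measure)
    have step: "integrable M (\<lambda>w. \<Sum>i<N. (v i + 2 * e1) * indicator (I i) w)"
      by (intro Bochner_Integration.integrable_sum ind I)
    have "(\<integral>w. h (J w) \<partial>M) \<le> (\<integral>w. (\<Sum>i<N. (v i + 2 * e1) * indicator (I i) w) + B * indicator Out w \<partial>M)"
    proof (rule integral_mono)
      have [measurable]: "h \<in> borel_measurable borel"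
        unfolding h_def circle_class_def using measurable_gh_class_scale[OF compact_metric_unit_circle]
        by (rule measurable_compose) (rule borel_measurable_continuous_onI[OF f])
      show "integrable M (\<lambda>w. h (J w))"
        by (rule M.integrable_const_bound[where B = B]) (use h in \<open>auto simp: abs_of_nonneg\<close>)
      show "integrable M (\<lambda>w. (\<Sum>i<N. (v i + 2 * e1) * indicator (I i) w) + B * indicator Out w)"
        by (intro Bochner_Integration.integrable_add step ind Out)
    qed (rule pw)
    also have "\<dots> = (\<Sum>i<N. \<integral>w. (v i + 2 * e1) * indicator (I i) w \<partial>M) + (\<integral>w. B * indicator Out w \<partial>M)"
      by (simp only: Bochner_Integration.integral_add[OF step ind[OF Out]] Bochner_Integration.integral_sum[OF ind[OF I]])
    also have "\<dots> = (\<Sum>i<N. (v i + 2 * e1) * p i) + B * measure M Out"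
      by (simp add: pI)
    also have "(\<Sum>i<N. (v i + 2 * e1) * p i) = (\<Sum>i<N. v i * p i) + 2 * e1 * (F lo - F hi)"
      unfolding sum_p[symmetric] by (simp add: distrib_right sum.distrib sum_distrib_left)
    also have "\<dots> \<le> (\<Sum>i<N. v i * p i) + 2 * e1 * 1"
      using e12 F_le_1 Fnonneg[of hi] by (intro add_left_mono mult_left_mono) auto
    also have "B * measure M Out \<le> B * (2 * e2)" using pOut B by (intro mult_left_mono)
    finally show ?thesis by simp
  qed
  have bound: "(\<integral>w. h (J w) \<partial>M) \<le> (\<Sum>i<N. v i * p i) + e / 4 + e / 4"
  proof -
    have "B * e2 \<le> (B + 1) * e2" using e12 by (intro mult_right_mono) auto
    also have "\<dots> = e / 8"
    proof -
      have "D * (e / (8 * D)) = e / 8" if "0 < D" for D using that by simp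
      moreover have "0 < B + 1" using B by simp
      ultimately show ?thesis unfolding e2_def by blast
    qed
    finally show ?thesis using limit_law by (simp add: e1_def)
  qed

  have "eventually (\<lambda>n. \<forall>i\<in>{..<N}. p i - e3 < measure (uniform_measure bgw {t. n \<le> tsize t}) (G n i)) sequentially"
  proof (intro eventually_ball_finite ballI)
    fix i
    have "eventually (\<lambda>n. ((1 - m) / a i) powr beta - ((1 - m) / a (Suc i)) powr beta - e3 <
     measure_pmf.prob bgw {t. n \<le> tsize t \<and> (\<exists>u. good_vertex (c * real n) (a i * real n) (a (Suc i) * real n) t u)} /
     measure_pmf.prob bgw {t. n \<le> tsize t}) sequentially"
      using alo[of i] st ca[of i] c e3 by (intro condensation) (auto simp: aSuc)
    then show "eventually (\<lambda>n. p i - e3 < measure (uniform_measure bgw {t. n \<le> tsize t}) (G n i)) sequentially"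
    proof eventually_elim
      case (elim n)
      have "measure (uniform_measure bgw {t. n \<le> tsize t}) (G n i) =
         measure_pmf.prob bgw ({t. n \<le> tsize t} \<inter> G n i) / measure_pmf.prob bgw {t. n \<le> tsize t}"
        using size_prob_pos[of n] by (intro measure_uniform_measure) (auto simp: measure_pmf.emeasure_eq_measure)
      also have "{t. n \<le> tsize t} \<inter> G n i = {t. n \<le> tsize t \<and> (\<exists>u. good_vertex (c * real n) (a i * real n) (a (Suc i) * real n) t u)}"
        by (auto simp: G_def)
      finally show ?case using elim by (simp add: p_def F_def)
    qed
  qed simp
  moreover have "eventually (\<lambda>n. 3 / real n < d / 4) sequentially"
  proof -
    have "(\<lambda>n. 3 / real n) \<longlonglongrightarrow> 0" by real_asymp
    then show ?thesis using d(1) by (intro order_tendstoD(2)) auto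
  qed
  ultimately show ?thesis
    using eventually_gt_at_top[of 0]
  proof eventually_elim
    case (elim n)
    let ?U = "uniform_measure bgw {t. n \<le> tsize t}"
    interpret U: prob_space ?U by (rule prob_space_conditioned)
    define X where "X t = gh_class (scale_metric (1 / real n) (loop t))" for t
    have setsU: "sets ?U = UNIV" "space ?U = UNIV" by simp_all
    have meas: "g \<in> borel_measurable ?U" for g :: "plane_tree \<Rightarrow> real"
      unfolding measurable_def using setsU by auto
    have close: "v i \<le> f (X t)" if i: "i < N" and t: "t \<in> G n i" for i t
    proof -
      obtain u where u: "good_vertex (c * real n) (a i * real n) (a (Suc i) * real n) t u" using t by (auto simp: G_def)
      define k where "k = num_children t u"
      have "dist (X t) (circle_class (a i)) \<le> (4 * (c * real n) + 3) / real n + \<bar>real k / real n - a i\<bar>"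
        unfolding X_def circle_class_def k_def
        using u elim(3) alo[of i] by (intro gh_loop_circle) (auto simp: good_vertex_def)
      also have "(4 * (c * real n) + 3) / real n = 4 * c + 3 / real n" using elim(3) by (simp add: add_divide_distrib)
      also have "\<bar>real k / real n - a i\<bar> \<le> st"
      proof -
        have "a i * real n \<le> real k" "real k < a (Suc i) * real n" using u by (auto simp: good_vertex_def k_def)
        then have "a i \<le> real k / real n" "real k / real n < a (Suc i)" using elim(3) by (simp_all add: field_simps)
        then show ?thesis using aSuc[of i] by linarith
      qed
      finally have "dist (X t) (circle_class (a i)) \<le> 4 * c + 3 / real n + st" by simp
      then have "dist (circle_class (a i)) (X t) < d"
        unfolding dist_commute[of "circle_class (a i)"] using c(3) elim(2) st(2) by linarith
      then have "\<bar>f (X t) - h (a i)\<bar> < e1" unfolding h_def using ain[of i] i by (intro d(2)) auto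
      then show ?thesis unfolding v_def using f0[of "X t"] by linarith
    qed
    \<comment> \<open>Uniqueness of the good vertex makes the two witnesses equal, and its degree
      lies in only one cell.\<close>
    have disj: "i = j" if "t \<in> G n i" "t \<in> G n j" for i j t
    proof -
      obtain u w where u: "good_vertex (c * real n) (a i * real n) (a (Suc i) * real n) t u"
        and w: "good_vertex (c * real n) (a j * real n) (a (Suc j) * real n) t w"
        using \<open>t \<in> G n i\<close> \<open>t \<in> G n j\<close> by (auto simp: G_def)
      have "w = u" using elim(3) ca[of j] by (intro good_vertex_unique[OF u w]) simp
      then have "a i * real n < a (Suc j) * real n" "a j * real n < a (Suc i) * real n"
        using u w by (auto simp: good_vertex_def)
      then have "a i < a (Suc j)" "a j < a (Suc i)" using elim(3) by simp_all
      then have "i < Suc j" "j < Suc i" using amono[of "Suc j" i] amono[of "Suc i" j] by (meson not_less)+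
      then show ?thesis by simp
    qed
    have pw: "(\<Sum>i<N. v i * indicator (G n i) t) \<le> f (X t)" for t
    proof (cases "\<exists>i<N. t \<in> G n i")
      case True
      then obtain i where i: "i < N" "t \<in> G n i" by blast
      have "(\<Sum>j<N. v j * indicator (G n j) t) = (\<Sum>j\<in>{i}. v j * indicator (G n j) t)"
      proof (rule sum.mono_neutral_right)
        show "\<forall>j\<in>{..<N} - {i}. v j * indicator (G n j) t = 0"
        proof
          fix j assume "j \<in> {..<N} - {i}"
          then have "t \<notin> G n j" using disj[OF i(2), of j] by blast
          then show "v j * indicator (G n j) t = 0" by simp
        qed
      qed (use i in simp_all)
      then show ?thesis using close[OF i] i by simp
    next
      case False
      then have "(\<Sum>i<N. v i * indicator (G n i) t) = 0" by (intro sum.neutral) auto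
      then show ?thesis using f0 by simp
    qed
    have ind: "integrable ?U (\<lambda>t. r * indicator A t)" for A and r :: real
      by (intro integrable_mult_right integrable_real_indicator) (auto simp: U.emeasure_eq_measure)
    have "(\<Sum>i<N. v i * p i) - real N * B * e3 \<le> (\<Sum>i<N. v i * measure ?U (G n i))"
    proof -
      have "(\<Sum>i<N. v i * p i) - real N * B * e3 = (\<Sum>i<N. v i * p i - B * e3)"
        by (simp add: sum_subtractf)
      also have "\<dots> \<le> (\<Sum>i<N. v i * measure ?U (G n i))"
      proof (rule sum_mono)
        fix i assume "i \<in> {..<N}"
        then have "p i - e3 \<le> measure ?U (G n i)" using elim(1) by (simp add: less_imp_le)
        then have "v i * (p i - e3) \<le> v i * measure ?U (G n i)" using v by (intro mult_left_mono)
        moreover have "v i * e3 \<le> B * e3" using v e3 by (intro mult_right_mono) auto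
        ultimately show "v i * p i - B * e3 \<le> v i * measure ?U (G n i)" by (simp add: right_diff_distrib)
      qed
      finally show ?thesis .
    qed
    also have "\<dots> = (\<integral>t. (\<Sum>i<N. v i * indicator (G n i) t) \<partial>?U)"
      by (subst Bochner_Integration.integral_sum[OF ind]) simp
    also have "\<dots> \<le> (\<integral>t. f (X t) \<partial>?U)"
    proof (rule integral_mono)
      show "integrable ?U (\<lambda>t. f (X t))"
        by (rule U.integrable_const_bound[where B = B]) (use f0 fB meas in \<open>auto simp: abs_of_nonneg\<close>)
      show "integrable ?U (\<lambda>t. \<Sum>i<N. v i * indicator (G n i) t)"
        by (intro Bochner_Integration.integrable_sum ind)
    qed (rule pw)
    finally have "(\<Sum>i<N. v i * p i) - real N * B * e3 \<le> (\<integral>t. f (X t) \<partial>?U)" .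
    with bound e3(2) e show ?case unfolding X_def h_def by linarith
  qed
qed

end

theorem theorem1:
  fixes mu :: "nat pmf" and m beta :: real and L :: "real \<Rightarrow> real"
    and M :: "'a measure" and J :: "'a \<Rightarrow> real"
  assumes "offspring_distribution mu"
    and "(\<lambda>i. real i * pmf mu i) sums m" and "m < 1"
    and "beta > 1" and "slowly_varying L"
    and "\<And>i::nat. i \<ge> 1 \<Longrightarrow> measure_pmf.prob mu {i..} = L (real i) / real i powr beta"
    and "prob_space M" and "J \<in> borel_measurable M"
    and "\<And>x. x \<ge> 1 - m \<Longrightarrow> measure M {w \<in> space M. J w \<ge> x} = ((1 - m) / x) powr beta"
  shows "weakly_converges
     (\<lambda>n. distr (BGW_at_least mu n) borel (\<lambda>t. gh_class (scale_metric (1 / real n) (loop t))))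
     (distr M borel (\<lambda>w. gh_class (scale_metric (J w) unit_circle)))"
proof -
  interpret heavy_tailed mu m beta L
    using assms by unfold_locales (auto simp: offspring_distribution_def)
  interpret M: prob_space M by fact
  note [measurable] = \<open>J \<in> borel_measurable M\<close>
  show ?thesis
    unfolding weakly_converges_def
  proof (intro allI impI)
    fix f :: "gh_space \<Rightarrow> real"
    assume f: "continuous_on UNIV f" and "bounded (range f)"
    then obtain B where B: "\<And>x. \<bar>f x\<bar> \<le> B" by (auto simp: bounded_real)
    have fm[measurable]: "f \<in> borel_measurable borel" by (rule borel_measurable_continuous_onI[OF f])
    let ?X = "\<lambda>n t. gh_class (scale_metric (1 / real n) (loop t))"
    let ?U = "\<lambda>n. uniform_measure bgw {t. n \<le> tsize t}"
    have U: "BGW_at_least mu n = ?U n" for n by (simp add: BGW_at_least_def BGW_eq)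
    have cm[measurable]: "circle_class \<in> borel_measurable borel"
      unfolding circle_class_def[abs_def] by (rule measurable_gh_class_scale[OF compact_metric_unit_circle])
    have left: "(\<integral>x. f x \<partial>distr (BGW_at_least mu n) borel (?X n)) = (\<integral>t. f (?X n t) \<partial>?U n)" for n
      by (subst integral_distr[OF measurable_BGW_at_least fm]) (simp add: U)
    have right: "(\<integral>x. f x \<partial>distr M borel (\<lambda>w. gh_class (scale_metric (J w) unit_circle))) = (\<integral>w. f (circle_class (J w)) \<partial>M)"
      unfolding circle_class_def[symmetric] by (intro integral_distr) measurable
    have intU: "integrable (?U n) (\<lambda>t. f (?X n t))" for n
    proof -
      interpret U: prob_space "?U n" by (rule prob_space_conditioned)
      show ?thesis by (rule U.integrable_const_bound[where B = B]) (use B in \<open>auto simp: measurable_def\<close>)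
    qed
    have intM: "integrable M (\<lambda>w. f (circle_class (J w)))"
      by (rule M.integrable_const_bound[where B = B]) (use B in auto)
    \<comment> \<open>Adding \<open>B\<close> makes both \<open>f\<close> and \<open>- f\<close>
      nonnegative; under a probability measure the constant integrates to itself and cancels in the
      comparison.\<close>
    have addU: "(\<integral>t. B + s * f (?X n t) \<partial>?U n) = B + s * (\<integral>t. f (?X n t) \<partial>?U n)" for n s
    proof -
      interpret U: prob_space "?U n" by (rule prob_space_conditioned)
      have "U.prob UNIV = 1" using U.prob_space by simp
      then show ?thesis using intU by simp
    qed
    have addM: "(\<integral>w. B + s * f (circle_class (J w)) \<partial>M) = B + s * (\<integral>w. f (circle_class (J w)) \<partial>M)" for s
      using intM by (simp add: M.prob_space)
    have half: "eventually (\<lambda>n. s * (\<integral>w. f (circle_class (J w)) \<partial>M) - e \<le> s * (\<integral>t. f (?X n t) \<partial>?U n)) sequentially"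
      if "s = 1 \<or> s = -1" "0 < e" for s e
    proof -
      have "eventually (\<lambda>n. (\<integral>w. B + s * f (circle_class (J w)) \<partial>M) - e \<le> (\<integral>t. B + s * f (?X n t) \<partial>?U n)) sequentially"
      proof (rule conditioned_liminf[where f = "\<lambda>x. B + s * f x" and B = "2 * B"])
        show "continuous_on UNIV (\<lambda>x. B + s * f x)" by (intro continuous_intros f)
        fix x
        show "0 \<le> B + s * f x" "B + s * f x \<le> 2 * B" using that(1) B[of x] by (auto simp: abs_le_iff)
      qed (use assms that in auto)
      then show ?thesis unfolding addU addM by eventually_elim simp
    qed
    show "(\<lambda>n. \<integral>x. f x \<partial>distr (BGW_at_least mu n) borel (?X n)) \<longlonglongrightarrow>
        (\<integral>x. f x \<partial>distr M borel (\<lambda>w. gh_class (scale_metric (J w) unit_circle)))"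
      unfolding left right
    proof (rule tendstoI)
      fix e :: real assume "0 < e"
      then have "eventually (\<lambda>n. 1 * (\<integral>w. f (circle_class (J w)) \<partial>M) - e / 2 \<le> 1 * (\<integral>t. f (?X n t) \<partial>?U n)) sequentially"
        "eventually (\<lambda>n. (-1) * (\<integral>w. f (circle_class (J w)) \<partial>M) - e / 2 \<le> (-1) * (\<integral>t. f (?X n t) \<partial>?U n)) sequentially"
        by (intro half; simp)+
      then show "eventually (\<lambda>n. dist (\<integral>t. f (?X n t) \<partial>?U n) (\<integral>w. f (circle_class (J w)) \<partial>M) < e) sequentially"
      proof eventually_elim
        case (elim n)
        then show ?case using \<open>0 < e\<close> unfolding dist_real_def by linarith
      qed
    qed
  qed
qed

end
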